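(* Let $p_1,p_2,p_3\in S^2$ be distinct points and let $\beta_1\le\beta_2\le\beta_3$ be positive integers. Then there exists $d\sigma^2\in\mathrm{Met}(S^2)$ with divisor $\beta_1p_1+\beta_2p_2+\beta_3p_3$ if and only if there exist a non-negative integer $N$ and mutually distinct complex numbers $a_1,\dots,a_N\in\mathbb{C}\setminus\{0,1\}$ which satisfy $$\beta_1+\beta_2-\beta_3=2N$$ and $$\frac{\beta_1}{a_j}+\frac{\beta_2}{a_j-1}-\sum_{k\ne j}\frac{2}{a_j-a_k}=0\qquad(j=1,\dots,N),$$ where the sum is over $1\le k\le N$, $k\neq j$ (for $N=0$ the second condition is void).
   Context: $S^2=\mathbb{C}\cup\{\infty\}$ is the Riemann sphere. A conformal positive semidefinite metric $d\sigma^2$ on $S^2$ has a conical singularity of order $\beta>-1$ at $p$ if, in a complex local coordinate $z$ around $p$, it is asymptotic to $C|z-z(p)|^{2\beta}\,dz\,d\bar z$ at $p$ for some constant $C>0$. $\mathrm{Met}(S^2)$ is the set of (non-vanishing) conformal pseudometrics of constant curvature $1$ on $S^2$ with finitely many conical singularities. If the conical singularities of $d\sigma^2$ are at $p_1,\dots,p_n$ with orders $\beta_1,\dots,\beta_n$ (and $d\sigma^2$ is a regular metric elsewhere), the formal sum $\beta_1p_1+\cdots+\beta_np_n$ is the divisor of $d\sigma^2$. *)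

theory Defs
  imports
    "HOL-Analysis.Analysis"
    "HOL-Library.Landau_Symbols"
    "HOL-Library.Poly_Mapping"
begin

datatype riemann_sphere = Pt complex | Infty

text \<open>
  A conformal (pseudo)metric on the sphere is given by its coefficients in the two standard
  charts: it is \<open>coeff_z g z * |dz|^2\<close> on the complex plane and \<open>coeff_w g w * |dw|^2\<close> in the
  coordinate \<open>w = 1/z\<close> around infinity. The values of the coefficients at a conical singularity
  carry no information.
\<close>

record conformal_form =
  coeff_z :: "complex \<Rightarrow> real"
  coeff_w :: "complex \<Rightarrow> real"

text \<open>The transformation law expresses \<open>|dz|^2 = |dw|^2 / |w|^4\<close> for \<open>z = 1/w\<close>.\<close>

definition conformal_pseudometric :: "conformal_form \<Rightarrow> bool" where
  "conformal_pseudometric g \<longleftrightarrow>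
     (\<forall>z. coeff_z g z \<ge> 0) \<and> (\<forall>w. coeff_w g w \<ge> 0) \<and>
     (\<forall>w. w \<noteq> 0 \<longrightarrow> coeff_w g w = coeff_z g (1 / w) / norm w ^ 4)"

text \<open>The standard local coordinate around a point: its value there, and the coefficient of the
  metric with respect to it.\<close>

fun coord :: "riemann_sphere \<Rightarrow> complex" where
  "coord (Pt a) = a"
| "coord Infty = 0"

fun coeff_at :: "conformal_form \<Rightarrow> riemann_sphere \<Rightarrow> complex \<Rightarrow> real" where
  "coeff_at g (Pt a) = coeff_z g"
| "coeff_at g Infty = coeff_w g"

text \<open>Real \<open>C^k\<close> and \<open>C^\<infinity>\<close> regularity; intended for open \<open>S\<close>.\<close>

primrec Ck_on :: "nat \<Rightarrow> complex set \<Rightarrow> (complex \<Rightarrow> real) \<Rightarrow> bool" where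
  "Ck_on 0 S f \<longleftrightarrow> continuous_on S f"
| "Ck_on (Suc k) S f \<longleftrightarrow>
     (\<forall>x\<in>S. f differentiable (at x)) \<and>
     (\<forall>v. Ck_on k S (\<lambda>x. frechet_derivative f (at x) v))"

definition smooth_on :: "complex set \<Rightarrow> (complex \<Rightarrow> real) \<Rightarrow> bool" where
  "smooth_on S f \<longleftrightarrow> (\<forall>k. Ck_on k S f)"

definition directional_deriv :: "complex \<Rightarrow> (complex \<Rightarrow> real) \<Rightarrow> complex \<Rightarrow> real" where
  "directional_deriv v f = (\<lambda>x. frechet_derivative f (at x) v)"

definition laplacian :: "(complex \<Rightarrow> real) \<Rightarrow> complex \<Rightarrow> real" where
  "laplacian f x =
     directional_deriv 1 (directional_deriv 1 f) x
     + directional_deriv \<i> (directional_deriv \<i> f) x"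

definition regular_at :: "conformal_form \<Rightarrow> riemann_sphere \<Rightarrow> bool" where
  "regular_at g p \<longleftrightarrow>
     (\<exists>r>0. smooth_on (ball (coord p) r) (coeff_at g p) \<and>
            (\<forall>x\<in>ball (coord p) r. coeff_at g p x > 0))"

text \<open>Gaussian curvature: a conformal metric \<open>\<rho> |dz|^2 = exp (2 u) |dz|^2\<close> has curvature
  \<open>- exp (- 2 u) \<Delta> u\<close> with \<open>u = ln \<rho> / 2\<close>.\<close>

definition gauss_curvature :: "conformal_form \<Rightarrow> riemann_sphere \<Rightarrow> real" where
  "gauss_curvature g p =
     - laplacian (\<lambda>x. ln (coeff_at g p x)) (coord p) / (2 * coeff_at g p (coord p))"

definition conical_at :: "conformal_form \<Rightarrow> riemann_sphere \<Rightarrow> real \<Rightarrow> bool" where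
  "conical_at g p \<beta> \<longleftrightarrow> \<beta> > -1 \<and>
     (\<exists>C>0. coeff_at g p \<sim>[at (coord p)] (\<lambda>x. C * norm (x - coord p) powr (2 * \<beta>)))"

text \<open>Divisors are finitely supported formal sums of points with real coefficients.
  A point of order \<open>0\<close> counts as a regular point, not as a conical singularity.\<close>

definition has_divisor :: "conformal_form \<Rightarrow> (riemann_sphere \<Rightarrow>\<^sub>0 real) \<Rightarrow> bool" where
  "has_divisor g D \<longleftrightarrow>
     (\<forall>p \<in> Poly_Mapping.keys D. conical_at g p (Poly_Mapping.lookup D p)) \<and> (\<forall>p. p \<notin> Poly_Mapping.keys D \<longrightarrow> regular_at g p)"

text \<open>Members are automatically not identically zero: coefficients are positive at regular points.\<close>

definition Met :: "conformal_form set" where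
  "Met = {g. conformal_pseudometric g \<and>
             (\<exists>D. has_divisor g D \<and> (\<forall>p. p \<notin> Poly_Mapping.keys D \<longrightarrow> gauss_curvature g p = 1))}"

end

(*
  Write a metric of curvature 1 as h^(-2) |dz|^2. Then h solves h_zz = -T h with a holomorphic
  potential T (half the Schwarzian of a developing map), so locally h is a positive definite
  Hermitian form in two solutions of y'' + T y = 0. Pulled back to a half plane by the exponential
  map, this form is preserved by the monodromy around a conical point of order b, so the monodromy
  is diagonalisable and unitary; comparing growth with h gives a solution z^(-b/2) Y(z) with
  Y holomorphic and Y(0) nonzero. Hence T has a double pole with leading coefficient
  -(b/2)(b/2 + 1), and the equation has no logarithmic term at the smallest of the three integral
  orders. By Liouville's theorem the three double poles determine T, the equation for Y becomes
  hypergeometric, and the absence of a logarithm forces b1 + b2 - b3 = 2N with N a natural number.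

  For such N the hypergeometric equation has polynomial solutions Q of degree N and P of degree
  b1 + b2 + 1 - N whose Wronskian is a multiple of x^b1 (x - 1)^b2. The roots of Q solve the
  algebraic system, and the pullback of the Fubini-Study metric by P/Q is the required metric.
  In particular, the system is solvable exactly when b1 + b2 - b3 is even and nonnegative.
*)

theory Submission
  imports Defs "HOL-Complex_Analysis.Complex_Analysis"
    "HOL-Computational_Algebra.Fundamental_Theorem_Algebra"
begin

section \<open>Wirtinger calculus\<close>

text \<open>The power \<open>\<rho>^(-1/2)\<close> is chosen because it makes the curvature equation
  quadratic: \<open>h h_(z zbar) - h_z h_zbar = 1/4\<close>. Differentiating once more in z leaves
  the statement that \<open>h_zz / h\<close> is holomorphic, and this quotient is - T. The obstacle
  is multivaluedness: solutions of the linear equation branch at the punctures. They are therefore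
  only considered on convex sets, where primitives are global. Around a puncture the convex set is a
  left half plane mapped by \<open>exp\<close>, and one turn becomes the translation by 2 pi i. What
  is pulled back is the single-valued \<open>h\<close>. The position of the orders matters. With the
  least order at 0 and the greatest at infinity, the condition for the absence of a logarithm yields
  a natural number equal to (b1 + b2 - b3) / 2, so parity and b3 \<le> b1 + b2 come together. At the
  point of greatest order it would give parity only. Infinity is treated like any other point:
  points, Moebius maps and polynomials are written in homogeneous coordinates, so that one
  computation serves both charts.\<close>

definition has_wirt :: "(complex \<Rightarrow> complex) \<Rightarrow> complex \<Rightarrow> complex \<Rightarrow> complex \<Rightarrow> bool" where
  "has_wirt F z a b \<longleftrightarrow> (F has_derivative (\<lambda>v. a * v + b * cnj v)) (at z)"

definition dz :: "(complex \<Rightarrow> complex) \<Rightarrow> complex \<Rightarrow> complex" where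
  "dz F z = (frechet_derivative F (at z) 1 - \<i> * frechet_derivative F (at z) \<i>) / 2"

definition dzb :: "(complex \<Rightarrow> complex) \<Rightarrow> complex \<Rightarrow> complex" where
  "dzb F z = (frechet_derivative F (at z) 1 + \<i> * frechet_derivative F (at z) \<i>) / 2"

lemma has_wirtD:
  assumes "has_wirt F z a b"
  shows "dz F z = a" "dzb F z = b" "F differentiable (at z)"
proof -
  have d: "frechet_derivative F (at z) = (\<lambda>v. a * v + b * cnj v)"
    using assms frechet_derivative_at unfolding has_wirt_def by metis
  show "dz F z = a" "dzb F z = b" unfolding dz_def dzb_def d by (auto simp: algebra_simps)
  show "F differentiable (at z)" using assms unfolding has_wirt_def differentiable_def by blast
qed

lemma complex_linear_decomp:
  assumes "linear (D :: complex \<Rightarrow> complex)"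
  shows "D v = (D 1 - \<i> * D \<i>) / 2 * v + (D 1 + \<i> * D \<i>) / 2 * cnj v"
proof -
  have "v = Re v *\<^sub>R 1 + Im v *\<^sub>R \<i>" by (simp add: complex_eq_iff)
  then have "D v = Re v *\<^sub>R D 1 + Im v *\<^sub>R D \<i>"
    by (metis assms linear_add linear_scale)
  then show ?thesis by (simp add: complex_eq_iff field_simps)
qed

lemma has_wirtI: "F differentiable (at z) \<Longrightarrow> has_wirt F z (dz F z) (dzb F z)"
  unfolding has_wirt_def dz_def dzb_def
  using complex_linear_decomp[OF linear_frechet_derivative] frechet_derivative_works
  by (metis (no_types, lifting) ext)

lemma has_wirt_const: "has_wirt (\<lambda>_. c) z 0 0"
  unfolding has_wirt_def by simp

lemma has_wirt_field: "(F has_field_derivative d) (at z) \<Longrightarrow> has_wirt F z d 0"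
  unfolding has_wirt_def has_field_derivative_def by simp

lemma has_wirt_cnj:
  assumes "has_wirt F z a b" shows "has_wirt (\<lambda>z. cnj (F z)) z (cnj b) (cnj a)"
  using has_derivative_cnj[OF assms[unfolded has_wirt_def]] unfolding has_wirt_def
  by (simp add: add.commute)

lemma has_wirt_add:
  "has_wirt F z a b \<Longrightarrow> has_wirt G z c d \<Longrightarrow> has_wirt (\<lambda>z. F z + G z) z (a + c) (b + d)"
  unfolding has_wirt_def
  by (drule (1) has_derivative_add) (simp add: algebra_simps)

lemma has_wirt_diff:
  "has_wirt F z a b \<Longrightarrow> has_wirt G z c d \<Longrightarrow> has_wirt (\<lambda>z. F z - G z) z (a - c) (b - d)"
  unfolding has_wirt_def
  by (drule (1) has_derivative_diff) (simp add: algebra_simps)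

lemma has_wirt_mult:
  "has_wirt F z a b \<Longrightarrow> has_wirt G z c d \<Longrightarrow>
    has_wirt (\<lambda>z. F z * G z) z (F z * c + a * G z) (F z * d + b * G z)"
  unfolding has_wirt_def
  by (drule (1) has_derivative_mult) (simp add: algebra_simps)

lemma has_wirt_outer:
  assumes "has_wirt F z a b" "(g has_field_derivative d) (at (F z))"
  shows "has_wirt (\<lambda>z. g (F z)) z (d * a) (d * b)"
proof -
  have "((\<lambda>z. g (F z)) has_derivative (\<lambda>v. d * (a * v + b * cnj v))) (at z)"
    using assms unfolding has_wirt_def has_field_derivative_def
    by (rule has_derivative_compose)
  then show ?thesis unfolding has_wirt_def by (simp add: algebra_simps)
qed

lemma has_wirt_inner:
  assumes "has_wirt F (\<phi> z) a b" "(\<phi> has_field_derivative d) (at z)"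
  shows "has_wirt (\<lambda>z. F (\<phi> z)) z (a * d) (b * cnj d)"
proof -
  have "((\<lambda>z. F (\<phi> z)) has_derivative (\<lambda>v. a * (d * v) + b * cnj (d * v))) (at z)"
    using assms(2,1) unfolding has_wirt_def has_field_derivative_def
    by (rule has_derivative_compose)
  then show ?thesis unfolding has_wirt_def by (simp add: algebra_simps)
qed

lemma wirt_cong:
  assumes "open S" "z \<in> S" "\<And>x. x \<in> S \<Longrightarrow> F x = G x"
  shows "dz F z = dz G z" "dzb F z = dzb G z"
proof -
  have "(F has_derivative D) (at z) \<longleftrightarrow> (G has_derivative D) (at z)" for D
    by (rule iffI; erule has_derivative_transform_within_open[OF _ assms(1,2)]) (simp_all add: assms(3))
  then have "frechet_derivative F (at z) = frechet_derivative G (at z)"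
    unfolding frechet_derivative_def by simp
  then show "dz F z = dz G z" "dzb F z = dzb G z" unfolding dz_def dzb_def by simp_all
qed

text \<open>Iterating only \<open>dz\<close> and \<open>dzb\<close> is enough, since they span all
  directional derivatives. Closure under products and compositions then takes two cases per order,
  not one for every direction as in \<open>Ck_on\<close>.\<close>

primrec wirt_smooth :: "nat \<Rightarrow> complex set \<Rightarrow> (complex \<Rightarrow> complex) \<Rightarrow> bool" where
  "wirt_smooth 0 S F \<longleftrightarrow> continuous_on S F"
| "wirt_smooth (Suc k) S F \<longleftrightarrow> (\<forall>x\<in>S. F differentiable (at x)) \<and> wirt_smooth k S (dz F) \<and> wirt_smooth k S (dzb F)"

lemma wirt_smooth_cong:
  "open S \<Longrightarrow> (\<And>x. x \<in> S \<Longrightarrow> F x = G x) \<Longrightarrow> wirt_smooth k S F \<Longrightarrow> wirt_smooth k S G"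
proof (induction k arbitrary: F G)
  case 0 then show ?case by (simp cong: continuous_on_cong)
next
  case (Suc k)
  have "G differentiable (at x)" if "x \<in> S" for x
  proof -
    obtain D where D: "(F has_derivative D) (at x)"
      using Suc.prems(3) \<open>x \<in> S\<close> unfolding differentiable_def wirt_smooth.simps(2) by blast
    show ?thesis unfolding differentiable_def
      using has_derivative_transform_within_open[OF D Suc.prems(1) \<open>x \<in> S\<close> Suc.prems(2)] by blast
  qed
  moreover have "wirt_smooth k S (dz G)"
    by (rule Suc.IH[OF Suc.prems(1), of "dz F"])
       (use Suc.prems(3) wirt_cong(1)[OF Suc.prems(1) _ Suc.prems(2)] in auto)
  moreover have "wirt_smooth k S (dzb G)"
    by (rule Suc.IH[OF Suc.prems(1), of "dzb F"])
       (use Suc.prems(3) wirt_cong(2)[OF Suc.prems(1) _ Suc.prems(2)] in auto)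
  ultimately show ?case by simp
qed

lemma wirt_smooth_SucI:
  assumes "open S" "\<And>x. x \<in> S \<Longrightarrow> has_wirt F x (A x) (B x)" "wirt_smooth k S A" "wirt_smooth k S B"
  shows "wirt_smooth (Suc k) S F"
proof -
  have "wirt_smooth k S (dz F)" by (rule wirt_smooth_cong[OF assms(1) _ assms(3)]) (simp add: has_wirtD(1)[OF assms(2)])
  moreover have "wirt_smooth k S (dzb F)" by (rule wirt_smooth_cong[OF assms(1) _ assms(4)]) (simp add: has_wirtD(2)[OF assms(2)])
  ultimately show ?thesis using has_wirtD(3)[OF assms(2)] by simp
qed

lemma wirt_smooth_wirt: "wirt_smooth (Suc k) S F \<Longrightarrow> x \<in> S \<Longrightarrow> has_wirt F x (dz F x) (dzb F x)"
  by (simp add: has_wirtI)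

lemma wirt_smooth_subset: "wirt_smooth k S F \<Longrightarrow> T \<subseteq> S \<Longrightarrow> wirt_smooth k T F"
proof (induction k arbitrary: F)
  case 0 then show ?case using continuous_on_subset by auto
qed auto

lemma wirt_smooth_down: "wirt_smooth (Suc k) S F \<Longrightarrow> wirt_smooth k S F"
proof (induction k arbitrary: F)
  case 0 then show ?case
    by (simp add: continuous_at_imp_continuous_on differentiable_imp_continuous_within)
next
  case (Suc k)
  from Suc.prems have a: "\<forall>x\<in>S. F differentiable (at x)" "wirt_smooth (Suc k) S (dz F)" "wirt_smooth (Suc k) S (dzb F)"
    unfolding wirt_smooth.simps(2)[of "Suc k"] by blast+
  show ?case unfolding wirt_smooth.simps(2) using a Suc.IH by blast
qed

lemma wirt_smooth_const: "wirt_smooth k S (\<lambda>_. c)"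
proof (induction k arbitrary: c)
  case (Suc k)
  have "dz (\<lambda>_. c) = (\<lambda>_. 0)" "dzb (\<lambda>_. c) = (\<lambda>_. 0)"
    using has_wirtD[OF has_wirt_const] by auto
  then show ?case using Suc by simp
qed simp

lemma wirt_smooth_add: "open S \<Longrightarrow> wirt_smooth k S F \<Longrightarrow> wirt_smooth k S G \<Longrightarrow> wirt_smooth k S (\<lambda>x. F x + G x)"
proof (induction k arbitrary: F G)
  case 0 then show ?case by (auto intro: continuous_intros)
next
  case (Suc k)
  show ?case
    by (rule wirt_smooth_SucI[OF Suc.prems(1) has_wirt_add[OF wirt_smooth_wirt[OF Suc.prems(2)] wirt_smooth_wirt[OF Suc.prems(3)]]])
       (use Suc in auto)
qed

lemma wirt_smooth_mult: "open S \<Longrightarrow> wirt_smooth k S F \<Longrightarrow> wirt_smooth k S G \<Longrightarrow> wirt_smooth k S (\<lambda>x. F x * G x)"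
proof (induction k arbitrary: F G)
  case 0 then show ?case by (auto intro: continuous_intros)
next
  case (Suc k)
  note d = wirt_smooth_down[OF Suc.prems(2)] wirt_smooth_down[OF Suc.prems(3)]
  show ?case
    by (rule wirt_smooth_SucI[OF Suc.prems(1) has_wirt_mult[OF wirt_smooth_wirt[OF Suc.prems(2)] wirt_smooth_wirt[OF Suc.prems(3)]]])
       (use Suc.IH Suc.prems d wirt_smooth_add in auto)
qed

lemma wirt_smooth_cnj: "open S \<Longrightarrow> wirt_smooth k S F \<Longrightarrow> wirt_smooth k S (\<lambda>x. cnj (F x))"
proof (induction k arbitrary: F)
  case 0 then show ?case by (auto intro: continuous_intros)
next
  case (Suc k)
  show ?case
    by (rule wirt_smooth_SucI[OF Suc.prems(1) has_wirt_cnj[OF wirt_smooth_wirt[OF Suc.prems(2)]]]) (use Suc in auto)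
qed

lemma holomorphic_derivD:
  "g holomorphic_on U \<Longrightarrow> open U \<Longrightarrow> x \<in> U \<Longrightarrow> (g has_field_derivative deriv g x) (at x)"
  by (rule holomorphic_derivI)

lemma wirt_smooth_outer:
  "open S \<Longrightarrow> open U \<Longrightarrow> g holomorphic_on U \<Longrightarrow> wirt_smooth k S F \<Longrightarrow> F ` S \<subseteq> U \<Longrightarrow> wirt_smooth k S (\<lambda>x. g (F x))"
proof (induction k arbitrary: g)
  case 0 then show ?case
    by (auto intro: continuous_on_compose2[OF holomorphic_on_imp_continuous_on])
next
  case (Suc k)
  have "wirt_smooth k S (\<lambda>x. deriv g (F x))"
    using Suc.IH[of "deriv g"] Suc.prems wirt_smooth_down holomorphic_deriv by blast
  then show ?case using Suc.prems
    by (intro wirt_smooth_SucI[OF Suc.prems(1) has_wirt_outer[OF wirt_smooth_wirt[OF Suc.prems(4)] holomorphic_derivD[OF Suc.prems(3,2)]]])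
       (auto intro!: wirt_smooth_mult)
qed

lemma wirt_smooth_holomorphic: "open S \<Longrightarrow> F holomorphic_on S \<Longrightarrow> wirt_smooth k S F"
proof (induction k arbitrary: F)
  case 0 then show ?case by (simp add: holomorphic_on_imp_continuous_on)
next
  case (Suc k)
  show ?case
    by (rule wirt_smooth_SucI[OF Suc.prems(1) has_wirt_field[OF holomorphic_derivD[OF Suc.prems(2,1)]]])
       (use Suc wirt_smooth_const holomorphic_deriv in auto)
qed

lemma wirt_smooth_inner:
  "open S \<Longrightarrow> open T \<Longrightarrow> \<phi> holomorphic_on T \<Longrightarrow> \<phi> ` T \<subseteq> S \<Longrightarrow> wirt_smooth k S F \<Longrightarrow> wirt_smooth k T (\<lambda>x. F (\<phi> x))"
proof (induction k arbitrary: F)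
  case 0 then show ?case
    by (auto intro: continuous_on_compose2[OF _ holomorphic_on_imp_continuous_on])
next
  case (Suc k)
  have 1: "wirt_smooth k T (\<lambda>x. dz F (\<phi> x))" "wirt_smooth k T (\<lambda>x. dzb F (\<phi> x))" "wirt_smooth k T (deriv \<phi>)"
    using Suc wirt_smooth_holomorphic holomorphic_deriv by auto
  show ?case
    by (rule wirt_smooth_SucI[OF Suc.prems(2) has_wirt_inner[OF wirt_smooth_wirt[OF Suc.prems(5)] holomorphic_derivD[OF Suc.prems(3,2)]]])
      (use 1 Suc.prems wirt_smooth_mult wirt_smooth_cnj in auto)
qed

lemma wirt_smooth_dz: "wirt_smooth (Suc k) S F \<Longrightarrow> wirt_smooth k S (dz F)" and sm_dzb: "wirt_smooth (Suc k) S F \<Longrightarrow> wirt_smooth k S (dzb F)"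
  by simp_all

lemma wirt_smooth_UN:
  assumes "\<And>x. x \<in> S \<Longrightarrow> \<exists>T. open T \<and> x \<in> T \<and> wirt_smooth k T F" shows "wirt_smooth k S F"
  using assms
proof (induction k arbitrary: F)
  case 0
  have "isCont F x" if "x \<in> S" for x
  proof -
    obtain T where "open T" "x \<in> T" "continuous_on T F" using 0[OF \<open>x \<in> S\<close>] by auto
    then show ?thesis by (simp add: continuous_on_eq_continuous_at)
  qed
  then show ?case unfolding wirt_smooth.simps(1) by (intro continuous_at_imp_continuous_on ballI)
next
  case (Suc k)
  have ex: "\<exists>T. open T \<and> x \<in> T \<and> wirt_smooth (Suc k) T F" if "x \<in> S" for x by (rule Suc.prems[OF that])
  have "wirt_smooth k S (dz F)" "wirt_smooth k S (dzb F)"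
    by (rule Suc.IH, drule ex, force)+
  moreover have "F differentiable (at x)" if "x \<in> S" for x using ex[OF that] by auto
  ultimately show ?case by simp
qed

section \<open>Symmetry of second derivatives\<close>

lemma second_difference_mvt:
  fixes f fa fab :: "complex \<Rightarrow> real"
  assumes fa: "\<And>x. x \<in> ball z0 r \<Longrightarrow> ((\<lambda>s. f (x + of_real s * a)) has_real_derivative fa x) (at 0)"
    and fab: "\<And>x. x \<in> ball z0 r \<Longrightarrow> ((\<lambda>s. fa (x + of_real s * b)) has_real_derivative fab x) (at 0)"
    and t: "0 < t" "2 * t < r" and ab: "norm a = 1" "norm b = 1"
  shows "\<exists>w\<in>cball z0 (2 * t).
           f (z0 + of_real t * a + of_real t * b) - f (z0 + of_real t * a)
             - f (z0 + of_real t * b) + f z0 = t * t * fab w"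
proof -
  have inball: "z0 + of_real u * a + of_real v * b \<in> cball z0 (2 * t)"
    if "0 \<le> u" "u \<le> t" "0 \<le> v" "v \<le> t" for u v
  proof -
    have "norm (of_real u * a + of_real v * b) \<le> norm (of_real u * a) + norm (of_real v * b)"
      by (rule norm_triangle_ineq)
    also have "\<dots> = u + v" using that ab by (simp add: norm_mult)
    finally have "norm (of_real u * a + of_real v * b) \<le> 2 * t" using that by simp
    moreover have "dist z0 (z0 + X) = norm X" for X by (simp add: dist_norm)
    ultimately show ?thesis unfolding mem_cball by (simp only: add.assoc)
  qed
  have inball': "z0 + of_real u * a + of_real v * b \<in> ball z0 r"
    if "0 \<le> u" "u \<le> t" "0 \<le> v" "v \<le> t" for u v
    using inball[OF that] t by simp
  have shift: "((\<lambda>s. F (y + of_real s * c)) has_real_derivative D) (at u)"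
    if "((\<lambda>s. F ((y + of_real u * c) + of_real s * c)) has_real_derivative D) (at 0)"
    for F :: "complex \<Rightarrow> real" and y c D u
    using that DERIV_shift[of "\<lambda>s. F (y + of_real s * c)" D 0 u] by (simp add: algebra_simps)
  define g where "g s = f (z0 + of_real t * b + of_real s * a) - f (z0 + of_real s * a)" for s :: real
  have "(g has_real_derivative (fa (z0 + of_real t * b + of_real s * a) - fa (z0 + of_real s * a))) (at s)"
    if s: "0 \<le> s" "s \<le> t" for s
  proof -
    have "((\<lambda>s. f (z0 + of_real t * b + of_real s * a)) has_real_derivative fa (z0 + of_real t * b + of_real s * a)) (at s)"
      by (rule shift, rule fa) (use inball'[of s t] s t in \<open>simp add: algebra_simps\<close>)
    moreover have "((\<lambda>s. f (z0 + of_real s * a)) has_real_derivative fa (z0 + of_real s * a)) (at s)"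
      by (rule shift, rule fa) (use inball'[of s 0] s t in \<open>simp add: algebra_simps\<close>)
    ultimately show ?thesis unfolding g_def by (rule DERIV_diff)
  qed
  from MVT2[OF t(1) this] obtain \<xi> where \<xi>: "0 < \<xi>" "\<xi> < t"
    "g t - g 0 = (t - 0) * (fa (z0 + of_real t * b + of_real \<xi> * a) - fa (z0 + of_real \<xi> * a))" by blast
  have "((\<lambda>s. fa (z0 + of_real \<xi> * a + of_real s * b)) has_real_derivative fab (z0 + of_real \<xi> * a + of_real s * b)) (at s)"
    if s: "0 \<le> s" "s \<le> t" for s
    by (rule shift, rule fab) (use inball'[of \<xi> s] s \<xi> in \<open>simp add: algebra_simps\<close>)
  from MVT2[OF t(1) this] obtain \<eta> where \<eta>: "0 < \<eta>" "\<eta> < t"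
    "fa (z0 + of_real \<xi> * a + of_real t * b) - fa (z0 + of_real \<xi> * a + of_real 0 * b)
      = (t - 0) * fab (z0 + of_real \<xi> * a + of_real \<eta> * b)" by blast
  have "f (z0 + of_real t * a + of_real t * b) - f (z0 + of_real t * a)
             - f (z0 + of_real t * b) + f z0 = g t - g 0"
    by (simp add: g_def algebra_simps)
  also have "\<dots> = t * t * fab (z0 + of_real \<xi> * a + of_real \<eta> * b)"
    using \<xi>(3) \<eta>(3) by (simp add: algebra_simps)
  finally show ?thesis using inball[of \<xi> \<eta>] \<xi> \<eta> by (intro bexI) auto
qed

lemma has_wirt_directional:
  assumes "has_wirt F x p q"
  shows "((\<lambda>s. Re (c * F (x + of_real s * a))) has_real_derivative Re (c * (p * a + q * cnj a))) (at 0)"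
proof -
  have F: "(F has_derivative (\<lambda>v. p * v + q * cnj v)) (at (x + of_real 0 * a))"
    using assms unfolding has_wirt_def by simp
  have "((\<lambda>s. x + of_real s * a) has_derivative (\<lambda>s. of_real s * a)) (at (0::real))"
    by (auto intro!: derivative_eq_intros)
  from has_derivative_compose[OF this F]
  have "((\<lambda>s. F (x + of_real s * a)) has_derivative (\<lambda>s. p * (of_real s * a) + q * cnj (of_real s * a))) (at 0)" .
  then have "((\<lambda>s. Re (c * F (x + of_real s * a))) has_derivative (\<lambda>s. Re (c * (p * (of_real s * a) + q * cnj (of_real s * a))))) (at 0)"
    by (auto intro!: derivative_eq_intros)
  moreover have "(\<lambda>s. Re (c * (p * (of_real s * a) + q * cnj (of_real s * a)))) = (*) (Re (c * (p * a + q * cnj a)))"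
    by (auto simp: algebra_simps)
  ultimately show ?thesis unfolding has_field_derivative_def by simp
qed

text \<open>The second difference of step \<open>t\<close> along \<open>a\<close> and
  \<open>b\<close> is symmetric in the two directions. Two applications of the mean value theorem
  (\<open>second_difference_mvt\<close>) express it as \<open>t * t\<close> times a value near
  \<open>z0\<close> of either mixed derivative, so continuity at \<open>z0\<close> makes them
  agree.\<close>

lemma symmetric_mixed_derivative:
  fixes f fa fb fab fba :: "complex \<Rightarrow> real"
  assumes S: "open S" "z0 \<in> S"
    and fa: "\<And>x. x \<in> S \<Longrightarrow> ((\<lambda>s. f (x + of_real s * a)) has_real_derivative fa x) (at 0)"
    and fb: "\<And>x. x \<in> S \<Longrightarrow> ((\<lambda>s. f (x + of_real s * b)) has_real_derivative fb x) (at 0)"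
    and fab: "\<And>x. x \<in> S \<Longrightarrow> ((\<lambda>s. fa (x + of_real s * b)) has_real_derivative fab x) (at 0)"
    and fba: "\<And>x. x \<in> S \<Longrightarrow> ((\<lambda>s. fb (x + of_real s * a)) has_real_derivative fba x) (at 0)"
    and cont: "isCont fab z0" "isCont fba z0"
    and ab: "norm a = 1" "norm b = 1"
  shows "fab z0 = fba z0"
proof (rule ccontr)
  assume "fab z0 \<noteq> fba z0"
  define e where "e = dist (fab z0) (fba z0) / 2"
  have e: "e > 0" using \<open>fab z0 \<noteq> fba z0\<close> by (simp add: e_def)
  obtain r where r: "r > 0" "ball z0 r \<subseteq> S" using S openE by blast
  obtain d1 where d1: "d1 > 0" "\<And>x. dist x z0 < d1 \<Longrightarrow> dist (fab x) (fab z0) < e"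
    using cont(1) e unfolding continuous_at_eps_delta by blast
  obtain d2 where d2: "d2 > 0" "\<And>x. dist x z0 < d2 \<Longrightarrow> dist (fba x) (fba z0) < e"
    using cont(2) e unfolding continuous_at_eps_delta by blast
  define t where "t = min r (min d1 d2) / 4"
  have t: "t > 0" "2 * t < r" "2 * t < d1" "2 * t < d2" using r d1 d2 by (auto simp: t_def)
  obtain w where w: "w \<in> cball z0 (2 * t)" "f (z0 + of_real t * a + of_real t * b) - f (z0 + of_real t * a)
             - f (z0 + of_real t * b) + f z0 = t * t * fab w"
    using second_difference_mvt[of z0 r f a fa b fab t] fa fab r t ab by blast
  obtain w' where w': "w' \<in> cball z0 (2 * t)" "f (z0 + of_real t * b + of_real t * a) - f (z0 + of_real t * b)
             - f (z0 + of_real t * a) + f z0 = t * t * fba w'"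
    using second_difference_mvt[of z0 r f b fb a fba t] fb fba r t ab by blast
  have e: "z0 + of_real t * b + of_real t * a = z0 + of_real t * a + of_real t * b" by simp
  have "t * t * fab w = t * t * fba w'" using w(2) w'(2) unfolding e by linarith
  then have "fab w = fba w'" using t by simp
  moreover have "dist (fab w) (fab z0) < e" using w(1) t d1(2)[of w] by (simp add: dist_commute)
  moreover have "dist (fba w') (fba z0) < e" using w'(1) t d2(2)[of w'] by (simp add: dist_commute)
  ultimately have "dist (fab z0) (fba z0) < 2 * e" by (simp add: dist_real_def)
  then show False by (simp add: e_def)
qed

lemma dz_dzb_commute:
  assumes S: "open S" "z \<in> S" and F: "wirt_smooth (Suc (Suc 0)) S F"
  shows "dz (dzb F) z = dzb (dz F) z"
proof -
  have F1: "wirt_smooth (Suc 0) S (dz F)" "wirt_smooth (Suc 0) S (dzb F)"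
    using F unfolding wirt_smooth.simps(2)[of "Suc 0"] by blast+
  have cont: "continuous_on S (dz (dz F))" "continuous_on S (dzb (dz F))"
    "continuous_on S (dz (dzb F))" "continuous_on S (dzb (dzb F))" using F1 by simp_all
  define D where "D a x = dz F x * a + dzb F x * cnj a" for a x
  define DD where "DD a b x = (dz (dz F) x * b + dzb (dz F) x * cnj b) * a
    + (dz (dzb F) x * b + dzb (dzb F) x * cnj b) * cnj a" for a b x
  have D: "((\<lambda>s. Re (c * F (x + of_real s * a))) has_real_derivative Re (c * D a x)) (at 0)"
    if "x \<in> S" for c a x
    unfolding D_def by (rule has_wirt_directional[OF wirt_smooth_wirt[OF F that]])
  have wD: "has_wirt (D a) x (dz (dz F) x * a + dz (dzb F) x * cnj a) (dzb (dz F) x * a + dzb (dzb F) x * cnj a)"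
    if "x \<in> S" for a x
  proof -
    have "has_wirt (\<lambda>x. dz F x * a + dzb F x * cnj a) x
      ((dz F x * 0 + dz (dz F) x * a) + (dzb F x * 0 + dz (dzb F) x * cnj a))
      ((dz F x * 0 + dzb (dz F) x * a) + (dzb F x * 0 + dzb (dzb F) x * cnj a))"
      by (intro has_wirt_add has_wirt_mult has_wirt_const wirt_smooth_wirt[OF F1(1) that] wirt_smooth_wirt[OF F1(2) that])
    then show ?thesis by (simp add: D_def[abs_def])
  qed
  have DD: "((\<lambda>s. Re (c * D a (x + of_real s * b))) has_real_derivative Re (c * DD a b x)) (at 0)"
    if "x \<in> S" for c a b x
    using has_wirt_directional[OF wD[OF that, of a], of c b] by (simp add: DD_def algebra_simps)
  have ctD: "isCont (\<lambda>x. Re (c * DD a b x)) z" for c a b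
  proof -
    have "continuous_on S (\<lambda>x. Re (c * DD a b x))" unfolding DD_def using cont by (intro continuous_intros)
    then show ?thesis using S by (simp add: continuous_on_eq_continuous_at)
  qed
  \<comment> \<open>Taking \<open>c = 1\<close> and \<open>c = \<i>\<close> recovers the complex
    identity from its real parts, and \<open>DD 1 \<i> - DD \<i> 1\<close> is
    \<open>2 * \<i>\<close> times the commutator of \<open>dz\<close> and
    \<open>dzb\<close>.\<close>
  have eq: "Re (c * DD 1 \<i> z) = Re (c * DD \<i> 1 z)" for c
    by (rule symmetric_mixed_derivative[OF S D D DD DD ctD ctD]) auto
  have "DD 1 \<i> z = DD \<i> 1 z" using eq[of 1] eq[of "\<i>"] by (simp add: complex_eq_iff)
  then show ?thesis unfolding DD_def by (simp add: complex_eq_iff)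
qed

section \<open>Real \<open>C^k\<close> functions and the Laplacian in Wirtinger form\<close>

lemma has_derivative_of_real_iff:
  fixes f :: "complex \<Rightarrow> real"
  shows "(f has_derivative D) (at x) \<Longrightarrow> ((\<lambda>x. complex_of_real (f x)) has_derivative (\<lambda>v. of_real (D v))) (at x)"
  by (auto intro!: derivative_eq_intros)

lemma wirt_of_real:
  fixes f :: "complex \<Rightarrow> real"
  assumes "f differentiable (at x)"
  shows "has_wirt (\<lambda>x. of_real (f x)) x
     ((of_real (frechet_derivative f (at x) 1) - \<i> * of_real (frechet_derivative f (at x) \<i>)) / 2)
     ((of_real (frechet_derivative f (at x) 1) + \<i> * of_real (frechet_derivative f (at x) \<i>)) / 2)"
proof -
  have d: "((\<lambda>x. complex_of_real (f x)) has_derivative (\<lambda>v. of_real (frechet_derivative f (at x) v))) (at x)"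
    using assms frechet_derivative_works has_derivative_of_real_iff by blast
  have "(\<lambda>v. of_real (frechet_derivative f (at x) v)) = frechet_derivative (\<lambda>x. complex_of_real (f x)) (at x)"
    by (rule frechet_derivative_at[OF d])
  then have *: "frechet_derivative (\<lambda>x. complex_of_real (f x)) (at x) v = of_real (frechet_derivative f (at x) v)" for v
    by metis
  have "(\<lambda>x. complex_of_real (f x)) differentiable (at x)" using d differentiable_def by blast
  from has_wirtI[OF this] show ?thesis unfolding dz_def dzb_def * .
qed

lemma Ck_on_imp_wirt_smooth:
  assumes "open S" "Ck_on k S f" shows "wirt_smooth k S (\<lambda>x. of_real (f x))"
  using assms(2)
proof (induction k arbitrary: f)
  case 0 then show ?case by (auto intro: continuous_intros)
next
  case (Suc k)
  have *: "wirt_smooth k S (\<lambda>x. of_real (frechet_derivative f (at x) v))" for v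
    by (rule Suc.IH) (use Suc.prems in simp)
  have c: "wirt_smooth k S (\<lambda>x. (of_real (frechet_derivative f (at x) 1) + c * of_real (frechet_derivative f (at x) \<i>)) * (1/2))" for c
    by (intro wirt_smooth_mult wirt_smooth_add wirt_smooth_const * assms(1))
  show ?case
    by (rule wirt_smooth_SucI[OF assms(1) wirt_of_real]) (use Suc.prems c[of "- \<i>"] c[of \<i>] in auto)
qed

lemma Ck_on_cong:
  "open S \<Longrightarrow> (\<And>x. x \<in> S \<Longrightarrow> f x = g x) \<Longrightarrow> Ck_on k S f \<Longrightarrow> Ck_on k S g"
proof (induction k arbitrary: f g)
  case 0 then show ?case by (simp cong: continuous_on_cong)
next
  case (Suc k)
  have D: "(g has_derivative D) (at x)" if "x \<in> S" "(f has_derivative D) (at x)" for D x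
    by (rule has_derivative_transform_within_open[OF that(2) Suc.prems(1) that(1) Suc.prems(2)])
  have d: "(f has_derivative frechet_derivative f (at x)) (at x)" if "x \<in> S" for x
    using Suc.prems(3) that by (simp add: frechet_derivative_works)
  have "g differentiable (at x)" if "x \<in> S" for x
    using D[OF that d[OF that]] unfolding differentiable_def by blast
  moreover have "Ck_on k S (\<lambda>x. frechet_derivative g (at x) v)" for v
  proof (rule Suc.IH[OF Suc.prems(1)])
    show "Ck_on k S (\<lambda>x. frechet_derivative f (at x) v)" using Suc.prems(3) by simp
    show "frechet_derivative f (at x) v = frechet_derivative g (at x) v" if "x \<in> S" for x
      using frechet_derivative_at[OF D[OF that d[OF that]]] by simp
  qed
  ultimately show ?case by simp
qed

lemma wirt_smooth_imp_Ck_on: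
  assumes "open S" "wirt_smooth k S F" shows "Ck_on k S (\<lambda>x. Re (F x))"
  using assms(2)
proof (induction k arbitrary: F)
  case 0 then show ?case by (auto intro: continuous_intros)
next
  case (Suc k)
  have D: "((\<lambda>x. Re (F x)) has_derivative (\<lambda>v. Re (dz F x * v + dzb F x * cnj v))) (at x)" if "x \<in> S" for x
    using wirt_smooth_wirt[OF Suc.prems that] unfolding has_wirt_def by (rule has_derivative_Re)
  have "(\<lambda>x. Re (F x)) differentiable (at x)" if "x \<in> S" for x
    using D[OF that] unfolding differentiable_def by blast
  moreover have "Ck_on k S (\<lambda>x. frechet_derivative (\<lambda>x. Re (F x)) (at x) v)" for v
  proof (rule Ck_on_cong[OF assms(1)])
    show "Ck_on k S (\<lambda>x. Re (dz F x * v + dzb F x * cnj v))"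
      by (rule Suc.IH, intro wirt_smooth_add wirt_smooth_mult wirt_smooth_const assms(1)) (use Suc.prems in auto)
    show "Re (dz F x * v + dzb F x * cnj v) = frechet_derivative (\<lambda>x. Re (F x)) (at x) v" if "x \<in> S" for x
      using frechet_derivative_at[OF D[OF that]] by metis
  qed
  ultimately show ?case by simp
qed

lemma laplacian_wirt:
  assumes S: "open S" "z \<in> S" and f: "Ck_on (Suc (Suc 0)) S f"
  shows "laplacian f z = 4 * Re (dzb (dz (\<lambda>x. of_real (f x))) z)"
proof -
  define f1 where "f1 x = frechet_derivative f (at x) 1" for x
  define f2 where "f2 x = frechet_derivative f (at x) \<i>" for x
  have d: "f differentiable (at x)" "f1 differentiable (at x)" "f2 differentiable (at x)" if "x \<in> S" for x
    using f that by (simp_all add: f1_def[abs_def] f2_def[abs_def])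
  have 1: "dz (\<lambda>x. of_real (f x)) x = (of_real (f1 x) + (- \<i>) * of_real (f2 x)) * (1/2)" if "x \<in> S" for x
    using has_wirtD(1)[OF wirt_of_real[OF d(1)[OF that]]] by (simp add: f1_def f2_def)
  have "has_wirt (\<lambda>x. (of_real (f1 x) + (- \<i>) * of_real (f2 x)) * (1/2)) z
     (((of_real (f1 z) + (- \<i>) * of_real (f2 z))) * 0 + (((of_real (frechet_derivative f1 (at z) 1) - \<i> * of_real (frechet_derivative f1 (at z) \<i>)) / 2)
        + ((- \<i>) * ((of_real (frechet_derivative f2 (at z) 1) - \<i> * of_real (frechet_derivative f2 (at z) \<i>)) / 2) + 0 * of_real (f2 z))) * (1/2))
     (((of_real (f1 z) + (- \<i>) * of_real (f2 z))) * 0 + (((of_real (frechet_derivative f1 (at z) 1) + \<i> * of_real (frechet_derivative f1 (at z) \<i>)) / 2)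
        + ((- \<i>) * ((of_real (frechet_derivative f2 (at z) 1) + \<i> * of_real (frechet_derivative f2 (at z) \<i>)) / 2) + 0 * of_real (f2 z))) * (1/2))"
    by (intro has_wirt_mult has_wirt_add has_wirt_const wirt_of_real d S)
  from has_wirtD(2)[OF this] have e: "dzb (dz (\<lambda>x. of_real (f x))) z =
     (((of_real (frechet_derivative f1 (at z) 1) + \<i> * of_real (frechet_derivative f1 (at z) \<i>)) / 2)
        + (- \<i>) * ((of_real (frechet_derivative f2 (at z) 1) + \<i> * of_real (frechet_derivative f2 (at z) \<i>)) / 2)) * (1/2)"
    using wirt_cong(2)[OF S, of "dz (\<lambda>x. of_real (f x))", OF 1] by simp
  have "4 * Re (dzb (dz (\<lambda>x. of_real (f x))) z) = frechet_derivative f1 (at z) 1 + frechet_derivative f2 (at z) \<i>"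
    unfolding e by simp
  moreover have "directional_deriv 1 f = f1" "directional_deriv \<i> f = f2"
    by (auto simp: directional_deriv_def f1_def f2_def)
  ultimately show ?thesis unfolding laplacian_def by (simp add: directional_deriv_def)
qed

section \<open>Linear differential equations on convex domains\<close>

text \<open>The equation y'' + Q y = 0 as a first-order system. Carrying the derivative as a
  separate function keeps \<open>deriv\<close> out of Wronskians, linear combinations and
  translations.\<close>

definition ode_sol :: "(complex \<Rightarrow> complex) \<Rightarrow> complex set \<Rightarrow> (complex \<Rightarrow> complex) \<Rightarrow> (complex \<Rightarrow> complex) \<Rightarrow> bool" where
  "ode_sol Q E y y' \<longleftrightarrow> (\<forall>z\<in>E. (y has_field_derivative y' z) (at z) \<and>
      (y' has_field_derivative - Q z * y z) (at z))"

text \<open>One Picard step: integration along the segment from \<open>z0\<close>, which convexity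
  keeps inside \<open>K\<close>, raises the power by one and turns \<open>fact n\<close> into
  \<open>fact (Suc n)\<close>. Iterated, it produces the terms of an exponential series.\<close>

lemma primitive_bound:
  assumes K: "convex K" "z0 \<in> K" "z \<in> K"
    and G: "\<And>x. x \<in> K \<Longrightarrow> (G has_field_derivative g x) (at x)" "G z0 = 0"
    and g: "\<And>x. x \<in> K \<Longrightarrow> norm (g x) \<le> C * norm (x - z0) ^ n / fact n"
  shows "norm (G z) \<le> C * norm (z - z0) ^ Suc n / fact (Suc n)"
proof -
  define p where "p t = z0 + of_real t * (z - z0)" for t :: real
  have pK: "p t \<in> K" if "0 \<le> t" "t \<le> 1" for t
    using convexD_alt[OF K that] by (simp add: p_def scaleR_conv_of_real algebra_simps)
  have dp: "(p has_vector_derivative (z - z0)) (at t)" for t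
    unfolding p_def has_vector_derivative_def
    by (auto intro!: derivative_eq_intros simp: scaleR_conv_of_real)
  have f': "((\<lambda>t. G (p t)) has_vector_derivative (z - z0) * g (p t)) (at t)" if "0 \<le> t" "t \<le> 1" for t
    using field_vector_diff_chain_at[OF dp[of t] G(1)[OF pK[OF that]]] by (simp add: o_def)
  \<comment> \<open>The antiderivative of the bound along the segment, where
    \<open>norm (p t - z0) = t * norm (z - z0)\<close>.\<close>
  define \<phi> where "\<phi> t = C * norm (z - z0) ^ Suc n / fact (Suc n) * t ^ Suc n" for t :: real
  have ph: "(\<phi> has_vector_derivative (C * norm (z - z0) ^ Suc n / fact n * t ^ n)) (at t)" for t
  proof -
    have "real (Suc n) / fact (Suc n) = 1 / fact n" by (simp add: fact_Suc del: of_nat_Suc)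
    then have "C * norm (z - z0) ^ Suc n * t ^ n * (real (Suc n) / fact (Suc n)) = C * norm (z - z0) ^ Suc n * t ^ n * (1 / fact n)"
      by simp
    then have e: "C * norm (z - z0) ^ Suc n / fact (Suc n) * (real (Suc n) * t ^ n) = C * norm (z - z0) ^ Suc n / fact n * t ^ n"
      by (simp add: mult_ac)
    have "(\<phi> has_real_derivative C * norm (z - z0) ^ Suc n / fact (Suc n) * (real (Suc n) * t ^ n)) (at t)"
      unfolding \<phi>_def by (rule DERIV_cmult) (use DERIV_pow[of "Suc n" t] in simp)
    then show ?thesis unfolding has_real_derivative_iff_has_vector_derivative[symmetric] e .
  qed
  have "norm (G (p 1) - G (p 0)) \<le> \<phi> 1 - \<phi> 0"
  proof (rule differentiable_bound_general[of 0 1])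
    show "continuous_on {0..1} (\<lambda>t. G (p t))"
      using f' by (intro continuous_at_imp_continuous_on ballI)
        (auto intro!: has_derivative_continuous simp: has_vector_derivative_def)
    show "continuous_on {0..1} \<phi>" unfolding \<phi>_def by (intro continuous_intros)
    show "((\<lambda>t. G (p t)) has_vector_derivative (z - z0) * g (p t)) (at t)" if "0 < t" "t < 1" for t
      using f' that by simp
    show "(\<phi> has_vector_derivative (C * norm (z - z0) ^ Suc n / fact n * t ^ n)) (at t)" for t by (rule ph)
    show "norm ((z - z0) * g (p t)) \<le> C * norm (z - z0) ^ Suc n / fact n * t ^ n" if t: "0 < t" "t < 1" for t
    proof -
      have "norm (p t - z0) = t * norm (z - z0)" using t by (simp add: p_def norm_mult)
      then have "norm (g (p t)) \<le> C * (t * norm (z - z0)) ^ n / fact n" using g[OF pK[of t]] t by simp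
      then have "norm (z - z0) * norm (g (p t)) \<le> norm (z - z0) * (C * (t * norm (z - z0)) ^ n / fact n)"
        by (intro mult_left_mono) auto
      then show ?thesis unfolding norm_mult by (simp add: power_mult_distrib mult_ac)
    qed
  qed simp
  then show ?thesis by (simp add: p_def \<phi>_def G(2))
qed

text \<open>Picard iteration written as a series: \<open>a n\<close> and \<open>b n\<close> are the
  n-th increments of the solution and of its derivative. Since holomorphic functions have primitives
  on all of the convex set, the sum is a solution on all of \<open>E\<close> and no continuation
  along paths is needed.\<close>

theorem linear_ode_exists:
  assumes E: "convex E" "open E" "z0 \<in> E" and Q: "Q holomorphic_on E"
  shows "\<exists>y y'. ode_sol Q E y y' \<and> y z0 = A \<and> y' z0 = B"
proof -
  define P where "P g = (SOME G. (\<forall>z\<in>E. (G has_field_derivative g z) (at z)) \<and> G z0 = 0)" for g :: "complex \<Rightarrow> complex"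
  have P: "\<forall>z\<in>E. (P g has_field_derivative g z) (at z)" "P g z0 = 0" if g: "g holomorphic_on E" for g
  proof -
    obtain G where G: "\<And>z. z \<in> E \<Longrightarrow> (G has_field_derivative g z) (at z within E)"
      using holomorphic_convex_primitive'[OF E(1,2) g] by blast
    have "(\<forall>z\<in>E. ((\<lambda>z. G z - G z0) has_field_derivative g z) (at z)) \<and> G z0 - G z0 = 0"
      using G E(2) by (auto intro!: derivative_eq_intros simp: at_within_open[of _ E])
    then have "\<exists>G. (\<forall>z\<in>E. (G has_field_derivative g z) (at z)) \<and> G z0 = 0"
      by (intro exI[of _ "\<lambda>z. G z - G z0"])
    then have "(\<forall>z\<in>E. (P g has_field_derivative g z) (at z)) \<and> P g z0 = 0"
      unfolding P_def by (rule someI_ex)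
    then show "\<forall>z\<in>E. (P g has_field_derivative g z) (at z)" "P g z0 = 0" by auto
  qed
  have Phol: "P g holomorphic_on E" if "g holomorphic_on E" for g
    using P(1)[OF that] E(2) by (auto simp: holomorphic_on_open)
  define ab where "ab = rec_nat ((\<lambda>_. A), (\<lambda>_. B)) (\<lambda>_ (a, b). (P b, P (\<lambda>z. - Q z * a z)))"
  define a where "a n = fst (ab n)" for n
  define b where "b n = snd (ab n)" for n
  have a0: "a 0 = (\<lambda>_. A)" and b0: "b 0 = (\<lambda>_. B)" by (auto simp: a_def b_def ab_def)
  have aS: "a (Suc n) = P (b n)" and bS: "b (Suc n) = P (\<lambda>z. - Q z * a n z)" for n
    by (auto simp: a_def b_def ab_def split: prod.split)
  have hol: "a n holomorphic_on E \<and> b n holomorphic_on E" for n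
    by (induction n) (auto simp: a0 b0 aS bS intro!: Phol holomorphic_intros Q)
  \<comment> \<open>Termwise derivatives. The terms of index 0 are constants, so differentiation
    shifts the index by one; this is why the differentiated series sum to \<open>v\<close> and to
    \<open>- Q x * u x\<close>.\<close>
  define a' where "a' n = (case n of 0 \<Rightarrow> (\<lambda>_. 0) | Suc m \<Rightarrow> b m)" for n
  define b' where "b' n = (case n of 0 \<Rightarrow> (\<lambda>_. 0) | Suc m \<Rightarrow> (\<lambda>z. - Q z * a m z))" for n
  have hQ: "(\<lambda>z. - Q z * a n z) holomorphic_on E" for n
    using hol[of n] by (intro holomorphic_intros Q) auto
  have da: "(a n has_field_derivative a' n z) (at z)" if "z \<in> E" for n z
    using P(1)[of "b m" for m] hol that by (cases n) (auto simp: a0 aS a'_def)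
  have db: "(b n has_field_derivative b' n z) (at z)" if "z \<in> E" for n z
    using P(1)[OF hQ] that by (cases n) (auto simp: b0 bS b'_def)
  have bound: "\<exists>d h. 0 < d \<and> summable h \<and> (\<forall>n. \<forall>y\<in>ball x d \<inter> E. norm (a n y) \<le> h n \<and> norm (b n y) \<le> h n)"
    if x: "x \<in> E" for x
  proof -
    obtain d where d: "d > 0" "cball x d \<subseteq> E" using E(2) x open_contains_cball by blast
    \<comment> \<open>The hull attaches the ball to the base point: it is compact, which bounds
      \<open>Q\<close>, and convex, which allows integration from \<open>z0\<close>.\<close>
    define K where "K = convex hull (insert z0 (cball x d))"
    have K: "convex K" "compact K" "z0 \<in> K" "cball x d \<subseteq> K"
      using hull_inc[of _ "insert z0 (cball x d)" convex]
      by (auto simp: K_def compact_convex_hull compact_insert simp del: mem_cball)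
    have KE: "K \<subseteq> E" unfolding K_def using d E by (intro hull_minimal) auto
    have "compact (Q ` K)" using K(2) KE Q
      by (meson compact_continuous_image continuous_on_subset holomorphic_on_imp_continuous_on)
    then obtain M0 where M0: "\<And>z. z \<in> K \<Longrightarrow> norm (Q z) \<le> M0"
      by (meson bounded_iff compact_imp_bounded imageI)
    \<comment> \<open>With \<open>M \<ge> 1\<close> one bound serves both components, although
      \<open>Q\<close> enters only in the step for \<open>b\<close>.\<close>
    define M where "M = max M0 1"
    have M: "norm (Q z) \<le> M" if "z \<in> K" for z using M0[OF that] by (simp add: M_def)
    have M1: "M \<ge> 1" by (simp add: M_def)
    define C where "C = norm A + norm B"
    have bd: "\<forall>z\<in>K. norm (a n z) \<le> (C * M ^ n) * norm (z - z0) ^ n / fact n \<and> norm (b n z) \<le> (C * M ^ n) * norm (z - z0) ^ n / fact n" for n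
    proof (induction n)
      case 0 then show ?case by (simp add: a0 b0 C_def)
    next
      case (Suc n)
      have C0: "C * M ^ n \<ge> 0" using M1 by (simp add: C_def)
      have le: "C * M ^ n \<le> C * M ^ Suc n" using mult_left_mono[OF M1 C0] by (simp add: mult_ac)
      have "norm (a (Suc n) z) \<le> (C * M ^ Suc n) * norm (z - z0) ^ Suc n / fact (Suc n)" if z: "z \<in> K" for z
      proof (rule primitive_bound[OF K(1,3) z])
        show "(a (Suc n) has_field_derivative b n x) (at x)" if "x \<in> K" for x
          using da[of x "Suc n"] KE that by (auto simp: a'_def)
        show "a (Suc n) z0 = 0" using P(2) hol by (simp add: aS)
        show "norm (b n x) \<le> (C * M ^ Suc n) * norm (x - z0) ^ n / fact n" if "x \<in> K" for x
        proof -
          have "norm (b n x) \<le> (C * M ^ n) * (norm (x - z0) ^ n / fact n)" using Suc that by simp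
          also have "\<dots> \<le> (C * M ^ Suc n) * (norm (x - z0) ^ n / fact n)"
            by (rule mult_right_mono[OF le]) simp
          finally show ?thesis by simp
        qed
      qed
      moreover have "norm (b (Suc n) z) \<le> (C * M ^ Suc n) * norm (z - z0) ^ Suc n / fact (Suc n)" if z: "z \<in> K" for z
      proof (rule primitive_bound[OF K(1,3) z])
        show "(b (Suc n) has_field_derivative (- Q x * a n x)) (at x)" if "x \<in> K" for x
          using db[of x "Suc n"] KE that by (auto simp: b'_def)
        show "b (Suc n) z0 = 0" using P(2)[OF hQ] by (simp add: bS)
        show "norm (- Q x * a n x) \<le> (C * M ^ Suc n) * norm (x - z0) ^ n / fact n" if "x \<in> K" for x
        proof -
          have "norm (- Q x * a n x) \<le> M * ((C * M ^ n) * norm (x - z0) ^ n / fact n)"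
            unfolding norm_mult norm_minus_cancel using Suc that M[OF that] M1 by (intro mult_mono) auto
          then show ?thesis by (simp add: mult_ac)
        qed
      qed
      ultimately show ?case by blast
    qed
    obtain R where R: "\<And>z. z \<in> K \<Longrightarrow> norm (z - z0) \<le> R"
      using compact_imp_bounded[OF K(2)] K(3) unfolding bounded_any_center[of K z0]
      by (metis dist_norm dist_commute)
    define h where "h n = C * ((M * R) ^ n /\<^sub>R fact n)" for n
    have "summable h" unfolding h_def by (intro summable_mult sums_summable[OF exp_converges])
    moreover have "(C * M ^ n) * norm (z - z0) ^ n / fact n \<le> h n" if "z \<in> K" for z n
    proof -
      have "C * M ^ n * norm (z - z0) ^ n \<le> C * M ^ n * R ^ n"
        using R[OF that] M1 by (intro mult_left_mono power_mono) (auto simp: C_def)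
      then have "C * M ^ n * norm (z - z0) ^ n / fact n \<le> C * M ^ n * R ^ n / fact n"
        by (rule divide_right_mono) simp
      moreover have "h n = C * M ^ n * R ^ n / fact n"
        by (simp add: h_def power_mult_distrib divide_inverse mult_ac)
      ultimately show ?thesis by simp
    qed
    moreover have "ball x d \<inter> E \<subseteq> K" using K(4) ball_subset_cball by blast
    ultimately show ?thesis using bd d(1) by (meson order_trans subsetD)
  qed
  have "\<exists>g g'. \<forall>x \<in> E. ((\<lambda>n. a n x) sums g x) \<and> ((\<lambda>n. a' n x) sums g' x) \<and> (g has_field_derivative g' x) (at x)"
  proof (rule series_and_derivative_comparison_local[OF E(2) da])
    show "\<exists>d h. 0 < d \<and> summable h \<and> (\<forall>\<^sub>F n in sequentially. \<forall>y\<in>ball x d \<inter> E. norm (a n y) \<le> h n)" if "x \<in> E" for x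
    proof -
      obtain d h where "0 < d" "summable h" "\<forall>n. \<forall>y\<in>ball x d \<inter> E. norm (a n y) \<le> h n \<and> norm (b n y) \<le> h n"
        using bound[OF \<open>x \<in> E\<close>] by blast
      then show ?thesis by (intro exI[of _ d] exI[of _ h]) auto
    qed
  qed
  then obtain u u' where u: "\<And>x. x \<in> E \<Longrightarrow> (\<lambda>n. a n x) sums u x" "\<And>x. x \<in> E \<Longrightarrow> (\<lambda>n. a' n x) sums u' x"
    "\<And>x. x \<in> E \<Longrightarrow> (u has_field_derivative u' x) (at x)" by blast
  have "\<exists>g g'. \<forall>x \<in> E. ((\<lambda>n. b n x) sums g x) \<and> ((\<lambda>n. b' n x) sums g' x) \<and> (g has_field_derivative g' x) (at x)"
  proof (rule series_and_derivative_comparison_local[OF E(2) db])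
    show "\<exists>d h. 0 < d \<and> summable h \<and> (\<forall>\<^sub>F n in sequentially. \<forall>y\<in>ball x d \<inter> E. norm (b n y) \<le> h n)" if "x \<in> E" for x
    proof -
      obtain d h where "0 < d" "summable h" "\<forall>n. \<forall>y\<in>ball x d \<inter> E. norm (a n y) \<le> h n \<and> norm (b n y) \<le> h n"
        using bound[OF \<open>x \<in> E\<close>] by blast
      then show ?thesis by (intro exI[of _ d] exI[of _ h]) auto
    qed
  qed
  then obtain v v' where v: "\<And>x. x \<in> E \<Longrightarrow> (\<lambda>n. b n x) sums v x" "\<And>x. x \<in> E \<Longrightarrow> (\<lambda>n. b' n x) sums v' x"
    "\<And>x. x \<in> E \<Longrightarrow> (v has_field_derivative v' x) (at x)" by blast
  have u': "u' x = v x" if "x \<in> E" for x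
  proof -
    have "(\<lambda>n. a' (Suc n) x) sums (u' x - a' 0 x)" using u(2)[OF that] sums_Suc_iff[of "\<lambda>n. a' n x"] by simp
    then show ?thesis using sums_unique2[OF _ v(1)[OF that]] by (simp add: a'_def)
  qed
  have v': "v' x = - Q x * u x" if "x \<in> E" for x
  proof -
    have "(\<lambda>n. b' (Suc n) x) sums (v' x - b' 0 x)" using v(2)[OF that] sums_Suc_iff[of "\<lambda>n. b' n x"] by simp
    moreover have "(\<lambda>n. - Q x * a n x) sums (- Q x * u x)" by (rule sums_mult[OF u(1)[OF that]])
    ultimately show ?thesis using sums_unique2 by (auto simp: b'_def)
  qed
  have z0: "(\<lambda>n. a n z0) sums a 0 z0" "(\<lambda>n. b n z0) sums b 0 z0"
  proof -
    have "a n z0 = 0" "b n z0 = 0" if "n \<noteq> 0" for n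
      using that P(2) hol hQ by (cases n; simp add: aS bS)+
    then show "(\<lambda>n. a n z0) sums a 0 z0" "(\<lambda>n. b n z0) sums b 0 z0"
      using sums_finite[of "{0}" "\<lambda>n. a n z0"] sums_finite[of "{0}" "\<lambda>n. b n z0"] by auto
  qed
  have "ode_sol Q E u v" unfolding ode_sol_def using u(3) v(3) u' v' by auto
  moreover have "u z0 = A" using sums_unique2[OF u(1)[OF E(3)] z0(1)] by (simp add: a0)
  moreover have "v z0 = B" using sums_unique2[OF v(1)[OF E(3)] z0(2)] by (simp add: b0)
  ultimately show ?thesis by blast
qed

section \<open>Liouville equation and its potential\<close>

definition wirt_smooth_inf :: "complex set \<Rightarrow> (complex \<Rightarrow> complex) \<Rightarrow> bool" where
  "wirt_smooth_inf S F \<longleftrightarrow> (\<forall>k. wirt_smooth k S F)"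

text \<open>The equation says that \<open>\<Delta> ln h = h^(-2)\<close>, i.e. that \<open>h^(-2) |dz|\<^sup>2\<close> has curvature 1.\<close>

definition liouville :: "complex set \<Rightarrow> (complex \<Rightarrow> complex) \<Rightarrow> bool" where
  "liouville S h \<longleftrightarrow> open S \<and> wirt_smooth_inf S h \<and> (\<forall>z\<in>S. h z \<in> \<real> \<and> Re (h z) > 0) \<and>
     (\<forall>z\<in>S. h z * dzb (dz h) z - dz h z * dzb h z = 1 / 4)"

text \<open>Half the Schwarzian derivative of any developing map of \<open>h^(-2) |dz|\<^sup>2\<close>.\<close>

definition potential :: "(complex \<Rightarrow> complex) \<Rightarrow> complex \<Rightarrow> complex" where
  "potential h z = - dz (dz h) z / h z"

lemma wirt_smooth_inf_dz: "wirt_smooth_inf S F \<Longrightarrow> wirt_smooth_inf S (dz F)" and Sm_dzb: "wirt_smooth_inf S F \<Longrightarrow> wirt_smooth_inf S (dzb F)"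
  unfolding wirt_smooth_inf_def using wirt_smooth_dz sm_dzb by blast+

lemma wirt_smooth_inf_wirt: "wirt_smooth_inf S F \<Longrightarrow> z \<in> S \<Longrightarrow> has_wirt F z (dz F z) (dzb F z)"
  unfolding wirt_smooth_inf_def using wirt_smooth_wirt by blast

lemma wirt_smooth_inf_commute: "open S \<Longrightarrow> wirt_smooth_inf S F \<Longrightarrow> z \<in> S \<Longrightarrow> dz (dzb F) z = dzb (dz F) z"
  unfolding wirt_smooth_inf_def using dz_dzb_commute by blast

lemma has_wirt_cong_eq:
  assumes "open S" "z \<in> S" "\<And>x. x \<in> S \<Longrightarrow> F x = G x" "has_wirt F z a b"
  shows "has_wirt G z a b"
  using assms(4) unfolding has_wirt_def
  by (rule has_derivative_transform_within_open[OF _ assms(1,2)]) (rule assms(3))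

lemma has_wirt_unique: "has_wirt F z a b \<Longrightarrow> has_wirt F z c d \<Longrightarrow> a = c \<and> b = d"
  using has_wirtD by metis

lemma has_wirt_holomorphic: "has_wirt F z a 0 \<Longrightarrow> (F has_field_derivative a) (at z)"
  unfolding has_wirt_def has_field_derivative_def by simp

lemma has_wirt_divide:
  assumes "has_wirt F z a b" "has_wirt G z c d" "G z \<noteq> 0"
  shows "has_wirt (\<lambda>z. F z / G z) z ((a * G z - F z * c) / (G z)\<^sup>2) ((b * G z - F z * d) / (G z)\<^sup>2)"
proof -
  have "has_wirt (\<lambda>z. inverse (G z)) z (- (inverse (G z) * inverse (G z)) * c) (- (inverse (G z) * inverse (G z)) * d)"
    by (rule has_wirt_outer[OF assms(2)]) (use DERIV_inverse[OF assms(3), where s = UNIV] in \<open>simp add: power2_eq_square\<close>)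
  from has_wirt_mult[OF assms(1) this] show ?thesis
    using assms(3) by (simp add: divide_simps power2_eq_square algebra_simps)
qed

lemma liouville_open: "liouville S h \<Longrightarrow> open S"
  by (simp add: liouville_def)

lemma liouville_nz: "liouville S h \<Longrightarrow> z \<in> S \<Longrightarrow> h z \<noteq> 0"
  unfolding liouville_def by force

lemma liouville_cnj:
  assumes "liouville S h" "z \<in> S"
  shows "cnj (h z) = h z" "cnj (dz h z) = dzb h z" "cnj (dz (dz h) z) = dzb (dzb h) z"
proof -
  have r: "h x = cnj (h x)" if "x \<in> S" for x
    using assms that unfolding liouville_def by (auto simp: Reals_cnj_iff)
  have S: "open S" and Sm: "wirt_smooth_inf S h" using assms(1) by (auto simp: liouville_def)
  have d: "dzb h x = cnj (dz h x)" if "x \<in> S" for x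
    using wirt_cong(2)[OF S that r] has_wirtD(2)[OF has_wirt_cnj[OF wirt_smooth_inf_wirt[OF Sm that]]] by simp
  show "cnj (h z) = h z" "cnj (dz h z) = dzb h z" using r d assms(2) by metis+
  show "cnj (dz (dz h) z) = dzb (dzb h) z"
    using wirt_cong(2)[OF S assms(2) d] has_wirtD(2)[OF has_wirt_cnj[OF wirt_smooth_inf_wirt[OF wirt_smooth_inf_dz[OF Sm] assms(2)]]] by simp
qed

text \<open>Differentiating \<open>h h_(z zbar) - h_z h_zbar = 1/4\<close> in z, the two terms
  \<open>h_z h_(z zbar)\<close> cancel and \<open>h h_(zz zbar) = h_zz h_zbar\<close> remains, which
  says that \<open>h_zz / h\<close> has vanishing zbar-derivative. The other claims only reorder
  derivatives.\<close>

lemma liouville_third: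
  assumes "liouville S h" "z \<in> S"
  shows "h z * dz (dzb (dz h)) z = dz (dz h) z * dzb h z"
    and "dz (dzb h) z = dzb (dz h) z"
    and "dzb (dz (dz h)) z = dz (dzb (dz h)) z"
    and "dzb (dzb (dz h)) z = dz (dzb (dzb h)) z"
proof -
  have S: "open S" and Sm: "wirt_smooth_inf S h" using assms(1) by (auto simp: liouville_def)
  note w = wirt_smooth_inf_wirt[OF Sm assms(2)] wirt_smooth_inf_wirt[OF wirt_smooth_inf_dz[OF Sm] assms(2)] wirt_smooth_inf_wirt[OF Sm_dzb[OF Sm] assms(2)]
    wirt_smooth_inf_wirt[OF Sm_dzb[OF wirt_smooth_inf_dz[OF Sm]] assms(2)]
  have "has_wirt (\<lambda>z. h z * dzb (dz h) z - dz h z * dzb h z) z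
     (h z * dz (dzb (dz h)) z + dz h z * dzb (dz h) z - (dz h z * dz (dzb h) z + dz (dz h) z * dzb h z))
     (h z * dzb (dzb (dz h)) z + dzb h z * dzb (dz h) z - (dz h z * dzb (dzb h) z + dzb (dz h) z * dzb h z))"
    by (intro has_wirt_diff has_wirt_mult w)
  then have "has_wirt (\<lambda>z. 1 / 4) z
     (h z * dz (dzb (dz h)) z + dz h z * dzb (dz h) z - (dz h z * dz (dzb h) z + dz (dz h) z * dzb h z))
     (h z * dzb (dzb (dz h)) z + dzb h z * dzb (dz h) z - (dz h z * dzb (dzb h) z + dzb (dz h) z * dzb h z))"
    by (rule has_wirt_cong_eq[OF S assms(2), rotated]) (use assms(1) in \<open>auto simp: liouville_def\<close>)
  with has_wirt_const have "h z * dz (dzb (dz h)) z + dz h z * dzb (dz h) z - (dz h z * dz (dzb h) z + dz (dz h) z * dzb h z) = 0"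
    using has_wirt_unique by blast
  moreover show c: "dz (dzb h) z = dzb (dz h) z" by (rule wirt_smooth_inf_commute[OF S Sm assms(2)])
  ultimately show "h z * dz (dzb (dz h)) z = dz (dz h) z * dzb h z" by (simp add: algebra_simps)
  show "dzb (dz (dz h)) z = dz (dzb (dz h)) z" by (rule wirt_smooth_inf_commute[OF S wirt_smooth_inf_dz[OF Sm] assms(2), symmetric])
  have "dzb (dzb (dz h)) z = dzb (dz (dzb h)) z"
    by (rule wirt_cong(2)[OF S assms(2)]) (simp add: wirt_smooth_inf_commute[OF S Sm])
  then show "dzb (dzb (dz h)) z = dz (dzb (dzb h)) z" using wirt_smooth_inf_commute[OF S Sm_dzb[OF Sm] assms(2)] by simp
qed

lemma potential_holomorphic:
  assumes "liouville S h" shows "potential h holomorphic_on S"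
proof -
  have S: "open S" and Sm: "wirt_smooth_inf S h" using assms(1) by (auto simp: liouville_def)
  have "\<exists>a. (potential h has_field_derivative a) (at z)" if z: "z \<in> S" for z
  proof -
    have "has_wirt (\<lambda>z. - dz (dz h) z / h z) z
      ((- dz (dz (dz h)) z * h z - (- dz (dz h) z) * dz h z) / (h z)\<^sup>2)
      ((- dzb (dz (dz h)) z * h z - (- dz (dz h) z) * dzb h z) / (h z)\<^sup>2)"
      using has_wirt_diff[OF has_wirt_const[of 0] wirt_smooth_inf_wirt[OF wirt_smooth_inf_dz[OF wirt_smooth_inf_dz[OF Sm]] z]]
      by (intro has_wirt_divide wirt_smooth_inf_wirt[OF Sm z] liouville_nz[OF assms z]) simp
    moreover have "- dzb (dz (dz h)) z * h z - (- dz (dz h) z) * dzb h z = 0"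
      using liouville_third[OF assms z] by (simp add: algebra_simps)
    ultimately have "has_wirt (potential h) z ((- dz (dz (dz h)) z * h z - (- dz (dz h) z) * dz h z) / (h z)\<^sup>2) 0"
      by (simp add: potential_def[abs_def])
    then show ?thesis using has_wirt_holomorphic by blast
  qed
  then show ?thesis using S by (auto simp: holomorphic_on_open)
qed

text \<open>The condition on \<open>\<psi>\<close> makes \<open>k = (h \<circ> \<phi>) / |\<phi>'|\<close>, the coefficient of the pulled back metric;
  the last term of the potential is half the Schwarzian derivative of \<open>\<phi>\<close>.\<close>

lemma liouville_pullback:
  assumes h: "liouville S h" and S': "open S'" and \<phi>: "\<phi> holomorphic_on S'" "\<phi> ` S' \<subseteq> S"
    and \<psi>: "\<psi> holomorphic_on S'" and eq: "\<And>z. z \<in> S' \<Longrightarrow> (\<psi> z)\<^sup>2 * deriv \<phi> z = 1"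
  defines "k \<equiv> \<lambda>z. h (\<phi> z) * \<psi> z * cnj (\<psi> z)"
  shows "liouville S' k"
    and "z \<in> S' \<Longrightarrow> potential k z = potential h (\<phi> z) / \<psi> z ^ 4 - deriv (deriv \<psi>) z / \<psi> z"
proof -
  have S: "open S" and Sm: "wirt_smooth_inf S h" using h by (auto simp: liouville_def)
  have \<phi>S: "\<phi> z \<in> S" if "z \<in> S'" for z using \<phi>(2) that by auto
  have \<psi>nz: "\<psi> z \<noteq> 0" if "z \<in> S'" for z using eq[OF that] by auto
  have "wirt_smooth n S' (\<lambda>z. h (\<phi> z))" "wirt_smooth n S' \<psi>" for n
    using wirt_smooth_inner[OF S S' \<phi>] wirt_smooth_holomorphic[OF S' \<psi>] Sm by (auto simp: wirt_smooth_inf_def)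
  then have Smk: "wirt_smooth_inf S' k" unfolding wirt_smooth_inf_def k_def by (intro allI wirt_smooth_mult wirt_smooth_cnj S')
  note d\<phi> = has_wirt_inner[OF _ holomorphic_derivD[OF \<phi>(1) S']]
  note d\<psi> = has_wirt_field[OF holomorphic_derivD[OF \<psi> S']]
  note d\<psi>' = has_wirt_field[OF holomorphic_derivD[OF holomorphic_deriv[OF \<psi> S'] S']]
  note d\<phi>' = has_wirt_field[OF holomorphic_derivD[OF holomorphic_deriv[OF \<phi>(1) S'] S']]
  note wh = wirt_smooth_inf_wirt[OF Sm \<phi>S] and wb = wirt_smooth_inf_wirt[OF wirt_smooth_inf_dz[OF Sm] \<phi>S]
  have k1: "has_wirt k z
      (h (\<phi> z) * \<psi> z * cnj 0 + (h (\<phi> z) * deriv \<psi> z + dz h (\<phi> z) * deriv \<phi> z * \<psi> z) * cnj (\<psi> z))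
      (h (\<phi> z) * \<psi> z * cnj (deriv \<psi> z) + (h (\<phi> z) * 0 + dzb h (\<phi> z) * cnj (deriv \<phi> z) * \<psi> z) * cnj (\<psi> z))"
    if z: "z \<in> S'" for z
    unfolding k_def by (intro has_wirt_mult has_wirt_cnj d\<phi>[OF wh[OF z] z] d\<psi>[OF z])
  define G where "G z = (h (\<phi> z) * deriv \<psi> z + dz h (\<phi> z) * deriv \<phi> z * \<psi> z) * cnj (\<psi> z)" for z
  have dzk: "G z = dz k z" if "z \<in> S'" for z
    using has_wirtD(1)[OF k1[OF that]] by (simp add: G_def)
  have dzbk: "dzb k z = h (\<phi> z) * \<psi> z * cnj (deriv \<psi> z) + dzb h (\<phi> z) * cnj (deriv \<phi> z) * \<psi> z * cnj (\<psi> z)"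
    if "z \<in> S'" for z using has_wirtD(2)[OF k1[OF that]] by simp
  have k2: "has_wirt G z
      ((h (\<phi> z) * deriv \<psi> z + dz h (\<phi> z) * deriv \<phi> z * \<psi> z) * cnj 0 +
        (h (\<phi> z) * deriv (deriv \<psi>) z + dz h (\<phi> z) * deriv \<phi> z * deriv \<psi> z +
          (dz h (\<phi> z) * deriv \<phi> z * deriv \<psi> z + (dz h (\<phi> z) * deriv (deriv \<phi>) z + dz (dz h) (\<phi> z) * deriv \<phi> z * deriv \<phi> z) * \<psi> z)) * cnj (\<psi> z))
      ((h (\<phi> z) * deriv \<psi> z + dz h (\<phi> z) * deriv \<phi> z * \<psi> z) * cnj (deriv \<psi> z) +
        (h (\<phi> z) * 0 + dzb h (\<phi> z) * cnj (deriv \<phi> z) * deriv \<psi> z +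
          (dz h (\<phi> z) * deriv \<phi> z * 0 + (dz h (\<phi> z) * 0 + dzb (dz h) (\<phi> z) * cnj (deriv \<phi> z) * deriv \<phi> z) * \<psi> z)) * cnj (\<psi> z))"
    if z: "z \<in> S'" for z
    unfolding G_def
    by (intro has_wirt_mult has_wirt_add has_wirt_cnj d\<phi>[OF wh[OF z] z] d\<phi>[OF wb[OF z] z] d\<psi>[OF z] d\<psi>'[OF z] d\<phi>'[OF z])
  have k2': "has_wirt (dz k) z (dz G z) (dzb G z)" if "z \<in> S'" for z
    using has_wirtD[OF k2[OF that]] has_wirt_cong_eq[OF S' that dzk k2[OF that]] by simp
  have "k z * dzb (dz k) z - dz k z * dzb k z = 1 / 4" if z: "z \<in> S'" for z
  proof -
    define H b c d where "H = h (\<phi> z)" and "b = dz h (\<phi> z)" and "c = dzb h (\<phi> z)" and "d = dzb (dz h) (\<phi> z)"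
    define p p' f q f' where "p = \<psi> z" and "p' = deriv \<psi> z" and "f = deriv \<phi> z"
      and "q = cnj (\<psi> z)" and "f' = cnj (deriv \<phi> z)"
    define q' where "q' = cnj (deriv \<psi> z)"
    have L: "H * d - b * c = 1 / 4" using h \<phi>S[OF z] by (simp add: liouville_def H_def b_def c_def d_def)
    have pf: "p\<^sup>2 * f = 1" using eq[OF z] by (simp add: p_def f_def)
    have "cnj (p\<^sup>2 * f) = cnj 1" using pf by simp
    then have qf: "q\<^sup>2 * f' = 1" by (simp add: p_def f_def q_def f'_def)
    have e1: "dzb (dz k) z = (H * p' + b * f * p) * q' + (c * f' * p' + d * f' * f * p) * q"
      using has_wirtD(2)[OF k2'[OF z]] has_wirtD(2)[OF k2[OF z]]
      by (simp add: H_def b_def c_def d_def p_def p'_def q_def q'_def f_def f'_def)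
    have e2: "dz k z = (H * p' + b * f * p) * q"
      using dzk[OF z] by (simp add: G_def H_def b_def c_def d_def p_def p'_def q_def q'_def f_def f'_def)
    have e3: "dzb k z = H * p * q' + c * f' * p * q"
      using dzbk[OF z] by (simp add: H_def b_def c_def d_def p_def p'_def q_def q'_def f_def f'_def)
    have e0: "k z = H * p * q" by (simp add: k_def H_def p_def q_def)
    have "k z * dzb (dz k) z - dz k z * dzb k z = (p\<^sup>2 * f) * (q\<^sup>2 * f') * (H * d - b * c)"
      unfolding e0 e1 e2 e3 by (simp add: algebra_simps power2_eq_square)
    then show ?thesis using L pf qf by simp
  qed
  moreover have "k z \<in> \<real> \<and> Re (k z) > 0" if z: "z \<in> S'" for z
  proof -
    have hr: "h (\<phi> z) = of_real (Re (h (\<phi> z)))" "Re (h (\<phi> z)) > 0"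
      using h \<phi>S[OF z] by (auto simp: liouville_def)
    have "k z = of_real (Re (h (\<phi> z)) * (norm (\<psi> z))\<^sup>2)"
      unfolding k_def by (subst hr(1)) (simp only: mult.assoc complex_norm_square[symmetric] of_real_mult)
    then show ?thesis using hr(2) \<psi>nz[OF z] by simp
  qed
  ultimately show "liouville S' k" using S' Smk by (simp add: liouville_def)
  show "potential k z = potential h (\<phi> z) / \<psi> z ^ 4 - deriv (deriv \<psi>) z / \<psi> z" if z: "z \<in> S'"
  proof -
    \<comment> \<open>Differentiating the constraint
      \<open>(\<psi> z)\<^sup>2 * deriv \<phi> z = 1\<close> shows that the coefficient of
      \<open>dz h\<close> in \<open>dz (dz k)\<close> is zero; hence the potential of
      \<open>k\<close> depends on \<open>h\<close> only through the potential of
      \<open>h\<close>.\<close>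
    have "((\<lambda>z. (\<psi> z)\<^sup>2 * deriv \<phi> z) has_field_derivative (2 * \<psi> z * deriv \<psi> z * deriv \<phi> z + (\<psi> z)\<^sup>2 * deriv (deriv \<phi>) z)) (at z)"
      by (rule derivative_eq_intros refl holomorphic_derivD[OF \<psi> S' z]
          holomorphic_derivD[OF holomorphic_deriv[OF \<phi>(1) S'] S' z])+ (simp add: algebra_simps)
    then have "((\<lambda>z. 1) has_field_derivative (2 * \<psi> z * deriv \<psi> z * deriv \<phi> z + (\<psi> z)\<^sup>2 * deriv (deriv \<phi>) z)) (at z)"
      by (rule has_field_derivative_transform_within_open[OF _ S' z]) (simp add: eq)
    then have "2 * \<psi> z * deriv \<psi> z * deriv \<phi> z + (\<psi> z)\<^sup>2 * deriv (deriv \<phi>) z = 0"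
      using DERIV_unique[OF _ DERIV_const] by blast
    then have "\<psi> z * (2 * deriv \<psi> z * deriv \<phi> z + \<psi> z * deriv (deriv \<phi>) z) = 0"
      by (simp add: algebra_simps power2_eq_square)
    then have 0: "2 * deriv \<psi> z * deriv \<phi> z + \<psi> z * deriv (deriv \<phi>) z = 0" using \<psi>nz[OF z] by simp
    have "dz (dz k) z = dz G z" using has_wirtD(1)[OF k2'[OF z]] .
    also have "\<dots> = (h (\<phi> z) * deriv (deriv \<psi>) z + dz h (\<phi> z) * (2 * deriv \<psi> z * deriv \<phi> z + \<psi> z * deriv (deriv \<phi>) z)
         + dz (dz h) (\<phi> z) * (deriv \<phi> z)\<^sup>2 * \<psi> z) * cnj (\<psi> z)"
      using has_wirtD(1)[OF k2[OF z]] by (simp add: algebra_simps power2_eq_square)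
    finally have e: "dz (dz k) z = (h (\<phi> z) * deriv (deriv \<psi>) z + dz (dz h) (\<phi> z) * (deriv \<phi> z)\<^sup>2 * \<psi> z) * cnj (\<psi> z)"
      using 0 by simp
    have f: "deriv \<phi> z = 1 / (\<psi> z)\<^sup>2" using eq[OF z] \<psi>nz[OF z] by (simp add: field_simps)
    have kz: "k z = h (\<phi> z) * \<psi> z * cnj (\<psi> z)" by (simp add: k_def)
    show ?thesis unfolding potential_def e f kz using \<psi>nz[OF z] liouville_nz[OF h \<phi>S[OF z]]
      by (simp add: field_simps power2_eq_square power4_eq_xxxx)
  qed
qed

section \<open>Solutions of y'' + Q y = 0 and Hermitian forms in them\<close>

lemma ode_solD:
  assumes "ode_sol Q E y y'" "z \<in> E"
  shows "(y has_field_derivative y' z) (at z)" "(y' has_field_derivative - Q z * y z) (at z)"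
  using assms by (auto simp: ode_sol_def)

lemma wronskian_constant:
  assumes "convex E" "open E" and y: "ode_sol Q E y y'" and w: "ode_sol Q E w w'"
  obtains c where "\<And>z. z \<in> E \<Longrightarrow> y z * w' z - y' z * w z = c"
proof -
  have "((\<lambda>z. y z * w' z - y' z * w z) has_field_derivative 0) (at z within E)" if "z \<in> E" for z
  proof -
    have "((\<lambda>z. y z * w' z - y' z * w z) has_field_derivative 0) (at z)"
      by (rule derivative_eq_intros refl ode_solD[OF y that] ode_solD[OF w that])+ (simp add: algebra_simps)
    then show ?thesis by (rule has_field_derivative_at_within)
  qed
  from has_field_derivative_zero_constant[OF assms(1) this]
  show ?thesis using that by blast
qed

text \<open>Cramer's rule: the coefficients of \<open>u\<close> are its Wronskians with
  \<open>w\<close> and \<open>y\<close>, which are constant, and the normalisation of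
  \<open>y\<close>, \<open>w\<close> makes the determinant 1.\<close>

lemma ode_sol_span:
  assumes E: "convex E" "open E" and y: "ode_sol Q E y y'" and w: "ode_sol Q E w w'"
    and W: "\<forall>z\<in>E. y z * w' z - y' z * w z = 1" and u: "ode_sol Q E u u'"
  shows "\<exists>\<alpha> \<beta>. \<forall>z\<in>E. u z = \<alpha> * y z + \<beta> * w z \<and> u' z = \<alpha> * y' z + \<beta> * w' z"
proof -
  obtain a where a: "\<And>z. z \<in> E \<Longrightarrow> u z * w' z - u' z * w z = a" using wronskian_constant[OF E u w] by blast
  obtain b where b: "\<And>z. z \<in> E \<Longrightarrow> y z * u' z - y' z * u z = b" using wronskian_constant[OF E y u] by blast
  have "u z = a * y z + b * w z" "u' z = a * y' z + b * w' z" if "z \<in> E" for z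
  proof -
    have "a * y z + b * w z = u z * (y z * w' z - y' z * w z)"
      using a[OF that] b[OF that] by (simp add: algebra_simps flip: a[OF that] b[OF that])
    then show "u z = a * y z + b * w z" using bspec[OF W that] by simp
    have "a * y' z + b * w' z = u' z * (y z * w' z - y' z * w z)"
      by (simp add: algebra_simps flip: a[OF that] b[OF that])
    then show "u' z = a * y' z + b * w' z" using bspec[OF W that] by simp
  qed
  then show ?thesis by blast
qed

lemma ode_sol_lincomb:
  assumes "ode_sol Q E y y'" "ode_sol Q E w w'"
  shows "ode_sol Q E (\<lambda>z. a * y z + b * w z) (\<lambda>z. a * y' z + b * w' z)"
  unfolding ode_sol_def
proof (intro ballI conjI)
  fix z assume z: "z \<in> E"
  show "((\<lambda>z. a * y z + b * w z) has_field_derivative a * y' z + b * w' z) (at z)"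
    by (rule derivative_eq_intros refl ode_solD[OF assms(1) z] ode_solD[OF assms(2) z])+ simp
  show "((\<lambda>z. a * y' z + b * w' z) has_field_derivative - Q z * (a * y z + b * w z)) (at z)"
    by (rule derivative_eq_intros refl ode_solD[OF assms(1) z] ode_solD[OF assms(2) z])+ (simp add: algebra_simps)
qed

lemma ode_sol_wirt:
  assumes "ode_sol Q E y y'" "z \<in> E"
  shows "has_wirt y z (y' z) 0" "has_wirt y' z (- Q z * y z) 0"
    "has_wirt (\<lambda>z. cnj (y z)) z 0 (cnj (y' z))" "has_wirt (\<lambda>z. cnj (y' z)) z 0 (cnj (- Q z * y z))"
  using has_wirt_field[OF ode_solD(1)[OF assms]] has_wirt_field[OF ode_solD(2)[OF assms]]
    has_wirt_cnj[OF has_wirt_field[OF ode_solD(1)[OF assms]]] has_wirt_cnj[OF has_wirt_field[OF ode_solD(2)[OF assms]]]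
  by simp_all

text \<open>All four coefficients are free. The difference of two Hermitian forms, or a form after
  substitution of other solutions, again has this shape, so identities between forms reduce to
  \<open>hform_independent\<close>.\<close>

definition hform :: "complex \<Rightarrow> complex \<Rightarrow> complex \<Rightarrow> complex \<Rightarrow> complex \<Rightarrow> complex \<Rightarrow> complex" where
  "hform p q r s u v = p * (u * cnj u) + q * (u * cnj v) + r * (v * cnj u) + s * (v * cnj v)"

lemma hform_wirt:
  assumes "ode_sol Q E y y'" "ode_sol Q E w w'" "z \<in> E"
  shows "has_wirt (\<lambda>z. hform p q r s (y z) (w z)) z
      (y' z * (p * cnj (y z) + q * cnj (w z)) + w' z * (r * cnj (y z) + s * cnj (w z)))
      (cnj (y' z) * (p * y z + r * w z) + cnj (w' z) * (q * y z + s * w z))"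
proof -
  note d = ode_sol_wirt[OF assms(1,3)] ode_sol_wirt[OF assms(2,3)]
  have eq: "has_wirt F z a b \<Longrightarrow> a = c \<Longrightarrow> b = d \<Longrightarrow> has_wirt F z c d" for F a b c d by simp
  show ?thesis unfolding hform_def
    by (rule eq, (rule has_wirt_add has_wirt_mult has_wirt_const d)+) (simp_all add: algebra_simps)
qed

text \<open>For \<open>dz\<close> the conjugated solutions are constants. The form and its
  z-derivative thus give a linear system for the two antiholomorphic factors whose determinant is
  the Wronskian, so both factors vanish. The same argument, applied to their conjugates, kills the
  coefficients.\<close>

lemma hform_independent:
  assumes E: "open E" "E \<noteq> {}" and y: "ode_sol Q E y y'" and w: "ode_sol Q E w w'"
    and W: "\<forall>z\<in>E. y z * w' z - y' z * w z = 1"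
    and 0: "\<And>z. z \<in> E \<Longrightarrow> hform p q r s (y z) (w z) = 0"
  shows "p = 0 \<and> q = 0 \<and> r = 0 \<and> s = 0"
proof -
  have key: "a = 0 \<and> b = 0" if ab: "\<And>z. z \<in> E \<Longrightarrow> a * y z + b * w z = 0" for a b
  proof -
    obtain z where z: "z \<in> E" using E(2) by blast
    have "((\<lambda>z. a * y z + b * w z) has_field_derivative a * y' z + b * w' z) (at z)"
      by (rule ode_solD(1)[OF ode_sol_lincomb[OF y w] z])
    then have "((\<lambda>z. 0) has_field_derivative a * y' z + b * w' z) (at z)"
      by (rule has_field_derivative_transform_within_open[OF _ E(1) z]) (simp add: ab)
    then have 1: "a * y' z + b * w' z = 0" using DERIV_unique[OF _ DERIV_const] by blast
    have "a * (y z * w' z - y' z * w z) = (a * y z + b * w z) * w' z - (a * y' z + b * w' z) * w z"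
      by (simp add: algebra_simps)
    then have "a = 0" unfolding 1 ab[OF z] bspec[OF W z] by simp
    have "b * (y z * w' z - y' z * w z) = (a * y' z + b * w' z) * y z - (a * y z + b * w z) * y' z"
      by (simp add: algebra_simps)
    then have "b = 0" unfolding 1 ab[OF z] bspec[OF W z] by simp
    with \<open>a = 0\<close> show ?thesis by simp
  qed
  have XY: "p * cnj (y z) + q * cnj (w z) = 0 \<and> r * cnj (y z) + s * cnj (w z) = 0" if z: "z \<in> E" for z
  proof -
    define X where "X = p * cnj (y z) + q * cnj (w z)"
    define Y where "Y = r * cnj (y z) + s * cnj (w z)"
    have "has_wirt (\<lambda>z. 0) z (y' z * X + w' z * Y) (cnj (y' z) * (p * y z + r * w z) + cnj (w' z) * (q * y z + s * w z))"
      unfolding X_def Y_def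
      by (rule has_wirt_cong_eq[OF E(1) z _ hform_wirt[OF y w z]]) (rule 0)
    then have 1: "y' z * X + w' z * Y = 0" using has_wirt_unique[OF has_wirt_const] by metis
    have 2: "y z * X + w z * Y = 0" using 0[OF z] by (simp add: hform_def X_def Y_def algebra_simps)
    have x: "X * (y z * w' z - y' z * w z) = (y z * X + w z * Y) * w' z - (y' z * X + w' z * Y) * w z"
      by (simp add: algebra_simps)
    have y: "Y * (y z * w' z - y' z * w z) = (y' z * X + w' z * Y) * y z - (y z * X + w z * Y) * y' z"
      by (simp add: algebra_simps)
    have "X = 0" "Y = 0" using x y unfolding 1 2 bspec[OF W z] by simp_all
    then show ?thesis by (simp add: X_def Y_def)
  qed
  have "cnj p = 0 \<and> cnj q = 0"
  proof (rule key)
    show "cnj p * y z + cnj q * w z = 0" if "z \<in> E" for z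
      using arg_cong[OF conjunct1[OF XY[OF that]], of cnj] by simp
  qed
  moreover have "cnj r = 0 \<and> cnj s = 0"
  proof (rule key)
    show "cnj r * y z + cnj s * w z = 0" if "z \<in> E" for z
      using arg_cong[OF conjunct2[OF XY[OF that]], of cnj] by simp
  qed
  ultimately show ?thesis by simp
qed

text \<open>Variation of constants: the coefficients of \<open>h\<close> with respect to \<open>y\<close> and \<open>w\<close> are antiholomorphic,
  and their conjugates solve the same linear equation.\<close>

lemma liouville_hform:
  assumes E: "convex E" "E \<noteq> {}" and h: "liouville E h"
    and y: "ode_sol (potential h) E y y'" and w: "ode_sol (potential h) E w w'"
    and W: "\<forall>z\<in>E. y z * w' z - y' z * w z = 1"
  shows "\<exists>(a::real) (d::real) b. (\<forall>z\<in>E. h z = hform (of_real a) b (cnj b) (of_real d) (y z) (w z))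
    \<and> a > 0 \<and> d > 0 \<and> a * d - (norm b)\<^sup>2 = 1 / 4"
proof -
  have oE: "open E" using h by (rule liouville_open)
  have Sm: "wirt_smooth_inf E h" using h by (auto simp: liouville_def)
  let ?Q = "potential h"
  have zz: "dz (dz h) z = - ?Q z * h z" if "z \<in> E" for z using liouville_nz[OF h that] by (simp add: potential_def)
  have zzb: "dzb (dzb h) z = - cnj (?Q z) * h z" if "z \<in> E" for z
    using liouville_cnj[OF h that] zz[OF that] by (metis complex_cnj_minus complex_cnj_mult)
  have ddz: "dz (dzb (dz h)) z = - ?Q z * dzb h z" if "z \<in> E" for z
  proof -
    have "h z * dz (dzb (dz h)) z = h z * (- ?Q z * dzb h z)" using liouville_third(1)[OF h that] zz[OF that] by simp
    then show ?thesis using mult_left_cancel[OF liouville_nz[OF h that]] by blast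
  qed
  have ddzb: "dzb (dzb (dz h)) z = - cnj (?Q z) * dz h z" if "z \<in> E" for z
  proof -
    have "dz (dzb (dzb h)) z = dz (\<lambda>z. - cnj (?Q z) * h z) z"
      by (rule wirt_cong(1)[OF oE that zzb])
    also have "\<dots> = - cnj (?Q z) * dz h z"
    proof -
      have "has_wirt (?Q) z (deriv ?Q z) 0"
        by (rule has_wirt_field[OF holomorphic_derivD[OF potential_holomorphic[OF h] oE that]])
      from has_wirt_mult[OF has_wirt_diff[OF has_wirt_const[of 0] has_wirt_cnj[OF this]] wirt_smooth_inf_wirt[OF Sm that]]
      show ?thesis by (auto dest!: has_wirtD(1))
    qed
    finally show ?thesis using liouville_third(4)[OF h that] by simp
  qed
  \<comment> \<open>The z-derivative of \<open>h u' - h_z u\<close> is zero because \<open>h\<close>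
    and \<open>u\<close> satisfy the same equation in z; hence its conjugate is holomorphic. It
    solves that equation too, since conjugation turns \<open>h_zz = - Q h\<close> into
    \<open>h_(zbar zbar) = - cnj Q h\<close>.\<close>
  have sol: "ode_sol ?Q E (\<lambda>z. cnj (h z * u' z - dz h z * u z)) (\<lambda>z. cnj (dzb h z * u' z - dzb (dz h) z * u z))"
    if u: "ode_sol ?Q E u u'" for u u'
    unfolding ode_sol_def
  proof (intro ballI conjI)
    fix z assume z: "z \<in> E"
    note wu = ode_sol_wirt(1,2)[OF u z]
    note wh = wirt_smooth_inf_wirt[OF Sm z] wirt_smooth_inf_wirt[OF wirt_smooth_inf_dz[OF Sm] z] wirt_smooth_inf_wirt[OF Sm_dzb[OF Sm] z] wirt_smooth_inf_wirt[OF Sm_dzb[OF wirt_smooth_inf_dz[OF Sm]] z]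
    have eq: "has_wirt F z a b \<Longrightarrow> a = c \<Longrightarrow> b = d \<Longrightarrow> has_wirt F z c d" for F a b c d by simp
    have "has_wirt (\<lambda>z. h z * u' z - dz h z * u z) z 0 (dzb h z * u' z - dzb (dz h) z * u z)"
      by (rule eq, (rule has_wirt_diff has_wirt_mult wu wh)+) (simp_all add: zz[OF z])
    from has_wirt_holomorphic[OF has_wirt_cnj[OF this, unfolded complex_cnj_zero]]
    show "((\<lambda>z. cnj (h z * u' z - dz h z * u z)) has_field_derivative cnj (dzb h z * u' z - dzb (dz h) z * u z)) (at z)" .
    have "has_wirt (\<lambda>z. dzb h z * u' z - dzb (dz h) z * u z) z 0 (- cnj (?Q z) * (h z * u' z - dz h z * u z))"
      by (rule eq, (rule has_wirt_diff has_wirt_mult wu wh)+)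
         (simp_all add: liouville_third(2)[OF h z] ddz[OF z] ddzb[OF z] zzb[OF z] algebra_simps)
    from has_wirt_holomorphic[OF has_wirt_cnj[OF this, unfolded complex_cnj_zero]]
    show "((\<lambda>z. cnj (dzb h z * u' z - dzb (dz h) z * u z)) has_field_derivative
       - ?Q z * cnj (h z * u' z - dz h z * u z)) (at z)" by simp
  qed
  obtain \<alpha> \<beta> where "\<forall>z\<in>E. cnj (h z * w' z - dz h z * w z) = \<alpha> * y z + \<beta> * w z
      \<and> cnj (dzb h z * w' z - dzb (dz h) z * w z) = \<alpha> * y' z + \<beta> * w' z"
    using ode_sol_span[OF E(1) oE y w W sol[OF w]] by (elim exE)
  then have ab: "cnj (h z * w' z - dz h z * w z) = \<alpha> * y z + \<beta> * w z" if "z \<in> E" for z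
    using that by blast
  obtain \<gamma> \<delta> where "\<forall>z\<in>E. cnj (h z * y' z - dz h z * y z) = \<gamma> * y z + \<delta> * w z
      \<and> cnj (dzb h z * y' z - dzb (dz h) z * y z) = \<gamma> * y' z + \<delta> * w' z"
    using ode_sol_span[OF E(1) oE y w W sol[OF y]] by (elim exE)
  then have cd: "cnj (h z * y' z - dz h z * y z) = \<gamma> * y z + \<delta> * w z" if "z \<in> E" for z
    using that by blast
  \<comment> \<open>With Wronskian 1, \<open>h\<close> is recovered as
    \<open>(h w' - h_z w) y - (h y' - h_z y) w\<close>, and both brackets are antiholomorphic
    combinations of conjugated solutions.\<close>
  have h0: "h z = hform (cnj \<alpha>) (cnj \<beta>) (- cnj \<gamma>) (- cnj \<delta>) (y z) (w z)" if z: "z \<in> E" for z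
  proof -
    have 1: "h z * w' z - dz h z * w z = cnj \<alpha> * cnj (y z) + cnj \<beta> * cnj (w z)"
      using arg_cong[OF ab[OF z], of cnj] by simp
    have 2: "h z * y' z - dz h z * y z = cnj \<gamma> * cnj (y z) + cnj \<delta> * cnj (w z)"
      using arg_cong[OF cd[OF z], of cnj] by simp
    have "h z * (y z * w' z - y' z * w z) = (h z * w' z - dz h z * w z) * y z - (h z * y' z - dz h z * y z) * w z"
      by (simp add: algebra_simps)
    then have "h z * 1 = (cnj \<alpha> * cnj (y z) + cnj \<beta> * cnj (w z)) * y z - (cnj \<gamma> * cnj (y z) + cnj \<delta> * cnj (w z)) * w z"
      unfolding bspec[OF W z] 1 2 .
    then show ?thesis by (simp add: hform_def algebra_simps)
  qed
  \<comment> \<open>Since \<open>h\<close> is real, the form equals its own conjugate; independence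
    turns this into Hermitian symmetry of the coefficients.\<close>
  have "cnj \<alpha> - \<alpha> = 0 \<and> cnj \<beta> - (- \<gamma>) = 0 \<and> - cnj \<gamma> - \<beta> = 0 \<and> - cnj \<delta> - (- \<delta>) = 0"
  proof (rule hform_independent[OF oE E(2) y w W])
    show "hform (cnj \<alpha> - \<alpha>) (cnj \<beta> - (- \<gamma>)) (- cnj \<gamma> - \<beta>) (- cnj \<delta> - (- \<delta>)) (y z) (w z) = 0" if z: "z \<in> E" for z
    proof -
      have "hform (cnj \<alpha>) (cnj \<beta>) (- cnj \<gamma>) (- cnj \<delta>) (y z) (w z) - cnj (hform (cnj \<alpha>) (cnj \<beta>) (- cnj \<gamma>) (- cnj \<delta>) (y z) (w z)) = 0"
        using h0[OF z] liouville_cnj(1)[OF h z] by simp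
      then show ?thesis by (simp add: hform_def algebra_simps)
    qed
  qed
  then have cc: "cnj \<alpha> = \<alpha>" "cnj \<delta> = \<delta>" "cnj \<gamma> = - \<beta>" by (auto simp: algebra_simps add_eq_0_iff2)
  define a where "a = Re \<alpha>"
  define d where "d = - Re \<delta>"
  define b where "b = cnj \<beta>"
  have re: "of_real a = cnj \<alpha>" "of_real d = - cnj \<delta>" "cnj b = - cnj \<gamma>" "b = cnj \<beta>"
    using cc by (auto simp: a_def d_def b_def complex_eq_iff)
  have hh: "h z = hform (of_real a) b (cnj b) (of_real d) (y z) (w z)" if z: "z \<in> E" for z
    using h0[OF z] unfolding re by (simp add: cc)
  obtain z where z: "z \<in> E" using E(2) by blast
  have dh: "dz h x = y' x * (a * cnj (y x) + b * cnj (w x)) + w' x * (cnj b * cnj (y x) + d * cnj (w x))"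
    "dzb h x = cnj (y' x) * (a * y x + cnj b * w x) + cnj (w' x) * (b * y x + d * w x)" if x: "x \<in> E" for x
    using has_wirtD[OF hform_wirt[OF y w x]] wirt_cong[OF oE x hh] by simp_all
  have "has_wirt (\<lambda>x. y' x * (a * cnj (y x) + b * cnj (w x)) + w' x * (cnj b * cnj (y x) + d * cnj (w x))) z
     (- ?Q z * y z * (a * cnj (y z) + b * cnj (w z)) + (- ?Q z * w z) * (cnj b * cnj (y z) + d * cnj (w z)))
     (y' z * (a * cnj (y' z) + b * cnj (w' z)) + w' z * (cnj b * cnj (y' z) + d * cnj (w' z)))"
  proof -
    have eq: "has_wirt F z a b \<Longrightarrow> a = c \<Longrightarrow> b = d \<Longrightarrow> has_wirt F z c d" for F a b c d by simp
    show ?thesis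
      by (rule eq, (rule has_wirt_add has_wirt_mult has_wirt_const ode_sol_wirt[OF y z] ode_sol_wirt[OF w z])+) simp_all
  qed
  from has_wirtD(2)[OF this] wirt_cong(2)[OF oE z dh(1)]
  have dd: "dzb (dz h) z = y' z * (a * cnj (y' z) + b * cnj (w' z)) + w' z * (cnj b * cnj (y' z) + d * cnj (w' z))" by simp
  \<comment> \<open>On a form, the left side of the Liouville equation is the determinant of the
    form times the squared modulus of the Wronskian; so the constant 1/4 is the determinant.\<close>
  have "1 / 4 = h z * dzb (dz h) z - dz h z * dzb h z" using h z by (simp add: liouville_def)
  also have "\<dots> = (a * d - b * cnj b) * ((y z * w' z - y' z * w z) * (cnj (y z) * cnj (w' z) - cnj (y' z) * cnj (w z)))"
    unfolding dd dh[OF z] hh[OF z] hform_def by (simp add: algebra_simps)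
  also have "cnj (y z) * cnj (w' z) - cnj (y' z) * cnj (w z) = cnj (y z * w' z - y' z * w z)" by simp
  also have "(a * d - b * cnj b) * ((y z * w' z - y' z * w z) * cnj (y z * w' z - y' z * w z)) = of_real (a * d - (norm b)\<^sup>2)"
    unfolding bspec[OF W z] by (simp only: complex_norm_square of_real_diff of_real_mult complex_cnj_one mult_1_right)
  finally have "complex_of_real (1 / 4) = of_real (a * d - (norm b)\<^sup>2)" by simp
  then have det: "a * d - (norm b)\<^sup>2 = 1 / 4" unfolding of_real_eq_iff by simp
  then have ad: "a * d > 0" using zero_le_power2[of "norm b"] by linarith
  \<comment> \<open>Completing the square: \<open>a h\<close> is a sum of squares because the
    determinant is positive, and positivity of \<open>h\<close> then fixes the sign of
    \<open>a\<close>.\<close>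
  have "of_real a * h z = (of_real a * y z + cnj b * w z) * cnj (of_real a * y z + cnj b * w z) + (of_real a * of_real d - b * cnj b) * (w z * cnj (w z))"
    unfolding hh[OF z] hform_def by (simp add: algebra_simps)
  also have "of_real a * of_real d - b * cnj b = of_real (1 / 4)"
    unfolding det[symmetric] by (simp only: complex_norm_square of_real_diff of_real_mult)
  also have "(of_real a * y z + cnj b * w z) * cnj (of_real a * y z + cnj b * w z) + of_real (1 / 4) * (w z * cnj (w z))
      = of_real ((norm (of_real a * y z + cnj b * w z))\<^sup>2 + 1 / 4 * (norm (w z))\<^sup>2)"
    by (simp only: complex_norm_square of_real_add of_real_mult)
  finally have "Re (of_real a * h z) = (norm (of_real a * y z + cnj b * w z))\<^sup>2 + 1 / 4 * (norm (w z))\<^sup>2" by simp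
  then have "a * Re (h z) \<ge> 0" by simp
  moreover have "Re (h z) > 0" using h z by (simp add: liouville_def)
  ultimately have "a \<ge> 0" by (simp add: zero_le_mult_iff)
  with ad have "a > 0" "d > 0" by (auto simp: zero_less_mult_iff)
  then show ?thesis using hh det by blast
qed

section \<open>Monodromy around a puncture\<close>

text \<open>The row vector \<open>(p, q)\<close> is a left eigenvector, as required for a
  combination \<open>p * y1 + q * y2\<close> of solutions whose translates are given by the rows of
  the matrix. The obvious candidates \<open>(\<gamma>, \<rho> - \<alpha>)\<close> and
  \<open>(\<rho> - \<delta>, \<beta>)\<close> may be zero, hence the three cases.\<close>

lemma eigenvector2:
  fixes \<alpha> \<beta> \<gamma> \<delta> :: complex
  shows "\<exists>\<rho> p q. (p \<noteq> 0 \<or> q \<noteq> 0) \<and> p * \<alpha> + q * \<gamma> = \<rho> * p \<and> p * \<beta> + q * \<delta> = \<rho> * q"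
proof -
  define D where "D = csqrt ((\<alpha> - \<delta>)\<^sup>2 + 4 * \<beta> * \<gamma>)"
  define \<rho> where "\<rho> = (\<alpha> + \<delta> + D) / 2"
  have "D\<^sup>2 = (\<alpha> - \<delta>)\<^sup>2 + 4 * \<beta> * \<gamma>" by (simp add: D_def)
  moreover have "D = 2 * \<rho> - (\<alpha> + \<delta>)" by (simp add: \<rho>_def field_simps)
  ultimately have "(2 * \<rho> - (\<alpha> + \<delta>))\<^sup>2 = (\<alpha> - \<delta>)\<^sup>2 + 4 * \<beta> * \<gamma>" by simp
  then have "4 * ((\<rho> - \<alpha>) * (\<rho> - \<delta>)) = 4 * (\<beta> * \<gamma>)" by (simp add: algebra_simps power2_eq_square)
  then have *: "(\<rho> - \<alpha>) * (\<rho> - \<delta>) = \<beta> * \<gamma>" by simp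
  consider "\<gamma> \<noteq> 0 \<or> \<rho> \<noteq> \<alpha>" | "\<rho> \<noteq> \<delta> \<or> \<beta> \<noteq> 0" | "\<gamma> = 0" "\<beta> = 0" "\<rho> = \<alpha>" "\<rho> = \<delta>" by blast
  then show ?thesis
  proof cases
    case 1
    then show ?thesis using *
      by (intro exI[of _ \<rho>] exI[of _ \<gamma>] exI[of _ "\<rho> - \<alpha>"]) (auto simp: algebra_simps)
  next
    case 2
    then show ?thesis using *
      by (intro exI[of _ \<rho>] exI[of _ "\<rho> - \<delta>"] exI[of _ \<beta>]) (auto simp: algebra_simps)
  next
    case 3
    then show ?thesis by (intro exI[of _ \<rho>] exI[of _ 1] exI[of _ 0]) auto
  qed
qed

lemma ode_sol_shift:
  assumes "ode_sol Q E y y'" and "\<And>z. z \<in> E \<Longrightarrow> z + \<tau> \<in> E" "\<And>z. z \<in> E \<Longrightarrow> Q (z + \<tau>) = Q z"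
  shows "ode_sol Q E (\<lambda>z. y (z + \<tau>)) (\<lambda>z. y' (z + \<tau>))"
  unfolding ode_sol_def using ode_solD[OF assms(1) assms(2)] assms(3) by (auto simp: DERIV_shift)

lemma potential_periodic:
  assumes h: "liouville E h" and \<tau>: "\<And>z. z \<in> E \<Longrightarrow> z + \<tau> \<in> E" and per: "\<And>z. z \<in> E \<Longrightarrow> h (z + \<tau>) = h z"
    and z: "z \<in> E"
  shows "potential h (z + \<tau>) = potential h z"
proof -
  have E: "open E" and Sm: "wirt_smooth_inf E h" using h by (auto simp: liouville_def)
  have sh: "((\<lambda>z. z + \<tau>) has_field_derivative 1) (at x)" for x
    by (auto intro!: derivative_eq_intros)
  have d: "dz F x = dz F (x + \<tau>)" if F: "wirt_smooth_inf E F" "\<And>x. x \<in> E \<Longrightarrow> F (x + \<tau>) = F x" and x: "x \<in> E" for F x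
  proof -
    have "has_wirt (\<lambda>x. F (x + \<tau>)) x (dz F (x + \<tau>) * 1) (dzb F (x + \<tau>) * cnj 1)"
      by (rule has_wirt_inner[OF wirt_smooth_inf_wirt[OF F(1) \<tau>[OF x]] sh])
    from has_wirt_cong_eq[OF E x F(2) this] show ?thesis using has_wirtD(1) by simp
  qed
  have "dz (dz h) z = dz (dz h) (z + \<tau>)"
    by (rule d[OF wirt_smooth_inf_dz[OF Sm] d[OF Sm per, symmetric] z])
  then show ?thesis using per[OF z] by (simp add: potential_def)
qed

text \<open>The translation has an eigenvector \<open>y\<close>, and it preserves the form that
  represents \<open>h\<close>. A second solution orthogonal to \<open>y\<close> for this form is
  then an eigenvector too, as for any unitary map.\<close>

lemma monodromy_diagonal:
  assumes E: "convex E" "E \<noteq> {}" and h: "liouville E h" and \<tau>: "\<And>z. z \<in> E \<Longrightarrow> z + \<tau> \<in> E"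
    and per: "\<And>z. z \<in> E \<Longrightarrow> h (z + \<tau>) = h z"
  shows "\<exists>y y' w w' \<rho> \<mu> a d. ode_sol (potential h) E y y' \<and> ode_sol (potential h) E w w' \<and>
    (\<forall>z\<in>E. y z * w' z - y' z * w z = 1) \<and> 0 < a \<and> 0 < d \<and> norm \<rho> = 1 \<and> norm \<mu> = 1 \<and>
    (\<forall>z\<in>E. y (z + \<tau>) = \<rho> * y z \<and> w (z + \<tau>) = \<mu> * w z \<and>
      Re (h z) = a * (norm (y z))\<^sup>2 + d * (norm (w z))\<^sup>2)"
proof -
  let ?Q = "potential h"
  have oE: "open E" by (rule liouville_open[OF h])
  obtain z0 where z0: "z0 \<in> E" using E(2) by blast
  have Q: "?Q holomorphic_on E" by (rule potential_holomorphic[OF h])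
  have Qper: "?Q (z + \<tau>) = ?Q z" if "z \<in> E" for z by (rule potential_periodic[OF h \<tau> per that])
  have shift: "ode_sol ?Q E (\<lambda>z. u (z + \<tau>)) (\<lambda>z. u' (z + \<tau>))" if "ode_sol ?Q E u u'" for u u'
    by (rule ode_sol_shift[OF that]) (use \<tau> Qper in auto)
  obtain y1 y1' where y1: "ode_sol ?Q E y1 y1'" "y1 z0 = 1" "y1' z0 = 0"
    using linear_ode_exists[OF E(1) oE z0 Q] by blast
  obtain y2 y2' where y2: "ode_sol ?Q E y2 y2'" "y2 z0 = 0" "y2' z0 = 1"
    using linear_ode_exists[OF E(1) oE z0 Q] by blast
  obtain c where c: "\<And>z. z \<in> E \<Longrightarrow> y1 z * y2' z - y1' z * y2 z = c"
    using wronskian_constant[OF E(1) oE y1(1) y2(1)] by blast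
  have "c = 1" using c[OF z0] y1 y2 by simp
  then have W12: "\<forall>z\<in>E. y1 z * y2' z - y1' z * y2 z = 1" using c by simp
  obtain \<alpha> \<beta> where ab: "\<forall>z\<in>E. y1 (z + \<tau>) = \<alpha> * y1 z + \<beta> * y2 z \<and> y1' (z + \<tau>) = \<alpha> * y1' z + \<beta> * y2' z"
    using ode_sol_span[OF E(1) oE y1(1) y2(1) W12 shift[OF y1(1)]] by (elim exE)
  obtain \<gamma> \<delta> where cd: "\<forall>z\<in>E. y2 (z + \<tau>) = \<gamma> * y1 z + \<delta> * y2 z \<and> y2' (z + \<tau>) = \<gamma> * y1' z + \<delta> * y2' z"
    using ode_sol_span[OF E(1) oE y1(1) y2(1) W12 shift[OF y2(1)]] by (elim exE)
  obtain \<rho> p q where pq: "p \<noteq> 0 \<or> q \<noteq> 0" "p * \<alpha> + q * \<gamma> = \<rho> * p" "p * \<beta> + q * \<delta> = \<rho> * q"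
    using eigenvector2 by blast
  define y where "y z = p * y1 z + q * y2 z" for z
  define y' where "y' z = p * y1' z + q * y2' z" for z
  have y: "ode_sol ?Q E y y'" unfolding y_def y'_def by (rule ode_sol_lincomb[OF y1(1) y2(1)])
  have y\<rho>: "y (z + \<tau>) = \<rho> * y z" if "z \<in> E" for z
  proof -
    have "y (z + \<tau>) = (p * \<alpha> + q * \<gamma>) * y1 z + (p * \<beta> + q * \<delta>) * y2 z"
      unfolding y_def conjunct1[OF bspec[OF ab that]] conjunct1[OF bspec[OF cd that]] by (simp add: algebra_simps)
    then show ?thesis unfolding pq by (simp add: y_def algebra_simps)
  qed
  \<comment> \<open>Completes \<open>(p, q)\<close> to a matrix of determinant 1, so that the new
    basis again has Wronskian 1.\<close>
  obtain r s where rs: "p * s - q * r = 1"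
  proof (cases "p = 0")
    case True
    then show ?thesis using pq(1) that[of 0 "- 1 / q"] by simp
  next
    case False
    then show ?thesis using that[of "1 / p" 0] by simp
  qed
  define w0 where "w0 z = r * y1 z + s * y2 z" for z
  define w0' where "w0' z = r * y1' z + s * y2' z" for z
  have w0: "ode_sol ?Q E w0 w0'" unfolding w0_def w0'_def by (rule ode_sol_lincomb[OF y1(1) y2(1)])
  have W0: "\<forall>z\<in>E. y z * w0' z - y' z * w0 z = 1"
  proof
    fix z assume z: "z \<in> E"
    have "y z * w0' z - y' z * w0 z = (p * s - q * r) * (y1 z * y2' z - y1' z * y2 z)"
      by (simp add: y_def y'_def w0_def w0'_def algebra_simps)
    then show "y z * w0' z - y' z * w0 z = 1" using rs W12 z by simp
  qed
  obtain a0 d :: real and b where "\<forall>z\<in>E. h z = hform (of_real a0) b (cnj b) (of_real d) (y z) (w0 z)"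
    and pos: "a0 > 0" "d > 0" "a0 * d - (norm b)\<^sup>2 = 1 / 4"
    using liouville_hform[OF E h y w0 W0] by blast
  then have hf: "h z = hform (of_real a0) b (cnj b) (of_real d) (y z) (w0 z)" if "z \<in> E" for z
    using that by blast
  \<comment> \<open>Adding this multiple of \<open>y\<close> to \<open>w0\<close> completes the
    square and removes the mixed term; the determinant 1/4 then forces the other diagonal entry to
    be \<open>1 / (4 * d)\<close>.\<close>
  define t where "t = b / of_real d"
  define w where "w z = t * y z + 1 * w0 z" for z
  define w' where "w' z = t * y' z + 1 * w0' z" for z
  have w: "ode_sol ?Q E w w'" unfolding w_def w'_def by (rule ode_sol_lincomb[OF y w0])
  have W: "\<forall>z\<in>E. y z * w' z - y' z * w z = 1"
    using W0 by (simp add: w_def w'_def algebra_simps)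
  define a where "a = 1 / (4 * d)"
  have a: "a > 0" using pos by (simp add: a_def)
  have hf2: "h z = hform (of_real a) 0 0 (of_real d) (y z) (w z)" if z: "z \<in> E" for z
  proof -
    have td: "of_real d * t = b" "of_real d * cnj t = cnj b" using pos by (simp_all add: t_def)
    have "d * a0 = d * a + (norm b)\<^sup>2" using pos by (simp add: a_def algebra_simps)
    then have "of_real d * of_real a0 = of_real d * of_real a + b * cnj b"
      by (metis complex_norm_square of_real_add of_real_mult)
    also have "\<dots> = of_real d * (of_real a + of_real d * (t * cnj t))"
      unfolding td[symmetric] by (simp add: algebra_simps)
    finally have a0: "of_real a0 = of_real a + of_real d * (t * cnj t)" using pos by simp
    show ?thesis unfolding hf[OF z] a0 hform_def w_def td[symmetric] by (simp add: algebra_simps)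
  qed
  obtain \<kappa> \<mu> where km: "\<forall>z\<in>E. w (z + \<tau>) = \<kappa> * y z + \<mu> * w z \<and> w' (z + \<tau>) = \<kappa> * y' z + \<mu> * w' z"
    using ode_sol_span[OF E(1) oE y w W shift[OF w]] by (elim exE)
  \<comment> \<open>Invariance of the form, coefficient by coefficient. The last equation gives
    \<open>norm \<mu> = 1\<close>, the second then \<open>\<kappa> = 0\<close>, which excludes a
    Jordan block, and the first \<open>norm \<rho> = 1\<close>.\<close>
  have "of_real a * (\<rho> * cnj \<rho> - 1) + of_real d * (\<kappa> * cnj \<kappa>) = 0 \<and> of_real d * (\<kappa> * cnj \<mu>) = 0
     \<and> of_real d * (\<mu> * cnj \<kappa>) = 0 \<and> of_real d * (\<mu> * cnj \<mu> - 1) = 0"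
  proof (rule hform_independent[OF oE E(2) y w W])
    fix z assume z: "z \<in> E"
    have "hform (of_real a) 0 0 (of_real d) (\<rho> * y z) (\<kappa> * y z + \<mu> * w z) = hform (of_real a) 0 0 (of_real d) (y z) (w z)"
      using hf2[OF \<tau>[OF z]] hf2[OF z] per[OF z] y\<rho>[OF z] km z by simp
    then show "hform (of_real a * (\<rho> * cnj \<rho> - 1) + of_real d * (\<kappa> * cnj \<kappa>)) (of_real d * (\<kappa> * cnj \<mu>))
       (of_real d * (\<mu> * cnj \<kappa>)) (of_real d * (\<mu> * cnj \<mu> - 1)) (y z) (w z) = 0"
      by (simp add: hform_def algebra_simps)
  qed
  then have c1: "of_real a * (\<rho> * cnj \<rho> - 1) + of_real d * (\<kappa> * cnj \<kappa>) = 0" and c2: "\<kappa> * cnj \<mu> = 0"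
    and c3: "\<mu> * cnj \<mu> = 1" using pos by auto
  have unit: "norm x = 1" if "x * cnj x = 1" for x :: complex
  proof -
    have "complex_of_real ((norm x)\<^sup>2) = of_real 1" using that complex_norm_square[of x] by simp
    then have "(norm x)\<^sup>2 = 1" unfolding of_real_eq_iff .
    then show ?thesis by (simp add: power2_eq_1_iff)
      (use norm_ge_zero[of x] in linarith)
  qed
  have \<mu>: "norm \<mu> = 1" by (rule unit[OF c3])
  then have \<kappa>: "\<kappa> = 0" using c2 by auto
  then have \<rho>: "norm \<rho> = 1" using c1 a by (intro unit) simp
  have "Re (h z) = a * (norm (y z))\<^sup>2 + d * (norm (w z))\<^sup>2" if "z \<in> E" for z
  proof -
    have "h z = of_real (a * (norm (y z))\<^sup>2 + d * (norm (w z))\<^sup>2)"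
      unfolding hf2[OF that] hform_def by (simp only: complex_norm_square of_real_add of_real_mult) simp
    then show ?thesis by simp
  qed
  then show ?thesis using y w W a pos(2) \<rho> \<mu> y\<rho> km \<kappa>
    by (intro exI[of _ y] exI[of _ y'] exI[of _ w] exI[of _ w'] exI[of _ \<rho>] exI[of _ \<mu>] exI[of _ a] exI[of _ d]) simp
qed

section \<open>Functions on a left half plane as functions of the exponential\<close>

lemma periodic_descent:
  assumes g: "g holomorphic_on {z. Re z < L}" and per: "\<And>z. Re z < L \<Longrightarrow> g (z + 2 * pi * \<i>) = g z"
  shows "\<exists>\<phi>. \<phi> holomorphic_on ball 0 (exp L) - {0} \<and> (\<forall>z. Re z < L \<longrightarrow> \<phi> (exp z) = g z)"
proof -
  have per_nat: "g (z + of_nat n * (2 * pi * \<i>)) = g z" if "Re z < L" for z n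
  proof (induction n)
    case (Suc n)
    have "g (z + of_nat (Suc n) * (2 * pi * \<i>)) = g ((z + of_nat n * (2 * pi * \<i>)) + 2 * pi * \<i>)"
      by (simp add: algebra_simps)
    also have "\<dots> = g (z + of_nat n * (2 * pi * \<i>))" by (rule per) (use that in simp)
    finally show ?case using Suc by simp
  qed simp
  have per_exp: "g z = g w" if e: "exp z = exp w" and z: "Re z < L" for z w
  proof -
    have w: "Re w < L" using e z by (metis norm_exp_eq_Re exp_less_cancel_iff)
    obtain n :: int where n: "z = w + (of_int (2 * n) * pi) * \<i>" using e exp_eq by blast
    show ?thesis
    proof (cases "n \<ge> 0")
      case True
      then have "z = w + of_nat (nat n) * (2 * pi * \<i>)" using n by (simp add: algebra_simps)
      then show ?thesis using per_nat[OF w] by simp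
    next
      case False
      then have "w = z + of_nat (nat (- n)) * (2 * pi * \<i>)" using n by (simp add: algebra_simps)
      then show ?thesis using per_nat[OF z] by simp
    qed
  qed
  define \<phi> where "\<phi> w = g (Ln w)" for w
  have ReLn: "Re (Ln w) < L" if "w \<in> ball 0 (exp L) - {0}" for w
  proof -
    have "exp (Re (Ln w)) < exp L" using that norm_exp_eq_Re[of "Ln w"] by simp
    then show ?thesis by simp
  qed
  have 1: "\<phi> (exp z) = g z" if "Re z < L" for z
    unfolding \<phi>_def
  proof (rule per_exp)
    show "exp (Ln (exp z)) = exp z" by simp
    then show "Re (Ln (exp z)) < L" using that by (metis norm_exp_eq_Re exp_less_cancel_iff)
  qed
  have "\<exists>f'. (\<phi> has_field_derivative f') (at w0)" if w0: "w0 \<in> ball 0 (exp L) - {0}" for w0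
  proof -
    \<comment> \<open>\<open>Ln\<close> jumps across the negative axis. Near \<open>w0\<close> the
      branch \<open>l\<close> centred at \<open>w0\<close> is holomorphic, and by periodicity every
      logarithm gives the same value of \<open>g\<close>.\<close>
    define N where "N = {w. w / w0 \<in> - \<real>\<^sub>\<le>\<^sub>0} \<inter> (ball 0 (exp L) - {0})"
    have N: "open N"
    proof -
      have "open ((\<lambda>w. w / w0) -` (- \<real>\<^sub>\<le>\<^sub>0))"
        using w0 by (intro continuous_open_vimage continuous_intros) (auto simp: closed_nonpos_Reals_complex open_Compl)
      then show ?thesis unfolding N_def by (intro open_Int) (auto simp: vimage_def open_delete)
    qed
    have w0N: "w0 \<in> N" using w0 by (auto simp: N_def)
    define l where "l w = Ln (w / w0) + Ln w0" for w
    have el: "exp (l w) = w" if "w \<in> N" for w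
      using that w0 by (simp add: l_def N_def exp_add)
    have Rel: "Re (l w) < L" if "w \<in> N" for w
    proof -
      have "exp (l w) = exp (Ln w)" using el[OF that] that by (auto simp: N_def)
      then have "Re (l w) = Re (Ln w)" by (metis norm_exp_eq_Re exp_inj_iff)
      then show ?thesis using ReLn[of w] that by (auto simp: N_def)
    qed
    have "l holomorphic_on N" unfolding l_def using w0
      by (intro holomorphic_intros) (auto simp: N_def)
    then have "(g \<circ> l) holomorphic_on N"
      by (rule holomorphic_on_compose_gen[OF _ g]) (use Rel in auto)
    then have "((g \<circ> l) has_field_derivative deriv (g \<circ> l) w0) (at w0)"
      by (rule holomorphic_derivD[OF _ N w0N])
    then have "(\<phi> has_field_derivative deriv (g \<circ> l) w0) (at w0)"
    proof (rule has_field_derivative_transform_within_open[OF _ N w0N])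
      show "(g \<circ> l) w = \<phi> w" if "w \<in> N" for w
        using 1[OF Rel[OF that]] el[OF that] by simp
    qed
    then show ?thesis by blast
  qed
  then have "\<phi> holomorphic_on ball 0 (exp L) - {0}"
    by (subst holomorphic_on_open) (auto simp: open_delete)
  then show ?thesis using 1 by blast
qed

text \<open>The multiplier is absorbed by \<open>exp (\<alpha> * z)\<close>, where
  \<open>\<alpha>\<close> is real because \<open>norm \<rho> = 1\<close>. The quotient descends to a
  function on a punctured disc; the growth bound rules out an essential singularity at 0, and the
  order of the zero or pole there joins \<open>\<alpha>\<close> in the exponent
  \<open>s\<close>.\<close>

lemma quasi_periodic_form:
  assumes y: "y holomorphic_on {z. Re z < L}" and qp: "\<And>z. Re z < L \<Longrightarrow> y (z + 2 * pi * \<i>) = \<rho> * y z"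
    and \<rho>: "norm \<rho> = 1" and bd: "\<And>z. Re z < L \<Longrightarrow> norm (y z) \<le> C * exp (- K * Re z)"
    and nz: "\<And>M. \<exists>z. Re z < M \<and> Re z < L \<and> y z \<noteq> 0"
  shows "\<exists>(s::real) Y L'. L' \<le> L \<and> Y holomorphic_on ball 0 (exp L') \<and> Y 0 \<noteq> 0 \<and>
    (\<forall>z. Re z < L' \<longrightarrow> y z = exp (of_real s * z) * Y (exp z))"
proof -
  define \<alpha> where "\<alpha> = Arg \<rho> / (2 * pi)"
  have e\<alpha>: "exp (of_real \<alpha> * (2 * pi * \<i>)) = \<rho>"
  proof -
    have e: "of_real \<alpha> * (2 * pi * \<i>) = \<i> * of_real (Arg \<rho>)" by (simp add: \<alpha>_def)
    have "\<rho> \<noteq> 0" using \<rho> by auto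
    then show ?thesis unfolding e using \<rho> Arg_eq[of \<rho>] by simp
  qed
  define g where "g z = y z * exp (- of_real \<alpha> * z)" for z
  have "g holomorphic_on {z. Re z < L}" unfolding g_def by (intro holomorphic_intros y)
  moreover have "g (z + 2 * pi * \<i>) = g z" if "Re z < L" for z
  proof -
    have "exp (- of_real \<alpha> * (z + 2 * pi * \<i>)) = exp (- of_real \<alpha> * z) / exp (of_real \<alpha> * (2 * pi * \<i>))"
      by (simp add: algebra_simps flip: exp_diff)
    then show ?thesis using that qp[OF that] \<rho> unfolding e\<alpha> g_def by auto
  qed
  ultimately have "\<exists>\<phi>. \<phi> holomorphic_on ball 0 (exp L) - {0} \<and> (\<forall>z. Re z < L \<longrightarrow> \<phi> (exp z) = g z)"
    by (rule periodic_descent)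
  then obtain \<phi> where \<phi>: "\<phi> holomorphic_on ball 0 (exp L) - {0}" "\<And>z. Re z < L \<Longrightarrow> \<phi> (exp z) = g z"
    by blast
  \<comment> \<open>Chosen so that \<open>exp ((real n - K - \<alpha>) * Re z)\<close> stays bounded
    on the half plane, which bounds \<open>\<phi> w * w ^ n\<close>.\<close>
  define n where "n = nat \<lceil>K + \<alpha>\<rceil>"
  have n: "real n \<ge> K + \<alpha>" unfolding n_def by linarith
  define C' where "C' = \<bar>C\<bar> * exp ((real n - K - \<alpha>) * L)"
  have bound: "norm (\<phi> w * w ^ n) \<le> C'" if w: "w \<in> ball 0 (exp L) - {0}" for w
  proof -
    define z where "z = Ln w"
    have ez: "exp z = w" using w by (simp add: z_def)
    have Rz: "Re z < L"
    proof -
      have "exp (Re z) < exp L" using w ez norm_exp_eq_Re[of z] by (simp add: dist_norm)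
      then show ?thesis by simp
    qed
    have "norm (\<phi> w * w ^ n) = norm (y z) * exp (- \<alpha> * Re z) * exp (Re z) ^ n"
      using \<phi>(2)[OF Rz] by (simp add: ez[symmetric] g_def norm_mult norm_power norm_exp_eq_Re)
    also have "\<dots> \<le> (\<bar>C\<bar> * exp (- K * Re z)) * exp (- \<alpha> * Re z) * exp (Re z) ^ n"
    proof (intro mult_right_mono)
      have "C * exp (- K * Re z) \<le> \<bar>C\<bar> * exp (- K * Re z)" by (intro mult_right_mono) auto
      then show "norm (y z) \<le> \<bar>C\<bar> * exp (- K * Re z)" using bd[OF Rz] by linarith
    qed auto
    also have "\<dots> = \<bar>C\<bar> * exp ((real n - K - \<alpha>) * Re z)"
      by (simp add: exp_of_nat_mult[symmetric] mult.assoc flip: exp_add) (simp add: algebra_simps)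
    also have "\<dots> \<le> C'" unfolding C'_def using n Rz
      by (intro mult_left_mono) (auto intro!: mult_left_mono)
    finally show ?thesis .
  qed
  define B where "B = ball (0::complex) (exp L)"
  have B: "open B" "0 \<in> B" by (auto simp: B_def)
  have ev: "\<forall>\<^sub>F w in at 0. w \<in> B - {0}" using eventually_at_in_open[OF B] .
  have lim0: "((\<lambda>w. \<phi> w * w ^ Suc n) \<longlongrightarrow> 0) (at 0)"
  proof (rule Lim_null_comparison)
    show "\<forall>\<^sub>F w in at 0. norm (\<phi> w * w ^ Suc n) \<le> C' * norm w"
      using ev
    proof eventually_elim
      case (elim w)
      have "norm (\<phi> w * w ^ Suc n) = norm (\<phi> w * w ^ n) * norm w" by (simp add: norm_mult norm_power)
      also have "\<dots> \<le> C' * norm w" using bound[of w] elim by (intro mult_right_mono) (auto simp: B_def)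
      finally show ?case .
    qed
    show "((\<lambda>w::complex. C' * norm w) \<longlongrightarrow> 0) (at 0)" by (auto intro!: tendsto_eq_intros)
  qed
  have iso: "isolated_singularity_at \<phi> 0"
    by (rule isolated_singularity_at_holomorphic[of _ B]) (use \<phi>(1) B in \<open>auto simp: B_def\<close>)
  have "not_essential (\<lambda>w. \<phi> w * w ^ Suc n) 0" using lim0 unfolding not_essential_def by blast
  moreover have iso2: "isolated_singularity_at (\<lambda>w. \<phi> w * w ^ Suc n) 0"
    by (rule isolated_singularity_at_holomorphic[of _ B]) (use \<phi>(1) B in \<open>auto simp: B_def intro!: holomorphic_intros\<close>)
  moreover have "not_essential (\<lambda>w::complex. w ^ Suc n) 0"
    unfolding not_essential_def by (intro exI[of _ 0] disjI1) (auto intro!: tendsto_eq_intros)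
  moreover have "isolated_singularity_at (\<lambda>w::complex. w ^ Suc n) 0"
    by (rule isolated_singularity_at_holomorphic[of _ B]) (use B in \<open>auto intro!: holomorphic_intros\<close>)
  ultimately have "not_essential (\<lambda>w. (\<phi> w * w ^ Suc n) / w ^ Suc n) 0"
    by (intro not_essential_divide)
  then have ness: "not_essential \<phi> 0"
    by (rule not_essential_transform) (rule eventually_mono[OF ev], simp)
  \<comment> \<open>A function that vanishes near 0 has no order; the points provided by
    \<open>nz\<close> exclude this.\<close>
  have freq: "\<exists>\<^sub>F w in at 0. \<phi> w \<noteq> 0"
  proof (rule ccontr)
    assume "\<not> (\<exists>\<^sub>F w in at 0. \<phi> w \<noteq> 0)"
    then have "\<forall>\<^sub>F w in at 0. \<phi> w = 0" by (simp add: not_frequently)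
    then obtain r where r: "r > 0" "\<And>w. w \<noteq> 0 \<Longrightarrow> dist w 0 < r \<Longrightarrow> \<phi> w = 0"
      unfolding eventually_at by auto
    obtain z where z: "Re z < ln r" "Re z < L" "y z \<noteq> 0" using nz by blast
    have "norm (exp z) < r" using z(1) r(1) by (metis norm_exp_eq_Re exp_less_cancel_iff exp_ln)
    then have "g z = 0" using \<phi>(2)[OF z(2)] r(2)[of "exp z"] by simp
    then show False using z(3) by (simp add: g_def)
  qed
  define m where "m = zorder \<phi> 0"
  define Y where "Y = zor_poly \<phi> 0"
  obtain r where r: "Y 0 \<noteq> 0" "r > 0" "Y holomorphic_on cball 0 r" "\<And>w. w \<in> cball 0 r - {0} \<Longrightarrow> \<phi> w = Y w * (w - 0) powi m"
    using zorder_exist[OF iso ness freq] unfolding m_def Y_def by blast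
  define L' where "L' = min L (ln r)"
  have "exp L' \<le> r" using r(2) unfolding L'_def by (metis exp_le_cancel_iff exp_ln min.cobounded2)
  then have sub: "ball 0 (exp L') \<subseteq> cball (0::complex) r" by auto
  have "y z = exp (of_real (\<alpha> + of_int m) * z) * Y (exp z)" if z: "Re z < L'" for z
  proof -
    have zL: "Re z < L" using z by (simp add: L'_def)
    have "exp z \<in> ball 0 (exp L')" using z by (simp add: norm_exp_eq_Re)
    then have "exp z \<in> cball 0 r" using sub by (rule subsetD[rotated])
    then have "exp z \<in> cball 0 r - {0}" by simp
    then have "g z = Y (exp z) * exp z powi m" using r(4) \<phi>(2)[OF zL] by simp
    moreover have "exp (of_real \<alpha> * z) * exp (- of_real \<alpha> * z) = 1" by (simp flip: exp_add)
    then have "y z = exp (of_real \<alpha> * z) * g z" unfolding g_def by (metis mult.left_commute mult_1_right)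
    moreover have "exp z powi m = exp (of_int m * z)" by (simp add: exp_power_int)
    moreover have "exp (of_real (\<alpha> + of_int m) * z) = exp (of_real \<alpha> * z) * exp (of_int m * z)"
      by (simp add: algebra_simps flip: exp_add)
    ultimately show ?thesis by simp
  qed
  then show ?thesis using r holomorphic_on_subset[OF r(3) sub]
    by (intro exI[of _ "\<alpha> + of_int m"] exI[of _ Y] exI[of _ L']) (simp add: L'_def)
qed

text \<open>Both summands are eventually positive, so nothing cancels as x tends to minus infinity:
  a negative exponent drives the sum to infinity, and two positive exponents drive it to 0. The
  lemma reads an exponent of the linear equation off the growth of the metric.\<close>

lemma exp_sum_exponent_zero:
  fixes p q :: "real \<Rightarrow> real"
  assumes p: "(p \<longlongrightarrow> P) at_bot" "P > 0" and q: "(q \<longlongrightarrow> Q) at_bot" "Q > 0"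
    and lim: "((\<lambda>x. exp (a * x) * p x + exp (b * x) * q x) \<longlongrightarrow> c) at_bot" and c: "c > 0"
  shows "a = 0 \<or> b = 0"
proof (rule ccontr)
  assume "\<not> (a = 0 \<or> b = 0)"
  then have nz: "a \<noteq> 0" "b \<noteq> 0" by auto
  have pos: "\<forall>\<^sub>F x in at_bot. p x > 0" "\<forall>\<^sub>F x in at_bot. q x > 0"
    using order_tendstoD(1)[OF p] order_tendstoD(1)[OF q] .
  have neg: "filterlim (\<lambda>x. exp (a * x) * p x) at_top at_bot" if "a < 0" "(p \<longlongrightarrow> P) at_bot" "P > 0"
    for a P and p :: "real \<Rightarrow> real"
  proof -
    have "filterlim (\<lambda>x. (- a) * (- x)) at_top at_bot"
      using that(1) by (intro filterlim_tendsto_pos_mult_at_top[OF tendsto_const _ filterlim_uminus_at_top_at_bot]) simp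
    then have "filterlim (\<lambda>x. a * x) at_top at_bot" by simp
    then have "filterlim (\<lambda>x. exp (a * x)) at_top at_bot"
      by (rule filterlim_compose[OF exp_at_top])
    from filterlim_tendsto_pos_mult_at_top[OF that(2,3) this] show ?thesis by (simp add: mult.commute)
  qed
  have posi: "((\<lambda>x. exp (a * x) * p x) \<longlongrightarrow> 0) at_bot" if "a > 0" "(p \<longlongrightarrow> P) at_bot"
    for a P and p :: "real \<Rightarrow> real"
  proof -
    have "filterlim (\<lambda>x. a * x) at_bot at_bot"
      using that(1) by (intro filterlim_tendsto_pos_mult_at_bot[OF tendsto_const] filterlim_ident)
    then have "((\<lambda>x. exp (a * x)) \<longlongrightarrow> 0) at_bot" by (rule filterlim_compose[OF exp_at_bot])
    from tendsto_mult[OF this that(2)] show ?thesis by simp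
  qed
  have notop: "\<not> filterlim (\<lambda>x. exp (a * x) * p x + exp (b * x) * q x) at_top at_bot"
    using not_tendsto_and_filterlim_at_infinity[OF _ lim] filterlim_at_top_imp_at_infinity by auto
  show False
  proof (cases "a < 0 \<or> b < 0")
    case True
    then show False
    proof
      assume "a < 0"
      have "filterlim (\<lambda>x. exp (a * x) * p x + exp (b * x) * q x) at_top at_bot"
        by (rule filterlim_at_top_mono[OF neg[OF \<open>a < 0\<close> p]]) (use pos(2) in \<open>auto elim!: eventually_mono\<close>)
      with notop show False by blast
    next
      assume "b < 0"
      have "filterlim (\<lambda>x. exp (a * x) * p x + exp (b * x) * q x) at_top at_bot"
        by (rule filterlim_at_top_mono[OF neg[OF \<open>b < 0\<close> q]]) (use pos(1) in \<open>auto elim!: eventually_mono\<close>)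
      with notop show False by blast
    qed
  next
    case False
    then have "a > 0" "b > 0" using nz by auto
    from tendsto_add[OF posi[OF this(1) p(1)] posi[OF this(2) q(1)]]
    have "((\<lambda>x. exp (a * x) * p x + exp (b * x) * q x) \<longlongrightarrow> 0) at_bot" by simp
    from tendsto_unique[OF _ lim this] c show False by simp
  qed
qed

text \<open>In the variable \<open>w = exp z\<close> the derivation d/dz is w d/dw, so y'' becomes
  the square of (w d/dw + s) applied to \<open>Y\<close>. The - 1/4 in \<open>Q\<close> is the
  correction that a potential acquires under pullback by \<open>exp\<close>.\<close>

lemma ode_exp_transfer:
  assumes y: "ode_sol Q {z. Re z < L} y y'" and Y: "Y holomorphic_on ball 0 (exp L)"
    and yY: "\<And>z. Re z < L \<Longrightarrow> y z = exp (s * z) * Y (exp z)"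
    and Q: "\<And>z. Re z < L \<Longrightarrow> Q z = T (exp z) * exp z ^ 2 - 1 / 4"
    and w: "w \<in> ball 0 (exp L) - {0}"
  shows "w\<^sup>2 * deriv (deriv Y) w + (2 * s + 1) * w * deriv Y w + (s\<^sup>2 - 1 / 4 + w\<^sup>2 * T w) * Y w = 0"
proof -
  define E where "E = {z. Re z < L}"
  have oE: "open E" unfolding E_def by (rule open_halfspace_Re_lt)
  define z where "z = Ln w"
  have ez: "exp z = w" using w by (simp add: z_def)
  have eB: "exp x \<in> ball 0 (exp L)" if "x \<in> E" for x using that by (simp add: E_def norm_exp_eq_Re)
  have zE: "z \<in> E"
  proof -
    have "exp (Re z) < exp L" using w ez norm_exp_eq_Re[of z] by (simp add: dist_norm)
    then show ?thesis by (simp add: E_def)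
  qed
  have dY: "((\<lambda>x. Y (exp x)) has_field_derivative deriv Y (exp x) * exp x) (at x)" if "x \<in> E" for x
    by (rule DERIV_chain2[OF holomorphic_derivD[OF Y open_ball eB[OF that]] DERIV_exp])
  have dY': "((\<lambda>x. deriv Y (exp x)) has_field_derivative deriv (deriv Y) (exp x) * exp x) (at x)" if "x \<in> E" for x
    by (rule DERIV_chain2[OF holomorphic_derivD[OF holomorphic_deriv[OF Y open_ball] open_ball eB[OF that]] DERIV_exp])
  have y'Y: "exp (s * x) * (s * Y (exp x) + exp x * deriv Y (exp x)) = y' x" if x: "x \<in> E" for x
  proof -
    have "((\<lambda>x. exp (s * x) * Y (exp x)) has_field_derivative exp (s * x) * (s * Y (exp x) + exp x * deriv Y (exp x))) (at x)"
      by (rule derivative_eq_intros dY[OF x] refl)+ (simp add: algebra_simps)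
    moreover have "((\<lambda>x. exp (s * x) * Y (exp x)) has_field_derivative y' x) (at x)"
      by (rule has_field_derivative_transform_within_open[OF ode_solD(1)[OF y] oE x])
         (use x yY in \<open>auto simp: E_def\<close>)
    ultimately show ?thesis by (rule DERIV_unique)
  qed
  have "((\<lambda>x. exp (s * x) * (s * Y (exp x) + exp x * deriv Y (exp x))) has_field_derivative
      exp (s * z) * (s\<^sup>2 * Y w + (2 * s + 1) * w * deriv Y w + w\<^sup>2 * deriv (deriv Y) w)) (at z)"
    by (rule derivative_eq_intros dY[OF zE] dY'[OF zE] refl)+ (simp add: ez algebra_simps power2_eq_square)
  moreover have "((\<lambda>x. exp (s * x) * (s * Y (exp x) + exp x * deriv Y (exp x))) has_field_derivative - Q z * y z) (at z)"
    by (rule has_field_derivative_transform_within_open[OF ode_solD(2)[OF y] oE zE])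
       (use zE y'Y in \<open>auto simp: E_def\<close>)
  ultimately have "exp (s * z) * (s\<^sup>2 * Y w + (2 * s + 1) * w * deriv Y w + w\<^sup>2 * deriv (deriv Y) w) = - Q z * y z"
    by (rule DERIV_unique)
  also have "\<dots> = exp (s * z) * (- (T w * w\<^sup>2 - 1 / 4) * Y w)"
    using zE Q[of z] yY[of z] by (simp add: E_def ez)
  finally have "s\<^sup>2 * Y w + (2 * s + 1) * w * deriv Y w + w\<^sup>2 * deriv (deriv Y) w = - (T w * w\<^sup>2 - 1 / 4) * Y w"
    by simp
  then show ?thesis by (simp add: algebra_simps)
qed

text \<open>On the half plane the metric coefficient grows like
  \<open>exp (- (\<beta> + 1) * Re z)\<close> and is a sum of two squared moduli, so one of the two
  diagonal solutions has exponent \<open>\<sigma> = - (\<beta> + 1) / 2\<close>. Undoing the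
  pullback by \<open>exp\<close> adds 1/2 and gives the exponent - \<beta> / 2 at the puncture.
  Which of the two solutions it is remains open and does not affect the conclusion.\<close>

lemma conical_frobenius:
  assumes h: "liouville (ball 0 r - {0}) h" and r: "r > 0"
    and lim: "((\<lambda>z. norm z powr \<beta> * Re (h z)) \<longlongrightarrow> c) (at 0)" and c: "c > 0"
  shows "\<exists>Y r'. 0 < r' \<and> r' \<le> r \<and> Y holomorphic_on ball 0 r' \<and> Y 0 \<noteq> 0 \<and>
    (\<forall>z\<in>ball 0 r' - {0}. z\<^sup>2 * deriv (deriv Y) z - of_real \<beta> * z * deriv Y z
       + (z\<^sup>2 * potential h z + of_real (\<beta> / 2 * (\<beta> / 2 + 1))) * Y z = 0)"
proof -
  have "\<forall>\<^sub>F z in at 0. norm z powr \<beta> * Re (h z) < c + 1" using order_tendstoD(2)[OF lim] by simp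
  then obtain r1 where r1: "r1 > 0" "\<And>z. z \<noteq> 0 \<Longrightarrow> norm z < r1 \<Longrightarrow> norm z powr \<beta> * Re (h z) < c + 1"
    unfolding eventually_at by auto
  define r0 where "r0 = min r r1"
  have r0: "r0 > 0" "r0 \<le> r" "r0 \<le> r1" using r r1 by (auto simp: r0_def)
  define L where "L = ln r0"
  have eL: "exp L = r0" using r0 by (simp add: L_def)
  define E where "E = {z. Re z < L}"
  have oE: "open E" and cE: "convex E" unfolding E_def by (rule open_halfspace_Re_lt convex_halfspace_Re_lt)+
  have neE: "E \<noteq> {}" unfolding E_def by (auto intro!: exI[of _ "of_real (L - 1)"])
  have nexp: "norm (exp z) < r0" if "z \<in> E" for z :: complex
    using that eL by (simp add: E_def norm_exp_eq_Re flip: eL)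
  define \<psi> :: "complex \<Rightarrow> complex" where "\<psi> z = exp (- z / 2)" for z
  define k where "k z = h (exp z) * \<psi> z * cnj (\<psi> z)" for z
  have \<psi>hol: "\<psi> holomorphic_on E" unfolding \<psi>_def by (intro holomorphic_intros) auto
  have \<psi>sq: "\<psi> z * \<psi> z * exp z = 1" for z by (simp add: \<psi>_def flip: exp_add)
  have sub: "exp ` E \<subseteq> ball 0 r - {0}" using nexp r0 by fastforce
  have der\<psi>: "deriv \<psi> = (\<lambda>z. \<psi> z * (- 1 / 2))"
    unfolding \<psi>_def by (rule ext, rule DERIV_imp_deriv) (auto intro!: derivative_eq_intros)
  have der\<psi>2: "deriv (deriv \<psi>) z = \<psi> z / 4" for z
    unfolding der\<psi> by (rule DERIV_imp_deriv) (auto intro!: derivative_eq_intros simp: \<psi>_def)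
  have hE: "exp holomorphic_on E" by (intro holomorphic_intros)
  have eq1: "(\<psi> z)\<^sup>2 * deriv exp z = 1" for z using \<psi>sq[of z] by (simp add: power2_eq_square DERIV_imp_deriv[OF DERIV_exp])
  have k: "liouville E k" and pk: "\<And>z. z \<in> E \<Longrightarrow> potential k z = potential h (exp z) / \<psi> z ^ 4 - deriv (deriv \<psi>) z / \<psi> z"
    using liouville_pullback[OF h oE hE sub \<psi>hol eq1] by (simp_all add: k_def[abs_def])
  have pk': "potential k z = potential h (exp z) * exp z ^ 2 - 1 / 4" if "z \<in> E" for z
  proof -
    have "\<psi> z \<noteq> 0" by (simp add: \<psi>_def)
    moreover have "\<psi> z ^ 4 * exp z ^ 2 = 1"
    proof -
      have "\<psi> z ^ 4 * exp z ^ 2 = (\<psi> z * \<psi> z * exp z) ^ 2" by (simp add: power2_eq_square power4_eq_xxxx)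
      then show ?thesis using \<psi>sq[of z] by simp
    qed
    ultimately have "potential h (exp z) / \<psi> z ^ 4 = potential h (exp z) * exp z ^ 2"
      by (simp add: field_simps)
    then show ?thesis using pk[OF that] der\<psi>2[of z] \<open>\<psi> z \<noteq> 0\<close> by simp
  qed
  \<comment> \<open>The square root of the derivative changes sign after one turn, but
    \<open>k\<close> contains it together with its conjugate and is therefore periodic.\<close>
  have per\<psi>: "\<psi> (z + 2 * pi * \<i>) = - \<psi> z" for z
  proof -
    have "\<psi> (z + 2 * pi * \<i>) = exp (- z / 2) * exp (- (pi * \<i>))"
      unfolding \<psi>_def exp_add[symmetric] by (rule arg_cong[of _ _ exp]) (simp add: field_simps)
    also have "exp (- (pi * \<i>)) = - 1" by (simp add: exp_minus mult.commute)
    finally show ?thesis by (simp add: \<psi>_def)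
  qed
  have perk: "k (z + 2 * pi * \<i>) = k z" for z
    unfolding k_def per\<psi> by (simp add: exp_add mult.commute)
  have \<tau>E: "z + 2 * pi * \<i> \<in> E" if "z \<in> E" for z using that by (simp add: E_def)
  have Rk: "Re (k z) = Re (h (exp z)) * exp (- Re z)" for z
  proof -
    have "\<psi> z * cnj (\<psi> z) = of_real (exp (- Re z))"
    proof -
      have "\<psi> z * cnj (\<psi> z) = of_real ((norm (\<psi> z))\<^sup>2)" by (simp only: complex_norm_square)
      also have "norm (\<psi> z) = exp (- Re z / 2)" by (simp add: \<psi>_def norm_exp_eq_Re)
      also have "(exp (- Re z / 2))\<^sup>2 = exp (- Re z)" by (simp add: power2_eq_square flip: exp_add)
      finally show ?thesis .
    qed
    then have "k z = h (exp z) * of_real (exp (- Re z))" unfolding k_def by (simp only: mult.assoc)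
    then show ?thesis by simp
  qed
  have "\<exists>y y' w w' \<rho> \<mu> a d. ode_sol (potential k) E y y' \<and> ode_sol (potential k) E w w' \<and>
    (\<forall>z\<in>E. y z * w' z - y' z * w z = 1) \<and> 0 < a \<and> 0 < d \<and> norm \<rho> = 1 \<and> norm \<mu> = 1 \<and>
    (\<forall>z\<in>E. y (z + 2 * pi * \<i>) = \<rho> * y z \<and> w (z + 2 * pi * \<i>) = \<mu> * w z \<and>
      Re (k z) = a * (norm (y z))\<^sup>2 + d * (norm (w z))\<^sup>2)"
    by (rule monodromy_diagonal[OF cE neE k \<tau>E perk])
  then obtain y y' w w' \<rho> \<mu> a d where y: "ode_sol (potential k) E y y'" and w: "ode_sol (potential k) E w w'"
    and W: "\<forall>z\<in>E. y z * w' z - y' z * w z = 1" and ad: "0 < a" "0 < d" and un: "norm \<rho> = 1" "norm \<mu> = 1"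
    and mon: "\<forall>z\<in>E. y (z + 2 * pi * \<i>) = \<rho> * y z \<and> w (z + 2 * pi * \<i>) = \<mu> * w z \<and>
      Re (k z) = a * (norm (y z))\<^sup>2 + d * (norm (w z))\<^sup>2"
    by (elim exE conjE)
  have kb: "Re (k z) \<le> (c + 1) * exp (- (\<beta> + 1) * Re z)" if z: "z \<in> E" for z
  proof -
    have "norm (exp z) powr \<beta> * Re (h (exp z)) \<le> c + 1" using r1(2)[of "exp z"] nexp[OF z] r0 by simp
    then have "exp (\<beta> * Re z) * Re (h (exp z)) \<le> c + 1" by (simp add: norm_exp_eq_Re powr_def)
    then have "exp (- (\<beta> + 1) * Re z) * (exp (\<beta> * Re z) * Re (h (exp z))) \<le> exp (- (\<beta> + 1) * Re z) * (c + 1)"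
      by (intro mult_left_mono) auto
    moreover have "exp (- (\<beta> + 1) * Re z) * exp (\<beta> * Re z) = exp (- Re z)"
      by (simp add: algebra_simps flip: exp_add)
    then have "exp (- (\<beta> + 1) * Re z) * (exp (\<beta> * Re z) * Re (h (exp z))) = Re (k z)"
      unfolding Rk mult.assoc[symmetric] by (simp only: mult.commute)
    ultimately show ?thesis by (simp only: mult.commute)
  qed
  have form: "\<exists>(s::real) Y L'. L' \<le> L \<and> Y holomorphic_on ball 0 (exp L') \<and> Y 0 \<noteq> 0 \<and>
    (\<forall>z. Re z < L' \<longrightarrow> u z = exp (of_real s * z) * Y (exp z))"
    if u: "ode_sol (potential k) E u u'" and per: "\<And>z. z \<in> E \<Longrightarrow> u (z + 2 * pi * \<i>) = \<nu> * u z" and \<nu>: "norm \<nu> = 1"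
      and e: "e > 0" and le: "\<And>z. z \<in> E \<Longrightarrow> e * (norm (u z))\<^sup>2 \<le> Re (k z)"
      and v: "\<And>z. z \<in> E \<Longrightarrow> u z * v' z - u' z * v z \<noteq> 0" for u u' v v' :: "complex \<Rightarrow> complex" and \<nu> e
  proof (rule quasi_periodic_form[OF _ _ \<nu>])
    show "u holomorphic_on {z. Re z < L}"
      using ode_solD(1)[OF u] oE by (fold E_def) (auto simp: holomorphic_on_open)
    show "u (z + 2 * pi * \<i>) = \<nu> * u z" if "Re z < L" for z using per that by (simp add: E_def)
    show "norm (u z) \<le> sqrt ((c + 1) / e) * exp (- ((\<beta> + 1) / 2) * Re z)" if "Re z < L" for z
    proof -
      have zE: "z \<in> E" using that by (simp add: E_def)
      have "(norm (u z))\<^sup>2 \<le> (c + 1) / e * exp (- (\<beta> + 1) * Re z)"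
        using le[OF zE] kb[OF zE] e by (simp add: field_simps)
      also have "\<dots> = (sqrt ((c + 1) / e) * exp (- ((\<beta> + 1) / 2) * Re z))\<^sup>2"
      proof -
        have "(exp (- ((\<beta> + 1) / 2) * Re z))\<^sup>2 = exp (- (\<beta> + 1) * Re z)"
          unfolding power2_eq_square exp_add[symmetric] by (rule arg_cong[of _ _ exp]) (simp add: field_simps)
        then show ?thesis using c e by (simp add: power_mult_distrib)
      qed
      finally show ?thesis by (rule power2_le_imp_le) (use c e in auto)
    qed
    \<comment> \<open>If \<open>u\<close> vanished on a half plane then so would \<open>u'\<close>,
      and the Wronskian with \<open>v\<close> would be 0 there.\<close>
    show "\<exists>z. Re z < M \<and> Re z < L \<and> u z \<noteq> 0" for M
    proof (rule ccontr)
      assume "\<nexists>z. Re z < M \<and> Re z < L \<and> u z \<noteq> 0"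
      then have 0: "u z = 0" if "Re z < min M L" for z using that by auto
      define z1 where "z1 = complex_of_real (min M L - 1)"
      have z1: "z1 \<in> {z. Re z < min M L}" "z1 \<in> E" by (auto simp: z1_def E_def)
      have "((\<lambda>z. 0) has_field_derivative u' z1) (at z1)"
        by (rule has_field_derivative_transform_within_open[OF ode_solD(1)[OF u z1(2)] open_halfspace_Re_lt z1(1)]) (use 0 in auto)
      then have "u' z1 = 0" using DERIV_unique[OF _ DERIV_const] by blast
      then show False using v[OF z1(2)] 0[of z1] z1(1) by simp
    qed
  qed
  obtain s Y L1 where Y: "L1 \<le> L" "Y holomorphic_on ball 0 (exp L1)" "Y 0 \<noteq> 0"
    "\<forall>z. Re z < L1 \<longrightarrow> y z = exp (complex_of_real s * z) * Y (exp z)"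
    using form[OF y _ un(1) ad(1), of w' w] mon W ad by fastforce
  obtain t X L2 where X: "L2 \<le> L" "X holomorphic_on ball 0 (exp L2)" "X 0 \<noteq> 0"
    "\<forall>z. Re z < L2 \<longrightarrow> w z = exp (complex_of_real t * z) * X (exp z)"
  proof -
    have "w z * y' z - w' z * y z \<noteq> 0" if "z \<in> E" for z
      using bspec[OF W that] by (auto simp: algebra_simps)
    then show ?thesis using form[OF w _ un(2) ad(2), of y' y] mon ad that by fastforce
  qed
  have "2 * s + \<beta> + 1 = 0 \<or> 2 * t + \<beta> + 1 = 0"
  proof (rule exp_sum_exponent_zero[OF _ _ _ _ _ c])
    have ex0: "((\<lambda>x. complex_of_real (exp x)) \<longlongrightarrow> 0) at_bot"
      using tendsto_of_real[OF exp_at_bot, where 'a = complex] by simp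
    have sq: "((\<lambda>x. e * (norm (Z (complex_of_real (exp x))))\<^sup>2) \<longlongrightarrow> e * (norm (Z 0))\<^sup>2) at_bot"
      if "Z holomorphic_on ball 0 (exp l)" for Z e l
    proof -
      have "isCont Z 0" using that holomorphic_on_imp_continuous_on continuous_on_eq_continuous_at
        by (metis centre_in_ball exp_gt_zero open_ball)
      then show ?thesis by (intro tendsto_intros isCont_tendsto_compose[OF _ ex0])
    qed
    show "((\<lambda>x. a * (norm (Y (complex_of_real (exp x))))\<^sup>2) \<longlongrightarrow> a * (norm (Y 0))\<^sup>2) at_bot" by (rule sq[OF Y(2)])
    show "((\<lambda>x. d * (norm (X (complex_of_real (exp x))))\<^sup>2) \<longlongrightarrow> d * (norm (X 0))\<^sup>2) at_bot" by (rule sq[OF X(2)])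
    show "a * (norm (Y 0))\<^sup>2 > 0" "d * (norm (X 0))\<^sup>2 > 0" using ad Y(3) X(3) by auto
    have at0: "filterlim (\<lambda>x. complex_of_real (exp x)) (at 0) at_bot"
      using ex0 by (simp add: filterlim_at)
    \<comment> \<open>The positive real axis suffices: along it both holomorphic factors tend to
      their nonzero values at 0, and only the exponentials are left to compare.\<close>
    have lim': "((\<lambda>x. norm (complex_of_real (exp x)) powr \<beta> * Re (h (complex_of_real (exp x)))) \<longlongrightarrow> c) at_bot"
      by (rule filterlim_compose[OF lim at0])
    have ev: "\<forall>\<^sub>F x in at_bot. norm (complex_of_real (exp x)) powr \<beta> * Re (h (complex_of_real (exp x))) =
      exp ((2 * s + \<beta> + 1) * x) * (a * (norm (Y (complex_of_real (exp x))))\<^sup>2)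
      + exp ((2 * t + \<beta> + 1) * x) * (d * (norm (X (complex_of_real (exp x))))\<^sup>2)"
      using eventually_gt_at_bot[of "min L1 L2"]
    proof eventually_elim
      case (elim x)
      define z where "z = complex_of_real x"
      have z: "z \<in> E" "Re z = x" "Re z < L1" "Re z < L2" using elim Y(1) by (auto simp: z_def E_def)
      have ez: "exp z = complex_of_real (exp x)" by (simp add: z_def exp_of_real)
      have "Re (h (exp z)) = exp x * Re (k z)" unfolding Rk z(2) by (simp add: exp_minus)
      also have "Re (k z) = a * (norm (y z))\<^sup>2 + d * (norm (w z))\<^sup>2" using mon z(1) by blast
      also have "norm (y z) = exp (s * x) * norm (Y (exp z))"
        using Y(4) z(2,3) by (simp add: norm_mult norm_exp_eq_Re)
      also have "norm (w z) = exp (t * x) * norm (X (exp z))"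
        using X(4) z(2,4) by (simp add: norm_mult norm_exp_eq_Re)
      finally have e: "Re (h (exp z)) = exp x * (a * (exp (s * x) * norm (Y (exp z)))\<^sup>2 + d * (exp (t * x) * norm (X (exp z)))\<^sup>2)" .
      have p: "norm (exp z) powr \<beta> = exp (\<beta> * x)" by (simp add: norm_exp_eq_Re powr_def z(2))
      have e3: "exp ((2 * q + \<beta> + 1) * x) = exp (\<beta> * x) * (exp x * (exp (q * x))\<^sup>2)" for q
        by (simp add: power2_eq_square algebra_simps flip: exp_add)
      show ?case unfolding ez[symmetric] e p e3 by (simp add: algebra_simps power_mult_distrib)
    qed
    show "((\<lambda>x. exp ((2 * s + \<beta> + 1) * x) * (a * (norm (Y (complex_of_real (exp x))))\<^sup>2)
      + exp ((2 * t + \<beta> + 1) * x) * (d * (norm (X (complex_of_real (exp x))))\<^sup>2)) \<longlongrightarrow> c) at_bot"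
      by (rule Lim_transform_eventually[OF lim' ev])
  qed
  then obtain u u' \<sigma> Z l where u: "ode_sol (potential k) E u u'" and Z: "l \<le> L" "Z holomorphic_on ball 0 (exp l)" "Z 0 \<noteq> 0"
    "\<forall>z. Re z < l \<longrightarrow> u z = exp (complex_of_real \<sigma> * z) * Z (exp z)" and \<sigma>: "2 * \<sigma> + \<beta> + 1 = 0"
    using y w Y X by blast
  have el: "exp l \<le> r" using Z(1) eL r0 by (metis exp_le_cancel_iff order_trans)
  show ?thesis
  proof (intro exI[of _ Z] exI[of _ "exp l"] conjI ballI)
    fix z :: complex assume z: "z \<in> ball 0 (exp l) - {0}"
    have ode: "z\<^sup>2 * deriv (deriv Z) z + (2 * complex_of_real \<sigma> + 1) * z * deriv Z z
       + ((complex_of_real \<sigma>)\<^sup>2 - 1 / 4 + z\<^sup>2 * potential h z) * Z z = 0"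
    proof (rule ode_exp_transfer[OF _ Z(2) _ _ z])
      show "ode_sol (potential k) {z. Re z < l} u u'" using u Z(1) by (auto simp: ode_sol_def E_def)
      show "u x = exp (complex_of_real \<sigma> * x) * Z (exp x)" if "Re x < l" for x using Z(4) that by blast
      show "potential k x = potential h (exp x) * exp x ^ 2 - 1 / 4" if "Re x < l" for x
        by (rule pk') (use that Z(1) in \<open>simp add: E_def\<close>)
    qed
    have "\<sigma> = - (\<beta> + 1) / 2" using \<sigma> by (simp add: field_simps)
    then have "complex_of_real \<sigma> = - (of_real \<beta> + 1) / 2"
      by (simp only: of_real_divide of_real_minus of_real_add of_real_1 of_real_numeral)
    then have e: "2 * complex_of_real \<sigma> + 1 = - of_real \<beta>" "(complex_of_real \<sigma>)\<^sup>2 - 1 / 4 = of_real (\<beta> / 2 * (\<beta> / 2 + 1))"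
      by (simp_all only:) (simp_all add: field_simps power2_eq_square)
    show "z\<^sup>2 * deriv (deriv Z) z - of_real \<beta> * z * deriv Z z
       + (z\<^sup>2 * potential h z + of_real (\<beta> / 2 * (\<beta> / 2 + 1))) * Z z = 0"
      using ode unfolding e by (simp add: add.commute)
  qed (use Z el in auto)
qed

section \<open>Three singularities in normal position\<close>

text \<open>The exponents at 0 are 0 and \<open>\<beta> + 1\<close>. In the recurrence for the
  Taylor coefficients, \<open>(k + 1) (k - \<beta>) F_(k+1) = (k - p) (k - q) F_k\<close>, the left
  factor vanishes at \<open>k = \<beta>\<close>. A holomorphic solution with nonzero value at 0 can
  pass this index only if the right factor has vanished for some
  \<open>k \<le> \<beta>\<close>.\<close>

lemma hypergeometric_no_log:
  fixes X :: "complex \<Rightarrow> complex" and \<beta> :: nat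
  assumes X: "X holomorphic_on ball 0 r" "r > 0" "X 0 \<noteq> 0"
    and ode: "\<And>z. z \<in> ball 0 r - {0} \<Longrightarrow>
      z * (z - 1) * deriv (deriv X) z - ((of_nat \<beta> + b) * z - of_nat \<beta>) * deriv X z + p * q * X z = 0"
    and pq: "p + q = of_nat \<beta> + b + 1"
  shows "\<exists>k\<le>\<beta>. of_nat k = p \<or> of_nat k = q"
proof (rule ccontr)
  assume "\<not> ?thesis"
  then have no: "of_nat k \<noteq> p" "of_nat k \<noteq> q" if "k \<le> \<beta>" for k using that by auto
  define F where "F = fps_expansion X 0"
  have F: "X has_fps_expansion F" unfolding F_def
    using X by (intro has_fps_expansion_fps_expansion[of "ball 0 r"]) auto
  define G where "G z = z * (z * deriv (deriv X) z) - z * deriv (deriv X) z - (of_nat \<beta> + b) * (z * deriv X z)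
     + of_nat \<beta> * deriv X z + (p * q) * X z" for z
  define GF where "GF = fps_X * (fps_X * fps_deriv (fps_deriv F)) - fps_X * fps_deriv (fps_deriv F)
     - fps_const (of_nat \<beta> + b) * (fps_X * fps_deriv F) + fps_const (of_nat \<beta>) * fps_deriv F + fps_const (p * q) * F"
  have GF: "G has_fps_expansion GF"
    unfolding G_def[abs_def] GF_def by (intro fps_expansion_intros F)
  have hol: "deriv X holomorphic_on ball 0 r" "deriv (deriv X) holomorphic_on ball 0 r"
    using X by (auto intro: holomorphic_deriv)
  have G0: "G z = 0" if "z \<in> ball 0 r - {0}" for z
    using ode[OF that] by (simp add: G_def algebra_simps)
  \<comment> \<open>The equation is given off the singular point; continuity adds the centre, so
    that the power series of \<open>G\<close> is zero.\<close>
  have "G z = 0" if "z \<in> ball 0 r" for z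
  proof (cases "z = 0")
    case True
    have "isCont G 0"
    proof -
      have "continuous_on (ball 0 r) G" unfolding G_def
        by (intro continuous_intros holomorphic_on_imp_continuous_on hol X(1))
      then show ?thesis using X(2) by (simp add: continuous_on_eq_continuous_at)
    qed
    then have "(G \<longlongrightarrow> G 0) (at 0)" by (simp add: isCont_def)
    moreover have "(G \<longlongrightarrow> 0) (at 0)"
    proof (rule Lim_transform_eventually[OF tendsto_const])
      show "\<forall>\<^sub>F z in at 0. 0 = G z"
        using eventually_at_in_open[of "ball 0 r" 0] X(2) by (auto elim!: eventually_mono simp: G0)
    qed
    ultimately show ?thesis using True tendsto_unique[of "at 0" G] by auto
  qed (use that G0 in auto)
  then have ev: "\<forall>\<^sub>F z in nhds 0. G z = 0"
    using X(2) by (intro eventually_nhds[THEN iffD2] exI[of _ "ball 0 r"]) auto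
  have "(\<lambda>_. 0) has_fps_expansion GF" using GF has_fps_expansion_cong[OF ev refl] by simp
  from fps_nth_fps_expansion[OF this] have GF0: "fps_nth GF k = 0" for k
    by (cases k) (simp_all add: higher_deriv_const)
  have rec: "of_nat (Suc k) * (of_nat k - of_nat \<beta>) * fps_nth F (Suc k) = (of_nat k - p) * (of_nat k - q) * fps_nth F k" for k
  proof -
    have "of_nat k * (of_nat k - 1) * fps_nth F k - of_nat (Suc k) * of_nat k * fps_nth F (Suc k)
      - (of_nat \<beta> + b) * of_nat k * fps_nth F k + of_nat \<beta> * of_nat (Suc k) * fps_nth F (Suc k) + p * q * fps_nth F k = 0"
      using GF0[of k] unfolding GF_def
      by (cases k; cases "k - 1") (simp_all add: algebra_simps)
    note e = this
    have bb: "of_nat \<beta> + b = p + q - 1" using pq by simp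
    show ?thesis using e unfolding bb by (simp add: algebra_simps)
  qed
  have nz: "fps_nth F k \<noteq> 0" if "k \<le> \<beta>" for k
    using that
  proof (induction k)
    case 0 then show ?case using X(3) by (simp add: F_def fps_expansion_def)
  next
    case (Suc k)
    then show ?case using rec[of k] no[of k] by auto
  qed
  show False using rec[of \<beta>] nz[of \<beta>] no[of \<beta>] by simp
qed

text \<open>The value of \<open>- s (s - 1)\<close> at the exponents \<open>s = - \<beta> / 2\<close> and \<open>s = 1 + \<beta> / 2\<close> of \<open>y'' + T y = 0\<close>.\<close>

definition indicial :: "real \<Rightarrow> complex" where
  "indicial \<beta> = - of_real (\<beta> / 2 * (\<beta> / 2 + 1))"

text \<open>The equation of \<open>conical_frobenius\<close>, divided by the nonvanishing
  \<open>Y\<close>, expresses \<open>z\<^sup>2 * potential h z\<close> through functions continuous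
  at 0, whose value there is the indicial constant.\<close>

lemma conical_potential_limit:
  assumes "liouville (ball 0 r - {0}) h" "r > 0" "((\<lambda>z. norm z powr \<beta> * Re (h z)) \<longlongrightarrow> c) (at 0)" "c > 0"
  shows "((\<lambda>z. z\<^sup>2 * potential h z) \<longlongrightarrow> indicial \<beta>) (at 0)"
proof -
  obtain Y r' where Y: "0 < r'" "Y holomorphic_on ball 0 r'" "Y 0 \<noteq> 0"
    and ode: "\<forall>z\<in>ball 0 r' - {0}. z\<^sup>2 * deriv (deriv Y) z - of_real \<beta> * z * deriv Y z
       + (z\<^sup>2 * potential h z + of_real (\<beta> / 2 * (\<beta> / 2 + 1))) * Y z = 0"
    using conical_frobenius[OF assms] by blast
  have c: "isCont Y 0" "isCont (deriv Y) 0" "isCont (deriv (deriv Y)) 0"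
    using Y holomorphic_on_imp_continuous_on[of _ "ball 0 r'"] holomorphic_deriv[of _ "ball 0 r'"]
    by (simp_all add: continuous_on_eq_continuous_at)
  have "((\<lambda>z. indicial \<beta> + (of_real \<beta> * z * deriv Y z - z\<^sup>2 * deriv (deriv Y) z) / Y z)
      \<longlongrightarrow> indicial \<beta> + (of_real \<beta> * 0 * deriv Y 0 - 0\<^sup>2 * deriv (deriv Y) 0) / Y 0) (at 0)"
    by (intro tendsto_intros isContD c Y(3))
  then have l: "((\<lambda>z. indicial \<beta> + (of_real \<beta> * z * deriv Y z - z\<^sup>2 * deriv (deriv Y) z) / Y z) \<longlongrightarrow> indicial \<beta>) (at 0)"
    by simp
  have "\<forall>\<^sub>F z in at 0. Y z \<noteq> 0" using isContD[OF c(1)] Y(3) by (rule tendsto_imp_eventually_ne)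
  moreover have "\<forall>\<^sub>F z in at 0. z \<in> ball 0 r' - {0}" using Y(1) by (intro eventually_at_in_open) auto
  ultimately have "\<forall>\<^sub>F z in at 0. indicial \<beta> + (of_real \<beta> * z * deriv Y z - z\<^sup>2 * deriv (deriv Y) z) / Y z = z\<^sup>2 * potential h z"
  proof eventually_elim
    case (elim z)
    have "(of_real \<beta> * z * deriv Y z - z\<^sup>2 * deriv (deriv Y) z) = (z\<^sup>2 * potential h z - indicial \<beta>) * Y z"
      using bspec[OF ode elim(2)] unfolding indicial_def by (simp add: algebra_simps)
    then show ?case using elim(1) by simp
  qed
  then show ?thesis by (rule Lim_transform_eventually[OF l])
qed

text \<open>After multiplication by \<open>z\<^sup>2 * (z - 1)\<^sup>2\<close> the singularities at
  0 and 1 are removable and the growth is at most quadratic, so Liouville's theorem leaves a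
  quadratic polynomial; the three limits are its values at 0 and 1 and its leading coefficient.
  \<open>T (1 / z) / z ^ 4\<close> is the potential in the coordinate at infinity, because the
  Schwarzian of a Moebius map is zero.\<close>

lemma three_double_poles:
  assumes T: "T holomorphic_on UNIV - {0, 1}"
    and l0: "((\<lambda>z. z\<^sup>2 * T z) \<longlongrightarrow> a) (at 0)" and l1: "((\<lambda>z. z\<^sup>2 * T (z + 1)) \<longlongrightarrow> b) (at 0)"
    and linf: "((\<lambda>z. z\<^sup>2 * (T (1 / z) / z ^ 4)) \<longlongrightarrow> c) (at 0)" and z: "z \<noteq> 0" "z \<noteq> 1"
  shows "z\<^sup>2 * (z - 1)\<^sup>2 * T z = c * z\<^sup>2 + (b - a - c) * z + a"
proof -
  define R0 where "R0 z = z\<^sup>2 * (z - 1)\<^sup>2 * T z" for z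
  have R0: "R0 holomorphic_on (UNIV - {1}) - {0}"
    unfolding R0_def by (intro holomorphic_intros holomorphic_on_subset[OF T]) auto
  have lim0: "(R0 \<longlongrightarrow> a) (at 0)"
  proof -
    have "((\<lambda>z. (z - 1)\<^sup>2 * (z\<^sup>2 * T z)) \<longlongrightarrow> (0 - 1)\<^sup>2 * a) (at 0)" by (intro tendsto_intros l0)
    then show ?thesis by (simp add: R0_def[abs_def] mult_ac)
  qed
  have lim1: "(R0 \<longlongrightarrow> b) (at 1)"
  proof -
    have "((\<lambda>z. (z + 1)\<^sup>2 * (z\<^sup>2 * T (z + 1))) \<longlongrightarrow> (0 + 1)\<^sup>2 * b) (at 0)" by (intro tendsto_intros l1)
    then have "((\<lambda>z. R0 (z + 1)) \<longlongrightarrow> b) (at 0)" by (simp add: R0_def mult_ac)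
    then show ?thesis using LIM_offset_zero_cancel[of R0 1 b] by (simp add: add.commute)
  qed
  define R1 where "R1 z = (if z = 0 then a else R0 z)" for z
  have R1: "R1 holomorphic_on UNIV - {1}"
    unfolding R1_def by (rule removable_singularity[OF R0 _ lim0]) (auto intro: open_delete)
  have "(R1 \<longlongrightarrow> b) (at 1)"
  proof (rule Lim_transform_eventually[OF lim1])
    have "\<forall>\<^sub>F z in at (1::complex). z \<in> ball 1 1 - {1}" by (intro eventually_at_in_open) auto
    then show "\<forall>\<^sub>F z in at 1. R0 z = R1 z" by eventually_elim (auto simp: R1_def)
  qed
  define R where "R z = (if z = 1 then b else R1 z)" for z
  have R: "R holomorphic_on UNIV"
    unfolding R_def by (rule removable_singularity[OF R1 _ \<open>(R1 \<longlongrightarrow> b) (at 1)\<close>]) auto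
  have Reg: "R z = z\<^sup>2 * (z - 1)\<^sup>2 * T z" if "z \<noteq> 0" "z \<noteq> 1" for z
    using that by (simp add: R_def R1_def R0_def)
  have limR: "((\<lambda>z. R (1 / z) * z\<^sup>2) \<longlongrightarrow> c) (at 0)"
  proof (rule Lim_transform_eventually)
    have "((\<lambda>z. (1 - z)\<^sup>2 * (z\<^sup>2 * (T (1 / z) / z ^ 4))) \<longlongrightarrow> (1 - 0)\<^sup>2 * c) (at 0)"
      by (intro tendsto_intros linf)
    then show "((\<lambda>z. (1 - z)\<^sup>2 * (z\<^sup>2 * (T (1 / z) / z ^ 4))) \<longlongrightarrow> c) (at 0)" by simp
    have "\<forall>\<^sub>F z in at (0::complex). z \<in> ball 0 1 - {0}" by (intro eventually_at_in_open) auto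
    then show "\<forall>\<^sub>F z in at 0. (1 - z)\<^sup>2 * (z\<^sup>2 * (T (1 / z) / z ^ 4)) = R (1 / z) * z\<^sup>2"
    proof eventually_elim
      case (elim z)
      have z: "z \<noteq> 0" "1 / z \<noteq> 1" "1 / z \<noteq> 0" using elim by auto
      have "1 / z - 1 = (1 - z) / z" using z by (simp add: field_simps)
      then show ?case unfolding Reg[OF z(3,2)] using z(1)
        by (simp add: power_divide field_simps power2_eq_square power4_eq_xxxx)
    qed
  qed
  have "\<forall>\<^sub>F z in at 0. norm (R (1 / z) * z\<^sup>2) < norm c + 1"
    using order_tendstoD(2)[OF tendsto_norm[OF limR]] by simp
  then obtain \<delta> where \<delta>: "\<delta> > 0" "\<And>z. z \<noteq> 0 \<Longrightarrow> norm z < \<delta> \<Longrightarrow> norm (R (1 / z) * z\<^sup>2) < norm c + 1"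
    unfolding eventually_at by auto
  have "norm (R x) \<le> (norm c + 1) * norm x ^ 2" if x: "2 / \<delta> \<le> norm x" for x
  proof -
    have xn: "norm x > 0" using x \<delta>(1) by (meson divide_pos_pos less_le_trans zero_less_numeral)
    have "2 \<le> norm x * \<delta>" using x \<delta>(1) by (simp add: field_simps)
    then have "1 / norm x < \<delta>" using xn by (simp add: field_simps)
    then have "norm (1 / x) < \<delta>" by (simp add: norm_divide)
    then have "norm (R x * (1 / x)\<^sup>2) < norm c + 1" using \<delta>(2)[of "1 / x"] xn by simp
    then show ?thesis using xn by (simp add: norm_mult norm_divide norm_power field_simps)
  qed
  from Liouville_polynomial[OF R this]
  have poly: "R x = (\<Sum>k\<le>2. (deriv ^^ k) R 0 / fact k * x ^ k)" for x by blast
  define r0 r1 r2 where "r0 = (deriv ^^ 0) R 0 / fact 0" and "r1 = (deriv ^^ 1) R 0 / fact 1" and "r2 = (deriv ^^ 2) R 0 / fact 2"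
  have Rp: "R x = r0 + r1 * x + r2 * x\<^sup>2" for x
    using poly[of x] by (simp add: r0_def r1_def r2_def numeral_2_eq_2)
  have "((\<lambda>z. R (1 / z) * z\<^sup>2) \<longlongrightarrow> r2) (at 0)"
  proof (rule Lim_transform_eventually)
    have "((\<lambda>z. r0 * z\<^sup>2 + r1 * z + r2) \<longlongrightarrow> r0 * 0\<^sup>2 + r1 * 0 + r2) (at 0)" by (intro tendsto_intros)
    then show "((\<lambda>z. r0 * z\<^sup>2 + r1 * z + r2) \<longlongrightarrow> r2) (at 0)" by simp
    have "\<forall>\<^sub>F z in at (0::complex). z \<in> UNIV - {0}" by (intro eventually_at_in_open) auto
    then show "\<forall>\<^sub>F z in at 0. r0 * z\<^sup>2 + r1 * z + r2 = R (1 / z) * z\<^sup>2"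
      by eventually_elim (simp add: Rp field_simps power2_eq_square)
  qed
  then have r2: "r2 = c" using tendsto_unique[OF _ limR] by auto
  have "R 0 = a" by (simp add: R_def R1_def)
  then have r0: "r0 = a" by (simp add: Rp)
  have "R 1 = b" by (simp add: R_def)
  then have "r0 + r1 + r2 = b" by (simp add: Rp)
  then have r1: "r1 = b - a - c" using r0 r2 by (simp add: algebra_simps)
  show ?thesis using Reg[OF z] Rp[of z] r0 r1 r2 by (simp add: algebra_simps)
qed

text \<open>\<open>Y\<close> already lacks the factor \<open>z^(- \<beta>1 / 2)\<close>.
  Multiplication by \<open>(1 - z)^(\<beta>2 / 2)\<close> moves the exponent - \<beta>2 / 2 at 1 to
  0 as well. With 0 as an exponent at both finite singular points, the double poles drop to simple
  ones and the equation becomes hypergeometric.\<close>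

lemma frobenius_to_hypergeometric:
  fixes \<beta>1 \<beta>2 \<beta>3 :: nat and Y T :: "complex \<Rightarrow> complex"
  assumes Y: "Y holomorphic_on ball 0 r" "0 < r" "r \<le> 1" "Y 0 \<noteq> 0"
    and ode: "\<And>z. z \<in> ball 0 r - {0} \<Longrightarrow> z\<^sup>2 * deriv (deriv Y) z - of_nat \<beta>1 * z * deriv Y z
       + (z\<^sup>2 * T z - indicial \<beta>1) * Y z = 0"
    and T: "\<And>z. z \<noteq> 0 \<Longrightarrow> z \<noteq> 1 \<Longrightarrow> z\<^sup>2 * (z - 1)\<^sup>2 * T z =
       indicial \<beta>3 * z\<^sup>2 + (indicial \<beta>2 - indicial \<beta>1 - indicial \<beta>3) * z + indicial \<beta>1"
  shows "\<exists>k\<le>\<beta>1. of_nat k = (of_nat \<beta>1 + of_nat \<beta>2 - of_nat \<beta>3) / (2::complex)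
      \<or> of_nat k = (of_nat \<beta>1 + of_nat \<beta>2 + of_nat \<beta>3) / (2::complex) + 1"
proof -
  define m :: complex where "m = of_nat \<beta>2 / 2"
  define s :: complex where "s = of_nat \<beta>1 / 2"
  define c :: complex where "c = of_nat \<beta>3 / 2"
  have ind: "indicial \<beta>1 = - (s * (s + 1))" "indicial \<beta>2 = - (m * (m + 1))" "indicial \<beta>3 = - (c * (c + 1))"
    by (simp_all add: indicial_def m_def s_def c_def)
  \<comment> \<open>The power \<open>(1 - z)^m\<close>; since \<open>r \<le> 1\<close>, the argument
    of the logarithm stays in the right half plane.\<close>
  define e where "e z = exp (m * Ln (1 - z))" for z
  define X where "X z = e z * Y z" for z
  have lnok: "1 - z \<notin> \<real>\<^sub>\<le>\<^sub>0" if "z \<in> ball 0 r" for z :: complex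
  proof
    assume "1 - z \<in> \<real>\<^sub>\<le>\<^sub>0"
    then have "Re (1 - z) \<le> 0" by (auto simp: complex_nonpos_Reals_iff)
    then have "1 \<le> Re z" by simp
    also have "\<dots> \<le> norm z" by (rule complex_Re_le_cmod)
    finally show False using that Y(3) by simp
  qed
  have n1: "z \<noteq> 1" if "z \<in> ball 0 r" for z :: complex using lnok[OF that] by auto
  have de: "(e has_field_derivative e z * (- m / (1 - z))) (at z)" if "z \<in> ball 0 r" for z
    unfolding e_def using lnok[OF that] n1[OF that]
    by (auto intro!: derivative_eq_intros simp: field_simps)
  have hol': "deriv Y holomorphic_on ball 0 r" using Y by (auto intro: holomorphic_deriv)
  have dY: "(Y has_field_derivative deriv Y z) (at z)" "(deriv Y has_field_derivative deriv (deriv Y) z) (at z)"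
    if "z \<in> ball 0 r" for z
    using holomorphic_derivD[OF Y(1) open_ball that] holomorphic_derivD[OF hol' open_ball that] .
  define X' where "X' z = e z * (deriv Y z - m / (1 - z) * Y z)" for z
  have dX: "(X has_field_derivative X' z) (at z)" if "z \<in> ball 0 r" for z
    unfolding X_def X'_def
    by (rule derivative_eq_intros refl de[OF that] dY[OF that])+ (simp add: algebra_simps)
  define X'' where "X'' z = e z * (deriv (deriv Y) z - 2 * m / (1 - z) * deriv Y z + (m\<^sup>2 - m) / (1 - z)\<^sup>2 * Y z)" for z
  have dX': "(X' has_field_derivative X'' z) (at z)" if "z \<in> ball 0 r" for z
  proof -
    have dq: "((\<lambda>z. m / (1 - z)) has_field_derivative m / (1 - z)\<^sup>2) (at z)"
      using n1[OF that] by (auto intro!: derivative_eq_intros simp: power2_eq_square)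
    have "(X' has_field_derivative
        e z * (deriv (deriv Y) z - (m / (1 - z) * deriv Y z + m / (1 - z)\<^sup>2 * Y z))
        + e z * (- m / (1 - z)) * (deriv Y z - m / (1 - z) * Y z)) (at z)"
      unfolding X'_def
      by (rule DERIV_cong[OF DERIV_mult[OF de[OF that] DERIV_diff[OF dY(2)[OF that] DERIV_mult[OF dq dY(1)[OF that]]]]])
         (simp add: algebra_simps)
    moreover have "e z * (deriv (deriv Y) z - (m / (1 - z) * deriv Y z + m / (1 - z)\<^sup>2 * Y z))
        + e z * (- m / (1 - z)) * (deriv Y z - m / (1 - z) * Y z) = X'' z"
      using n1[OF that] unfolding X''_def
      by (simp add: divide_simps power2_eq_square) (simp add: algebra_simps)
    ultimately show ?thesis by simp
  qed
  have derX: "deriv X z = X' z" if "z \<in> ball 0 r" for z using dX[OF that] by (rule DERIV_imp_deriv)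
  have derX': "deriv (deriv X) z = X'' z" if "z \<in> ball 0 r" for z
  proof (rule DERIV_imp_deriv)
    show "(deriv X has_field_derivative X'' z) (at z)"
      by (rule has_field_derivative_transform_within_open[OF dX'[OF that] open_ball that]) (simp add: derX)
  qed
  \<comment> \<open>The two degrees of growth at infinity: \<open>- c\<close> and
    \<open>c + 1\<close> for y'' + T y = 0, each raised by \<open>s + m\<close> through the factors
    split off at 0 and 1.\<close>
  define p q where "p = s + m - c" and "q = s + m + c + 1"
  have "\<exists>k\<le>\<beta>1. of_nat k = p \<or> of_nat k = q"
  proof (rule hypergeometric_no_log)
    show "X holomorphic_on ball 0 r" using dX by (subst holomorphic_on_open) blast+
    show "r > 0" "X 0 \<noteq> 0" using Y by (auto simp: X_def e_def)
    show "p + q = of_nat \<beta>1 + 2 * m + 1" by (simp add: p_def q_def s_def)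
    show "z * (z - 1) * deriv (deriv X) z - ((of_nat \<beta>1 + 2 * m) * z - of_nat \<beta>1) * deriv X z + p * q * X z = 0"
      if z: "z \<in> ball 0 r - {0}" for z
    proof -
      have zb: "z \<in> ball 0 r" "z \<noteq> 0" "z \<noteq> 1" using z n1 by auto
      define y y' y'' where "y = Y z" and "y' = deriv Y z" and "y'' = deriv (deriv Y) z"
      define t where "t = 1 - z"
      have t: "t \<noteq> 0" "z = 1 - t" using zb(3) by (auto simp: t_def)
      have s2: "of_nat \<beta>1 = 2 * s" by (simp add: s_def)
      have "z\<^sup>2 * (z - 1)\<^sup>2 * T z = (- (c * (c + 1))) * z\<^sup>2 + (- (m * (m + 1)) + s * (s + 1) + c * (c + 1)) * z - s * (s + 1)"
        using T[OF zb(2,3)] unfolding ind by (simp add: algebra_simps)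
      note R = this
      have O: "z\<^sup>2 * y'' - 2 * s * z * y' + (z\<^sup>2 * T z + s * (s + 1)) * y = 0"
        using ode[OF z] unfolding ind s2 y_def y'_def y''_def by simp
      have "0 = (z - 1)\<^sup>2 * (z\<^sup>2 * y'' - 2 * s * z * y' + (z\<^sup>2 * T z + s * (s + 1)) * y)" unfolding O by simp
      also have "\<dots> = (z\<^sup>2 * y'' - 2 * s * z * y' + s * (s + 1) * y) * (z - 1)\<^sup>2 + (z\<^sup>2 * (z - 1)\<^sup>2 * T z) * y"
        by (simp add: algebra_simps)
      also have "\<dots> = z * (z * (z - 1)\<^sup>2 * y'' - 2 * s * (z - 1)\<^sup>2 * y'
         + (s * (s + 1) * (z - 2) - c * (c + 1) * z - m * (m + 1) + s * (s + 1) + c * (c + 1)) * y)"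
        unfolding R by (simp add: algebra_simps power2_eq_square)
      finally have "z * (z * (z - 1)\<^sup>2 * y'' - 2 * s * (z - 1)\<^sup>2 * y'
         + (s * (s + 1) * (z - 2) - c * (c + 1) * z - m * (m + 1) + s * (s + 1) + c * (c + 1)) * y) = 0" by simp
      then have main: "z * (z - 1)\<^sup>2 * y'' - 2 * s * (z - 1)\<^sup>2 * y'
         + (s * (s + 1) * (z - 2) - c * (c + 1) * z - m * (m + 1) + s * (s + 1) + c * (c + 1)) * y = 0"
        using zb(2) by simp
      define A where "A = y'' - 2 * m / t * y' + (m\<^sup>2 - m) / t\<^sup>2 * y"
      define B where "B = y' - m / t * y"
      have A: "t\<^sup>2 * A = t\<^sup>2 * y'' - 2 * m * t * y' + (m\<^sup>2 - m) * y"
        unfolding A_def using t(1) by (simp add: field_simps power2_eq_square)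
      have B: "t\<^sup>2 * B = t\<^sup>2 * y' - m * t * y"
        unfolding B_def using t(1) by (simp add: field_simps power2_eq_square)
      have "t\<^sup>2 * (z * (z - 1) * A - ((2 * s + 2 * m) * z - 2 * s) * B + p * q * y)
        = z * (z - 1) * (t\<^sup>2 * A) - ((2 * s + 2 * m) * z - 2 * s) * (t\<^sup>2 * B) + t\<^sup>2 * (p * q * y)"
        by (simp add: algebra_simps)
      also have "\<dots> = (z - 1) * (z * (z - 1)\<^sup>2 * y'' - 2 * s * (z - 1)\<^sup>2 * y'
         + (s * (s + 1) * (z - 2) - c * (c + 1) * z - m * (m + 1) + s * (s + 1) + c * (c + 1)) * y)"
        unfolding A B unfolding p_def q_def t_def by (simp add: algebra_simps power2_eq_square)
      finally have "z * (z - 1) * A - ((2 * s + 2 * m) * z - 2 * s) * B + p * q * y = 0"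
        using main t(1) by simp
      then have fin: "e z * (z * (z - 1) * A - ((2 * s + 2 * m) * z - 2 * s) * B + p * q * y) = 0" by simp
      have XX: "deriv (deriv X) z = e z * A" "deriv X z = e z * B" "X z = e z * y"
        using derX'[OF zb(1)] derX[OF zb(1)]
        by (simp_all add: X''_def X'_def X_def A_def B_def y_def y'_def y''_def t_def)
      show ?thesis using fin unfolding XX s2 by (simp add: algebra_simps)
    qed
  qed
  then show ?thesis by (simp add: p_def q_def s_def m_def c_def add_divide_distrib diff_divide_distrib)
qed

text \<open>The parameters are (\<beta>1 + \<beta>2 - \<beta>3) / 2 and (\<beta>1 + \<beta>2 +
  \<beta>3) / 2 + 1, and one of them is a natural number at most \<open>\<beta>1\<close>. The
  ordering of the orders makes the second too large, so the first is the required N.\<close>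

theorem three_conical_parity:
  fixes \<beta>1 \<beta>2 \<beta>3 :: nat
  assumes h: "liouville (UNIV - {0, 1}) h"
    and l0: "((\<lambda>z. norm z powr \<beta>1 * Re (h z)) \<longlongrightarrow> c0) (at 0)" "c0 > 0"
    and l1: "((\<lambda>z. norm z powr \<beta>2 * Re (h (z + 1))) \<longlongrightarrow> c1) (at 0)" "c1 > 0"
    and l2: "((\<lambda>z. norm z powr \<beta>3 * Re (h (1 / z) * z * cnj z)) \<longlongrightarrow> c2) (at 0)" "c2 > 0"
    and le: "\<beta>1 \<le> \<beta>2" "\<beta>2 \<le> \<beta>3" "\<beta>1 > 0"
  shows "\<exists>N. \<beta>1 + \<beta>2 = \<beta>3 + 2 * N"
proof -
  let ?B = "ball (0::complex) 1 - {0}"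
  have oB: "open ?B" by (intro open_Diff) auto
  have sub0: "liouville ?B h"
  proof -
    have 1: "(\<lambda>z. z) holomorphic_on ?B" "(\<lambda>z. z) ` ?B \<subseteq> UNIV - {0, 1}" "(\<lambda>z. 1) holomorphic_on ?B"
      "((\<lambda>z. 1::complex) z)\<^sup>2 * deriv (\<lambda>z. z) z = 1" for z by auto
    show ?thesis using liouville_pullback(1)[OF h oB 1] by simp
  qed
  have p1: "liouville ?B (\<lambda>z. h (z + 1))" "\<And>z. z \<in> ?B \<Longrightarrow> potential (\<lambda>z. h (z + 1)) z = potential h (z + 1)"
  proof -
    have d: "deriv (\<lambda>z. z + 1) z = 1" for z :: complex
      by (rule DERIV_imp_deriv) (auto intro!: derivative_eq_intros)
    have 1: "(\<lambda>z. z + 1) holomorphic_on ?B" "(\<lambda>z. z + 1) ` ?B \<subseteq> UNIV - {0, 1}" "(\<lambda>z. 1) holomorphic_on ?B"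
      "((\<lambda>z. 1::complex) z)\<^sup>2 * deriv (\<lambda>z. z + 1) z = 1" for z
      using d by (auto intro!: holomorphic_intros simp: add_eq_0_iff2)
    show "liouville ?B (\<lambda>z. h (z + 1))" "\<And>z. z \<in> ?B \<Longrightarrow> potential (\<lambda>z. h (z + 1)) z = potential h (z + 1)"
      using liouville_pullback[OF h oB 1] by simp_all
  qed
  let ?k = "\<lambda>z. h (1 / z) * z * cnj z"
  have p2: "liouville ?B ?k" "\<And>z. z \<in> ?B \<Longrightarrow> potential ?k z = potential h (1 / z) / z ^ 4"
  proof -
    have d: "deriv (\<lambda>z. 1 / z) z = - 1 / z\<^sup>2" if "z \<noteq> 0" for z :: complex
      by (rule DERIV_imp_deriv) (use that in \<open>auto intro!: derivative_eq_intros simp: power2_eq_square\<close>)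
    \<comment> \<open>The inversion has derivative - 1 / z^2, and \<open>\<i> * z\<close> is a
      square root of its reciprocal; the modulus \<open>z * cnj z\<close> does not see the factor
      \<open>\<i>\<close>.\<close>
    have 1: "(\<lambda>z. 1 / z) holomorphic_on ?B" "(\<lambda>z. 1 / z) ` ?B \<subseteq> UNIV - {0, 1}" "(\<lambda>z. \<i> * z) holomorphic_on ?B"
      by (auto intro!: holomorphic_intros)
    have 2: "((\<lambda>z. \<i> * z) z)\<^sup>2 * deriv (\<lambda>z. 1 / z) z = 1" if "z \<in> ?B" for z
      using that d[of z] by (simp add: power_mult_distrib)
    have d1: "deriv (\<lambda>z. \<i> * z) = (\<lambda>z. \<i>)"
      by (rule ext, rule DERIV_imp_deriv) (auto intro!: derivative_eq_intros)
    show "liouville ?B ?k" "\<And>z. z \<in> ?B \<Longrightarrow> potential ?k z = potential h (1 / z) / z ^ 4"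
      using liouville_pullback[OF h oB 1 2] unfolding d1 by (simp_all add: power_mult_distrib mult_ac)
  qed
  have evB: "\<forall>\<^sub>F z in at 0. z \<in> ?B" by (intro eventually_at_in_open) auto
  have t0: "((\<lambda>z. z\<^sup>2 * potential h z) \<longlongrightarrow> indicial \<beta>1) (at 0)"
    by (rule conical_potential_limit[OF sub0 _ l0]) simp
  have t1: "((\<lambda>z. z\<^sup>2 * potential h (z + 1)) \<longlongrightarrow> indicial \<beta>2) (at 0)"
    by (rule Lim_transform_eventually[OF conical_potential_limit[OF p1(1) _ l1]])
       (use evB p1(2) in \<open>auto elim!: eventually_mono\<close>)
  have t2: "((\<lambda>z. z\<^sup>2 * (potential h (1 / z) / z ^ 4)) \<longlongrightarrow> indicial \<beta>3) (at 0)"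
    by (rule Lim_transform_eventually[OF conical_potential_limit[OF p2(1) _ l2]])
       (use evB p2(2) in \<open>auto elim!: eventually_mono\<close>)
  note T = three_double_poles[OF potential_holomorphic[OF h] t0 t1 t2]
  obtain Y r where Y: "0 < r" "r \<le> 1" "Y holomorphic_on ball 0 r" "Y 0 \<noteq> 0"
    and ode: "\<forall>z\<in>ball 0 r - {0}. z\<^sup>2 * deriv (deriv Y) z - of_real \<beta>1 * z * deriv Y z
       + (z\<^sup>2 * potential h z + of_real (\<beta>1 / 2 * (\<beta>1 / 2 + 1))) * Y z = 0"
    using conical_frobenius[OF sub0 _ l0] by auto
  have "\<exists>k\<le>\<beta>1. of_nat k = (of_nat \<beta>1 + of_nat \<beta>2 - of_nat \<beta>3) / (2::complex)
      \<or> of_nat k = (of_nat \<beta>1 + of_nat \<beta>2 + of_nat \<beta>3) / (2::complex) + 1"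
    by (rule frobenius_to_hypergeometric[OF Y(3,1,2,4) _ T]) (use ode in \<open>auto simp: indicial_def\<close>)
  then obtain k where k: "k \<le> \<beta>1" "of_nat k = (of_nat \<beta>1 + of_nat \<beta>2 - of_nat \<beta>3) / (2::complex)
      \<or> of_nat k = (of_nat \<beta>1 + of_nat \<beta>2 + of_nat \<beta>3) / (2::complex) + 1" by blast
  from k(2) show ?thesis
  proof
    assume "of_nat k = (of_nat \<beta>1 + of_nat \<beta>2 - of_nat \<beta>3) / (2::complex)"
    then have "of_nat k * 2 = of_nat \<beta>1 + of_nat \<beta>2 - (of_nat \<beta>3 :: complex)" by simp
    then have "complex_of_nat (\<beta>3 + 2 * k) = of_nat (\<beta>1 + \<beta>2)" by (simp add: algebra_simps)
    then have "\<beta>3 + 2 * k = \<beta>1 + \<beta>2" by (simp only: of_nat_eq_iff)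
    then show ?thesis by (intro exI[of _ k]) simp
  next
    assume "of_nat k = (of_nat \<beta>1 + of_nat \<beta>2 + of_nat \<beta>3) / (2::complex) + 1"
    then have "complex_of_nat (2 * k) = of_nat (\<beta>1 + \<beta>2 + \<beta>3 + 2)" by (simp add: field_simps)
    then have "2 * k = \<beta>1 + \<beta>2 + \<beta>3 + 2" by (simp only: of_nat_eq_iff)
    then show ?thesis using k(1) le by simp
  qed
qed

section \<open>Polynomial solutions of the hypergeometric equation\<close>

text \<open>For \<open>l = m n\<close> with \<open>m + n = b1 + b2 + 1\<close> this is the hypergeometric operator with exponents
  \<open>0, b1 + 1\<close> at 0, \<open>0, b2 + 1\<close> at 1 and \<open>- m, - n\<close> at infinity, so solutions can have degree \<open>m\<close> or \<open>n\<close>.\<close>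

definition jacobi_op :: "nat \<Rightarrow> nat \<Rightarrow> complex \<Rightarrow> complex poly \<Rightarrow> complex poly" where
  "jacobi_op b1 b2 l X = [:0, -1, 1:] * pderiv (pderiv X) - [:- of_nat b1, of_nat b1 + of_nat b2:] * pderiv X + smult l X"

text \<open>The condition on \<open>m + n\<close> is what lets the quadratic in \<open>k\<close>
  factor, so that \<open>m\<close> and \<open>n\<close> become the possible degrees.\<close>

lemma coeff_jacobi_op:
  assumes "m + n = b1 + b2 + 1"
  shows "coeff (jacobi_op b1 b2 (of_nat m * of_nat n) X) k =
    (of_nat k - of_nat m) * (of_nat k - of_nat n) * coeff X k
      - of_nat (Suc k) * (of_nat k - of_nat b1) * coeff X (Suc k)"
proof -
  have "coeff (jacobi_op b1 b2 (of_nat m * of_nat n) X) k =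
    of_nat k * (of_nat k - 1) * coeff X k - of_nat (Suc k) * of_nat k * coeff X (Suc k)
      + of_nat b1 * of_nat (Suc k) * coeff X (Suc k) - (of_nat b1 + of_nat b2) * of_nat k * coeff X k
      + of_nat m * of_nat n * coeff X k"
    unfolding jacobi_op_def
    by (cases k; cases "k - 1") (simp_all add: mult_pCons_left coeff_pderiv coeff_pCons algebra_simps)
  moreover have "of_nat m + of_nat n = of_nat b1 + of_nat b2 + (1::complex)"
    using arg_cong[OF assms, of "of_nat :: nat \<Rightarrow> complex"] by simp
  then have "of_nat b1 + of_nat b2 = of_nat m + of_nat n - (1::complex)" by simp
  ultimately show ?thesis by (simp only:) (simp add: algebra_simps)
qed

text \<open>A two-term recurrence started at an exponent \<open>s\<close> of the singular point 0
  and stopped at an exponent \<open>e\<close> of infinity. Between them \<open>j \<noteq> b1\<close>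
  keeps the denominators nonzero, and \<open>j \<noteq> m\<close>, \<open>j \<noteq> n\<close>
  prevent the coefficients from dying before the degree \<open>e\<close> is reached.\<close>

lemma jacobi_solution:
  assumes mn: "m + n = b1 + b2 + 1" and s: "s = 0 \<or> s = Suc b1" "s \<le> e" and e: "e = m \<or> e = n"
    and nb: "\<And>j. s \<le> j \<Longrightarrow> j < e \<Longrightarrow> j \<noteq> b1 \<and> j \<noteq> m \<and> j \<noteq> n"
  shows "\<exists>X. jacobi_op b1 b2 (of_nat m * of_nat n) X = 0 \<and> degree X = e \<and> coeff X s = 1 \<and> (\<forall>k<s. coeff X k = 0)"
proof -
  define r :: "nat \<Rightarrow> complex" where "r j = (of_nat j - of_nat m) * (of_nat j - of_nat n) / (of_nat (Suc j) * (of_nat j - of_nat b1))" for j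
  define x where "x k = (if s \<le> k \<and> k \<le> e then \<Prod>j=s..<k. r j else 0)" for k
  define X where "X = (\<Sum>k\<le>e. monom (x k) k)"
  have cX: "coeff X k = x k" for k
  proof -
    have "coeff X k = (\<Sum>j\<le>e. if j = k then x j else 0)" by (simp add: X_def coeff_sum coeff_monom)
    also have "\<dots> = (if k \<le> e then x k else 0)" by (simp add: sum.delta)
    finally show ?thesis by (simp add: x_def)
  qed
  have rnz: "r j \<noteq> 0" if "s \<le> j" "j < e" for j
    using nb[OF that] by (simp add: r_def del: of_nat_Suc)
  have rec: "of_nat (Suc k) * (of_nat k - of_nat b1) * x (Suc k) = (of_nat k - of_nat m) * (of_nat k - of_nat n) * x k" for k
  proof -
    \<comment> \<open>The truncation is harmless at both ends: if \<open>Suc k = s\<close> then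
      \<open>k = b1\<close> and the left factor is 0, and at \<open>k = e\<close> the right factor
      is 0.\<close>
    consider "Suc k < s" | "Suc k = s" | "s \<le> k" "k < e" | "k = e" "s \<le> k" | "k > e" using s(2) by linarith
    then show ?thesis
    proof cases
      case 1 then show ?thesis by (simp add: x_def)
    next
      case 2 then show ?thesis using s by (auto simp: x_def)
    next
      case 3
      then have "x (Suc k) = x k * r k" by (simp add: x_def prod.atLeastLessThan_Suc)
      then show ?thesis using nb[OF 3] by (simp add: r_def del: of_nat_Suc)
    next
      case 4 then show ?thesis using e by (auto simp: x_def)
    next
      case 5 then show ?thesis by (simp add: x_def)
    qed
  qed
  have "jacobi_op b1 b2 (of_nat m * of_nat n) X = 0"
    by (rule poly_eqI) (simp add: coeff_jacobi_op[OF mn] cX rec del: of_nat_Suc)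
  moreover have "degree X = e"
  proof (rule antisym)
    show "degree X \<le> e" by (rule degree_le) (simp add: cX x_def)
    show "e \<le> degree X" by (rule le_degree) (use s(2) rnz in \<open>simp add: cX x_def\<close>)
  qed
  moreover have "coeff X s = 1" "\<forall>k<s. coeff X k = 0" using s(2) by (simp_all add: cX x_def)
  ultimately show ?thesis by blast
qed

text \<open>Abel's identity: the zero-order terms cancel, which leaves a first-order equation for
  the Wronskian.\<close>

lemma jacobi_wronskian:
  assumes "jacobi_op b1 b2 l X = 0" "jacobi_op b1 b2 l Y = 0"
  defines "W \<equiv> pderiv X * Y - X * pderiv Y"
  shows "[:0, -1, 1:] * pderiv W = [:- of_nat b1, of_nat b1 + of_nat b2:] * W"
proof -
  define t :: "complex poly" where "t = [:0, -1, 1:]"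
  define u :: "complex poly" where "u = [:- of_nat b1, of_nat b1 + of_nat b2:]"
  have "t * pderiv W - u * W = jacobi_op b1 b2 l X * Y - X * jacobi_op b1 b2 l Y"
    unfolding W_def jacobi_op_def t_def[symmetric] u_def[symmetric]
    by (simp add: pderiv_diff pderiv_mult algebra_simps)
  then show ?thesis using assms by (simp add: t_def u_def)
qed

text \<open>The coefficients satisfy \<open>(k - b1) W_k = (k - 1 - b1 - b2) W_(k-1)\<close>.
  Starting from zero, the only index at which this leaves a coefficient free is
  \<open>b1\<close>.\<close>

lemma first_order_unique:
  assumes "[:0, -1, 1:] * pderiv W = [:- of_nat b1, of_nat b1 + of_nat b2:] * W" "coeff W b1 = 0"
  shows "W = (0 :: complex poly)"
proof -
  have rec: "(of_nat k - of_nat b1) * coeff W k = (of_nat k - 1 - of_nat b1 - of_nat b2) * (if k = 0 then 0 else coeff W (k - 1))" for k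
    using arg_cong[OF assms(1), of "\<lambda>p. coeff p k"]
    by (cases k; cases "k - 1") (auto simp: mult_pCons_left coeff_pderiv coeff_pCons algebra_simps)
  have "coeff W k = 0" for k
  proof (induction k)
    case 0 then show ?case using rec[of 0] assms(2) by (cases "b1 = 0") auto
  next
    case (Suc k)
    show ?case
    proof (cases "Suc k = b1")
      case True then show ?thesis using assms(2) by simp
    next
      case False
      then have "(of_nat (Suc k) - of_nat b1 :: complex) \<noteq> 0" by (metis eq_iff_diff_eq_0 of_nat_eq_iff)
      then show ?thesis using rec[of "Suc k"] Suc by auto
    qed
  qed
  then show ?thesis by (simp add: poly_eq_iff)
qed

lemma pderiv_linear_power:
  assumes "pderiv L = 1" shows "L * pderiv (L ^ n) = smult (of_nat n) (L ^ n)"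
proof (cases n)
  case (Suc k)
  show ?thesis unfolding Suc pderiv_power_Suc assms by simp
qed (simp add: pderiv_1)

lemma first_order_solution:
  assumes W: "[:0, -1, 1:] * pderiv W = [:- of_nat b1, of_nat b1 + of_nat b2:] * (W :: complex poly)"
  shows "\<exists>C. W = smult C ([:0, 1:] ^ b1 * [:-1, 1:] ^ b2) \<and> coeff W b1 = C * (- 1) ^ b2"
proof -
  define V :: "complex poly" where "V = [:0, 1:] ^ b1 * [:-1, 1:] ^ b2"
  have p1: "[:0, 1:] * pderiv ([:0, 1:] ^ b1) = [:of_nat b1:] * ([:0, 1:] ^ b1 :: complex poly)"
    using pderiv_linear_power[of "[:0, 1 :: complex:]" b1] by (simp add: pderiv_pCons)
  have p2: "[:-1, 1:] * pderiv ([:-1, 1:] ^ b2) = [:of_nat b2:] * ([:-1, 1:] ^ b2 :: complex poly)"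
    using pderiv_linear_power[of "[:-1, 1 :: complex:]" b2] by (simp add: pderiv_pCons)
  have "[:0, -1, 1:] * pderiv V = [:0, 1:] * [:-1, 1:] * pderiv V" by simp
  also have "\<dots> = [:-1, 1:] * [:-1, 1:] ^ b2 * ([:0, 1:] * pderiv ([:0, 1:] ^ b1))
     + [:0, 1:] * [:0, 1:] ^ b1 * ([:-1, 1:] * pderiv ([:-1, 1:] ^ b2))"
    unfolding V_def pderiv_mult by (simp only: algebra_simps)
  also have "\<dots> = ([:-1, 1:] * [:of_nat b1:] + [:0, 1:] * [:of_nat b2:]) * V"
    unfolding p1 p2 V_def by (simp only: algebra_simps)
  also have "[:-1, 1:] * [:of_nat b1:] + [:0, 1:] * [:of_nat b2:] = [:- of_nat b1, of_nat b1 + of_nat b2 :: complex:]"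
    by simp
  finally have V: "[:0, -1, 1:] * pderiv V = [:- of_nat b1, of_nat b1 + of_nat b2:] * V" .
  have cV: "coeff V b1 = (- 1) ^ b2"
  proof -
    have "V = monom 1 b1 * [:-1, 1:] ^ b2" by (simp add: V_def monom_altdef)
    then have "coeff V b1 = coeff ([:-1, 1:] ^ b2) 0" by (simp add: coeff_monom_mult)
    also have "\<dots> = (- 1) ^ b2" by (simp add: coeff_0_power)
    finally show ?thesis .
  qed
  \<comment> \<open>The normalised solution \<open>V\<close> has coefficient
    \<open>(- 1) ^ b2\<close> at \<open>b1\<close>, which is its own inverse.\<close>
  define C where "C = coeff W b1 * (- 1) ^ b2"
  have sq: "(- 1) ^ b2 * (- 1) ^ b2 = (1 :: complex)" by (simp flip: power_mult_distrib)
  have "W - smult C V = 0"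
  proof (rule first_order_unique)
    show "[:0, -1, 1:] * pderiv (W - smult C V) = [:- of_nat b1, of_nat b1 + of_nat b2:] * (W - smult C V)"
      using W V by (simp only: pderiv_diff pderiv_smult right_diff_distrib mult_smult_right)
    show "coeff (W - smult C V) b1 = 0" using sq by (simp add: cV C_def mult.assoc)
  qed
  moreover have "coeff W b1 = C * (- 1) ^ b2" using sq by (simp add: C_def mult.assoc)
  ultimately show ?thesis by (auto simp: V_def)
qed

text \<open>The reflection x to 1 - x exchanges the two finite singular points; through it the value
  of a solution at 1 becomes a constant coefficient.\<close>

lemma jacobi_op_reflect:
  "jacobi_op b2 b1 l (X \<circ>\<^sub>p [:1, -1:]) = (jacobi_op b1 b2 l X) \<circ>\<^sub>p [:1, -1:]"
proof -
  have d: "pderiv (Z \<circ>\<^sub>p [:1, -1:]) = - (pderiv Z \<circ>\<^sub>p [:1, -1:])" for Z :: "complex poly"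
    by (simp add: pderiv_pcompose pderiv_pCons)
  have 1: "[:0, -1, 1:] \<circ>\<^sub>p [:1, -1:] = [:0, -1, 1 :: complex:]" by (simp add: pcompose_pCons)
  have 2: "[:- of_nat b1, of_nat b1 + of_nat b2:] \<circ>\<^sub>p [:1, -1:] = - [:- of_nat b2, of_nat b2 + of_nat b1 :: complex:]"
    by (simp add: pcompose_pCons)
  show ?thesis unfolding jacobi_op_def
    by (simp only: pcompose_add pcompose_diff pcompose_mult pcompose_smult d pderiv_minus 1 2)
       (simp only: minus_minus mult_minus_left mult_minus_right)
qed

text \<open>\<open>N\<close> and \<open>b1 + b2 + 1 - N\<close> are the two exponents at infinity,
  one for each solution. \<open>Q\<close> starts at exponent 0 and ends before the resonance at
  \<open>b1\<close>; \<open>P\<close> starts after it, at \<open>b1 + 1\<close>. This is possible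
  because \<open>2 * N = b1 - (b3 - b2)\<close> is at most \<open>b1\<close>.\<close>

lemma jacobi_pair:
  assumes N: "b1 + b2 = b3 + 2 * N" and le: "b1 \<le> b2" "b2 \<le> b3" "0 < b1"
  shows "\<exists>P Q C. degree P = b1 + b2 + 1 - N \<and> degree Q = N \<and> C \<noteq> 0 \<and>
    pderiv P * Q - P * pderiv Q = smult C ([:0, 1:] ^ b1 * [:-1, 1:] ^ b2) \<and>
    poly Q 0 \<noteq> 0 \<and> poly Q 1 \<noteq> 0 \<and>
    jacobi_op b1 b2 (of_nat N * of_nat (b1 + b2 + 1 - N)) Q = 0"
proof -
  define D where "D = b1 + b2 + 1 - N"
  have ND: "N + D = b1 + b2 + 1" and Nb: "2 * N \<le> b1" "N < b1" "N < b2" "b1 < D" "N < D" using N le by (auto simp: D_def)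
  obtain Q where Q: "jacobi_op b1 b2 (of_nat N * of_nat D) Q = 0" "degree Q = N" "coeff Q 0 = 1"
    using jacobi_solution[OF ND, of 0 N] Nb by auto
  obtain P where P: "jacobi_op b1 b2 (of_nat N * of_nat D) P = 0" "degree P = D" "coeff P (Suc b1) = 1" "\<forall>k<Suc b1. coeff P k = 0"
    using jacobi_solution[OF ND, of "Suc b1" D] Nb by auto
  obtain C where C: "pderiv P * Q - P * pderiv Q = smult C ([:0, 1:] ^ b1 * [:-1, 1:] ^ b2)"
    "coeff (pderiv P * Q - P * pderiv Q) b1 = C * (- 1) ^ b2"
    using first_order_solution[OF jacobi_wronskian[OF P(1) Q(1)]] by blast
  \<comment> \<open>\<open>P\<close> begins with x^(b1 + 1) and \<open>Q\<close> with 1, so the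
    lowest coefficient of the Wronskian is \<open>b1 + 1\<close>; this shows that \<open>C\<close>
    is nonzero.\<close>
  have "coeff (pderiv P * Q) b1 = (\<Sum>i\<le>b1. coeff (pderiv P) i * coeff Q (b1 - i))" by (rule coeff_mult)
  also have "\<dots> = (\<Sum>i\<in>{b1}. coeff (pderiv P) i * coeff Q (b1 - i))"
    by (rule sum.mono_neutral_right) (use P(4) in \<open>auto simp: coeff_pderiv\<close>)
  also have "\<dots> = of_nat (Suc b1)" using P(3) Q(3) by (simp add: coeff_pderiv)
  finally have 1: "coeff (pderiv P * Q) b1 = of_nat (Suc b1)" .
  have 2: "coeff (P * pderiv Q) b1 = 0" unfolding coeff_mult using P(4) by simp
  have "of_nat (Suc b1) = C * (- 1) ^ b2" using C(2) 1 2 by (simp del: of_nat_Suc)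
  then have C0: "C \<noteq> 0" by (metis mult_zero_left of_nat_eq_0_iff nat.distinct(1))
  have Q0: "poly Q 0 \<noteq> 0" using Q(3) by (simp add: poly_0_coeff_0)
  \<comment> \<open>If \<open>Q\<close> vanished at 1, its reflection would have constant
    coefficient 0, and as \<open>N < b2\<close> the recurrence would propagate this zero through all
    coefficients up to the degree.\<close>
  have Q1: "poly Q 1 \<noteq> 0"
  proof
    assume z: "poly Q 1 = 0"
    define R where "R = Q \<circ>\<^sub>p [:1, -1:]"
    have R: "jacobi_op b2 b1 (of_nat N * of_nat D) R = 0" unfolding R_def jacobi_op_reflect Q(1) by simp
    have ND': "N + D = b2 + b1 + 1" using ND by simp
    have rec: "(of_nat k - of_nat N) * (of_nat k - of_nat D) * coeff R k = of_nat (Suc k) * (of_nat k - of_nat b2) * coeff R (Suc k)" for k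
      using coeff_jacobi_op[OF ND', of R k] unfolding R by simp
    have R0: "coeff R 0 = 0" using z by (simp add: R_def poly_pcompose flip: poly_0_coeff_0)
    have "coeff R k = 0" if "k \<le> N" for k using that
    proof (induction k)
      case 0 show ?case by (rule R0)
    next
      case (Suc k)
      then have "of_nat (Suc k) * (of_nat k - of_nat b2) * coeff R (Suc k) = 0" using rec[of k] by simp
      moreover have "(of_nat (Suc k) :: complex) \<noteq> 0" "of_nat k - of_nat b2 \<noteq> (0 :: complex)"
        using Suc.prems Nb by (auto simp del: of_nat_Suc)
      ultimately show ?case by simp
    qed
    moreover have "degree R = N" by (simp add: R_def degree_pcompose Q(2))
    ultimately have "R = 0" by (metis leading_coeff_0_iff order_refl)
    then have "poly R 1 = 0" by simp
    then show False using Q0 by (simp add: R_def poly_pcompose)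
  qed
  show ?thesis using P(2) Q(1,2) C(1) C0 Q0 Q1 unfolding D_def by blast
qed

text \<open>Stieltjes' computation: for Q = c (x - a) R one has Q'(a) = c R(a) and Q''(a) = 2 c
  R'(a), so Q''(a) / Q'(a) is twice the logarithmic derivative of R at a.\<close>

lemma squarefree_logderiv:
  fixes Q :: "complex poly"
  assumes A: "finite A" "a \<in> A" and Q: "Q = smult c (\<Prod>z\<in>A. [:-z, 1:])"
  shows "poly (pderiv (pderiv Q)) a = poly (pderiv Q) a * (\<Sum>z\<in>A - {a}. 2 / (a - z))"
proof -
  define R where "R = (\<Prod>z\<in>A - {a}. [:-z, 1:])"
  define L where "L = [:-a, 1:]"
  have L: "pderiv L = 1" "poly L a = 0" by (simp_all add: L_def pderiv_pCons)
  have "Q = smult c (L * R)" unfolding Q R_def L_def using A by (simp only: prod.remove)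
  then have d1: "pderiv Q = smult c (L * pderiv R + R)"
    by (simp add: pderiv_smult pderiv_mult L)
  then have d2: "pderiv (pderiv Q) = smult c (L * pderiv (pderiv R) + 2 * pderiv R)"
    by (simp add: pderiv_smult pderiv_mult pderiv_add L add.commute)
  have "poly (pderiv R) a = (\<Sum>z\<in>A - {a}. \<Prod>w\<in>A - {a} - {z}. a - w)"
    unfolding R_def by (simp add: pderiv_prod pderiv_pCons poly_sum poly_prod)
  also have "\<dots> = (\<Sum>z\<in>A - {a}. poly R a / (a - z))"
  proof (rule sum.cong)
    fix z assume z: "z \<in> A - {a}"
    have "poly R a = (a - z) * (\<Prod>w\<in>A - {a} - {z}. a - w)"
      unfolding R_def poly_prod using prod.remove[of "A - {a}" z "\<lambda>w. poly [:- w, 1:] a"] A z by simp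
    then show "(\<Prod>w\<in>A - {a} - {z}. a - w) = poly R a / (a - z)" using z by auto
  qed simp
  finally have "2 * poly (pderiv R) a = poly R a * (\<Sum>z\<in>A - {a}. 2 / (a - z))"
    by (simp add: sum_distrib_left mult.commute)
  then show ?thesis unfolding d2 unfolding d1 by (simp add: L)
qed

text \<open>At a root of \<open>Q\<close> the zero-order term of the hypergeometric equation drops
  out and Q'' / Q' is a rational function of the root with simple poles at 0 and 1. Its partial
  fractions are the two outer terms of the system, and Stieltjes' identity supplies the sum.\<close>

theorem jacobi_roots_system:
  fixes b1 b2 b3 N :: nat
  assumes N: "b1 + b2 = b3 + 2 * N" and le: "b1 \<le> b2" "b2 \<le> b3" "0 < b1"
  shows "\<exists>a :: nat \<Rightarrow> complex. inj_on a {1..N} \<and> (\<forall>j\<in>{1..N}. a j \<noteq> 0 \<and> a j \<noteq> 1) \<and>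
    (\<forall>j\<in>{1..N}. of_nat b1 / a j + of_nat b2 / (a j - 1) - (\<Sum>k\<in>{1..N} - {j}. 2 / (a j - a k)) = 0)"
proof -
  obtain P Q C where PQ: "degree Q = N" "C \<noteq> 0"
    "pderiv P * Q - P * pderiv Q = smult C ([:0, 1:] ^ b1 * [:-1, 1:] ^ b2)"
    "poly Q 0 \<noteq> 0" "poly Q 1 \<noteq> 0"
    "jacobi_op b1 b2 (of_nat N * of_nat (b1 + b2 + 1 - N)) Q = 0"
    using jacobi_pair[OF assms] by blast
  \<comment> \<open>A multiple root would be a zero of the Wronskian with \<open>P\<close>, hence 0
    or 1, where \<open>Q\<close> does not vanish.\<close>
  have simple: "poly (pderiv Q) z \<noteq> 0" if z: "poly Q z = 0" for z
  proof
    assume "poly (pderiv Q) z = 0"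
    then have "poly (smult C ([:0, 1:] ^ b1 * [:-1, 1:] ^ b2)) z = 0" using z unfolding PQ(3)[symmetric] by simp
    then have "z = 0 \<or> z = 1" using PQ(2) by (auto simp: poly_power)
    then show False using z PQ(4,5) by auto
  qed
  have "rsquarefree Q" unfolding rsquarefree_roots using simple by blast
  from complex_poly_decompose_rsquarefree[OF this]
  have Qd: "Q = smult (lead_coeff Q) (\<Prod>z\<in>{z. poly Q z = 0}. [:-z, 1:])" by simp
  define A where "A = {z. poly Q z = 0}"
  have Q0: "Q \<noteq> 0" using PQ(4) by auto
  have fA: "finite A" unfolding A_def by (rule poly_roots_finite[OF Q0])
  have "N = degree (\<Prod>z\<in>A. [:-z, 1:])" using PQ(1) Qd Q0 unfolding A_def by (metis degree_smult_eq leading_coeff_0_iff)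
  also have "\<dots> = (\<Sum>z\<in>A. degree [:-z, 1:])" by (rule degree_prod_eq_sum_degree) auto
  finally have cA: "card A = N" by simp
  obtain a where a: "bij_betw a {1..N} A" using ex_bij_betw_nat_finite_1[OF fA] cA by blast
  have inj: "inj_on a {1..N}" and img: "a ` {1..N} = A" using a by (auto simp: bij_betw_def)
  have nz: "a j \<noteq> 0 \<and> a j \<noteq> 1" and root: "poly Q (a j) = 0" if "j \<in> {1..N}" for j
    using that img PQ(4,5) by (auto simp: A_def)
  moreover have "of_nat b1 / a j + of_nat b2 / (a j - 1) - (\<Sum>k\<in>{1..N} - {j}. 2 / (a j - a k)) = 0"
    if j: "j \<in> {1..N}" for j
  proof -
    have aj: "a j \<in> A" using img j by blast
    have im: "a ` ({1..N} - {j}) = A - {a j}"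
      using inj_on_image_set_diff[OF inj, of "{1..N}" "{j}"] img j by simp
    have "(\<Sum>z\<in>A - {a j}. 2 / (a j - z)) = (\<Sum>k\<in>{1..N} - {j}. 2 / (a j - a k))"
      unfolding im[symmetric] using inj_on_subset[OF inj, of "{1..N} - {j}"]
      by (subst sum.reindex) (auto simp: o_def)
    then have d2: "poly (pderiv (pderiv Q)) (a j) = poly (pderiv Q) (a j) * (\<Sum>k\<in>{1..N} - {j}. 2 / (a j - a k))"
      using squarefree_logderiv[OF fA aj Qd[folded A_def]] by simp
    have "poly (jacobi_op b1 b2 (of_nat N * of_nat (b1 + b2 + 1 - N)) Q) (a j) = 0" using PQ(6) by simp
    then have "a j * (a j - 1) * poly (pderiv (pderiv Q)) (a j) - ((of_nat b1 + of_nat b2) * a j - of_nat b1) * poly (pderiv Q) (a j) = 0"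
      using root[OF j] by (simp add: jacobi_op_def algebra_simps)
    then have "poly (pderiv Q) (a j) * (a j * (a j - 1) * (\<Sum>k\<in>{1..N} - {j}. 2 / (a j - a k)) - ((of_nat b1 + of_nat b2) * a j - of_nat b1)) = 0"
      unfolding d2 by (simp add: algebra_simps)
    then have "a j * (a j - 1) * (\<Sum>k\<in>{1..N} - {j}. 2 / (a j - a k)) = (of_nat b1 + of_nat b2) * a j - of_nat b1"
      using simple[OF root[OF j]] by simp
    then have "(\<Sum>k\<in>{1..N} - {j}. 2 / (a j - a k)) = ((of_nat b1 + of_nat b2) * a j - of_nat b1) / (a j * (a j - 1))"
      using nz[OF j] by (simp add: eq_divide_eq mult.commute)
    also have "\<dots> = of_nat b1 / a j + of_nat b2 / (a j - 1)"
      using nz[OF j] by (simp add: field_simps)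
    finally show ?thesis by simp
  qed
  ultimately show ?thesis using inj by blast
qed

section \<open>From conformal metrics to solutions of the Liouville equation\<close>

text \<open>The \<open>h\<close> of the Liouville equation. It depends on \<open>p\<close> only
  through the chart, so \<open>inv_sqrt_coeff g (Pt a)\<close> is one function for all
  \<open>a\<close>.\<close>

definition inv_sqrt_coeff :: "conformal_form \<Rightarrow> riemann_sphere \<Rightarrow> complex \<Rightarrow> complex" where
  "inv_sqrt_coeff g p z = of_real (coeff_at g p z powr (- 1 / 2))"

lemma liouville_local:
  assumes "open S" "\<And>x. x \<in> S \<Longrightarrow> \<exists>U. open U \<and> x \<in> U \<and> liouville U h"
  shows "liouville S h"
proof -
  have "wirt_smooth k S h" for k
  proof (rule wirt_smooth_UN)
    fix x assume "x \<in> S"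
    then obtain U where "open U" "x \<in> U" "liouville U h" using assms(2) by blast
    then show "\<exists>T. open T \<and> x \<in> T \<and> wirt_smooth k T h" by (auto simp: liouville_def wirt_smooth_inf_def)
  qed
  moreover have "h x \<in> \<real> \<and> Re (h x) > 0" "h x * dzb (dz h) x - dz h x * dzb h x = 1 / 4" if "x \<in> S" for x
    using assms(2)[OF that] by (auto simp: liouville_def)
  ultimately show ?thesis using assms(1) by (simp add: liouville_def wirt_smooth_inf_def)
qed

lemma liouville_subset:
  assumes "liouville S h" "T \<subseteq> S" "open T" shows "liouville T h"
  by (rule liouville_local[OF assms(3)]) (use assms in \<open>auto simp: liouville_def\<close>)

lemma liouville_cong:
  assumes h: "liouville S h" and eq: "\<And>x. x \<in> S \<Longrightarrow> h x = k x" shows "liouville S k"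
proof -
  have S: "open S" by (rule liouville_open[OF h])
  have d: "dz h x = dz k x" "dzb h x = dzb k x" if "x \<in> S" for x
    by (rule wirt_cong[OF S that]; erule eq)+
  have dd: "dzb (dz h) x = dzb (dz k) x" if "x \<in> S" for x by (rule wirt_cong(2)[OF S that d(1)])
  have "wirt_smooth n S k" for n by (rule wirt_smooth_cong[OF S eq]) (use h in \<open>auto simp: liouville_def wirt_smooth_inf_def\<close>)
  moreover have "k x \<in> \<real> \<and> Re (k x) > 0 \<and> k x * dzb (dz k) x - dz k x * dzb k x = 1 / 4" if "x \<in> S" for x
    using h that unfolding liouville_def eq[OF that, symmetric] d[OF that, symmetric] dd[OF that, symmetric] by blast
  ultimately show ?thesis using S by (simp add: liouville_def wirt_smooth_inf_def)
qed

lemma real_wirt_cnj: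
  assumes S: "open S" "z \<in> S" and Sm: "wirt_smooth_inf S h" and r: "\<And>x. x \<in> S \<Longrightarrow> h x \<in> \<real>"
  shows "cnj (dz h z) = dzb h z" "cnj (dzb (dz h) z) = dzb (dz h) z"
proof -
  have r': "h x = cnj (h x)" if "x \<in> S" for x using r[OF that] by (auto simp: Reals_cnj_iff)
  have d: "dzb h x = cnj (dz h x)" if "x \<in> S" for x
    using wirt_cong(2)[OF S(1) that r'] has_wirtD(2)[OF has_wirt_cnj[OF wirt_smooth_inf_wirt[OF Sm that]]] by simp
  show "cnj (dz h z) = dzb h z" using d[OF S(2)] by simp
  have "dz (dzb h) z = cnj (dzb (dz h) z)"
    using wirt_cong(1)[OF S d] has_wirtD(1)[OF has_wirt_cnj[OF wirt_smooth_inf_wirt[OF wirt_smooth_inf_dz[OF Sm] S(2)]]] by simp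
  then show "cnj (dzb (dz h) z) = dzb (dz h) z" using wirt_smooth_inf_commute[OF S(1) Sm S(2)] by simp
qed

text \<open>Since \<open>ln \<rho>\<close> is - 2 times \<open>ln h\<close>, its Laplacian is - 8
  times the mixed Wirtinger derivative of \<open>ln h\<close>, and dividing by
  \<open>\<rho> = h^(-2)\<close> clears the denominator. Curvature controls only the real part of
  the result, hence the separate claim that it is real.\<close>

lemma smooth_inv_sqrt_coeff:
  fixes \<rho> :: "complex \<Rightarrow> real"
  assumes U: "open U" and sm: "smooth_on U \<rho>" and posB: "\<forall>x\<in>U. \<rho> x > 0"
  defines "h \<equiv> \<lambda>x. complex_of_real (\<rho> x powr (- 1 / 2))"
  shows "wirt_smooth_inf U h" "\<And>x. x \<in> U \<Longrightarrow> h x \<in> \<real> \<and> Re (h x) > 0"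
    "\<And>x. x \<in> U \<Longrightarrow> laplacian (\<lambda>x. ln (\<rho> x)) x / \<rho> x = - 8 * Re (h x * dzb (dz h) x - dz h x * dzb h x)"
    "\<And>x. x \<in> U \<Longrightarrow> h x * dzb (dz h) x - dz h x * dzb h x \<in> \<real>"
proof -
  have pos: "\<rho> x > 0" if "x \<in> U" for x using posB that by blast
  have smr: "wirt_smooth k U (\<lambda>x. complex_of_real (\<rho> x))" for k
    using sm Ck_on_imp_wirt_smooth[OF U] by (auto simp: smooth_on_def)
  have img: "(\<lambda>x. complex_of_real (\<rho> x)) ` U \<subseteq> - \<real>\<^sub>\<le>\<^sub>0" using pos by (force simp: nonpos_Reals_def)
  have o: "open (- \<real>\<^sub>\<le>\<^sub>0 :: complex set)" by (simp add: open_Compl)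
  \<comment> \<open>The real power is extended holomorphically to the slit plane, so that smoothness
    follows from composition with a holomorphic map.\<close>
  have "(\<lambda>w. exp (- 1 / 2 * Ln w)) holomorphic_on - \<real>\<^sub>\<le>\<^sub>0" by (intro holomorphic_intros) auto
  from wirt_smooth_outer[OF U o this smr img]
  have 1: "wirt_smooth k U (\<lambda>x. exp (- 1 / 2 * Ln (complex_of_real (\<rho> x))))" for k .
  have 2: "exp (- 1 / 2 * Ln (complex_of_real (\<rho> x))) = h x" if "x \<in> U" for x
  proof -
    have "exp (- 1 / 2 * Ln (complex_of_real (\<rho> x))) = exp (complex_of_real (- 1 / 2 * ln (\<rho> x)))"
      using pos[OF that] by (simp add: Ln_of_real)
    then show ?thesis using pos[OF that] unfolding h_def powr_def by (simp only: exp_of_real) simp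
  qed
  show Sm: "wirt_smooth_inf U h" unfolding wirt_smooth_inf_def
  proof
    show "wirt_smooth k U h" for k by (rule wirt_smooth_cong[OF U 2 1])
  qed
  show re: "h x \<in> \<real> \<and> Re (h x) > 0" if "x \<in> U" for x using pos[OF that] by (simp add: h_def)
  have real: "h x \<in> \<real>" if "x \<in> U" for x using re that by blast
  have nz: "h x \<noteq> 0" if "x \<in> U" for x using re[OF that] by auto
  show "h x * dzb (dz h) x - dz h x * dzb h x \<in> \<real>" if "x \<in> U" for x
  proof -
    have c: "cnj (dz h x) = dzb h x" "cnj (dzb (dz h) x) = dzb (dz h) x" "cnj (h x) = h x"
      using real_wirt_cnj[OF U that Sm real] real[OF that] by (auto simp: Reals_cnj_iff)
    then have "cnj (dzb h x) = dz h x" by (metis complex_cnj_cnj)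
    then have "cnj (h x * dzb (dz h) x - dz h x * dzb h x) = h x * dzb (dz h) x - dz h x * dzb h x"
      using c by (simp add: mult.commute)
    then show ?thesis by (simp only: Reals_cnj_iff)
  qed
  show "laplacian (\<lambda>x. ln (\<rho> x)) x / \<rho> x = - 8 * Re (h x * dzb (dz h) x - dz h x * dzb h x)" if x: "x \<in> U" for x
  proof -
    have hr: "h y = of_real (Re (h y))" if "y \<in> U" for y using real[OF that] by simp
    have L: "complex_of_real (ln (\<rho> y)) = - 2 * Ln (h y)" if "y \<in> U" for y
    proof -
      have "ln (\<rho> y powr (- 1 / 2)) = - 1 / 2 * ln (\<rho> y)" using pos[OF that] by (simp add: ln_powr)
      moreover have "\<rho> y powr (- 1 / 2) > 0" using pos[OF that] by simp
      ultimately have "Ln (h y) = complex_of_real (- 1 / 2 * ln (\<rho> y))" unfolding h_def by (simp only: Ln_of_real)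
      then show ?thesis by simp
    qed
    have hp: "h y \<notin> \<real>\<^sub>\<le>\<^sub>0" if "y \<in> U" for y
      using re[OF that] by (auto simp: nonpos_Reals_def)
    have d1: "has_wirt (\<lambda>y. - 2 * Ln (h y)) y (- 2 * (dz h y / h y)) (- 2 * (dzb h y / h y))" if "y \<in> U" for y
    proof -
      have "((\<lambda>w. - 2 * Ln w) has_field_derivative (- 2 / h y)) (at (h y))"
        using hp[OF that] by (auto intro!: derivative_eq_intros simp: divide_inverse)
      from has_wirt_outer[OF wirt_smooth_inf_wirt[OF Sm that] this] show ?thesis by simp
    qed
    have dL: "dz (\<lambda>y. complex_of_real (ln (\<rho> y))) y = - 2 * (dz h y / h y)" if "y \<in> U" for y
      using wirt_cong(1)[OF U that L] has_wirtD(1)[OF d1[OF that]] by simp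
    have "has_wirt (\<lambda>y. - 2 * (dz h y / h y)) x
       (- 2 * ((dz (dz h) x * h x - dz h x * dz h x) / (h x)\<^sup>2) + 0 * (dz h x / h x))
       (- 2 * ((dzb (dz h) x * h x - dz h x * dzb h x) / (h x)\<^sup>2) + 0 * (dz h x / h x))"
      by (intro has_wirt_mult has_wirt_const has_wirt_divide wirt_smooth_inf_wirt[OF Sm x] wirt_smooth_inf_wirt[OF wirt_smooth_inf_dz[OF Sm] x] nz x)
    then have ddL: "dzb (dz (\<lambda>y. complex_of_real (ln (\<rho> y)))) x = - 2 * ((h x * dzb (dz h) x - dz h x * dzb h x) / (h x)\<^sup>2)"
      using wirt_cong(2)[OF U x dL] has_wirtD(2) by (simp add: mult.commute)
    have smL: "wirt_smooth k U (\<lambda>y. - 2 * Ln (h y))" for k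
    proof -
      have "(\<lambda>w. - 2 * Ln w) holomorphic_on - \<real>\<^sub>\<le>\<^sub>0" by (intro holomorphic_intros) auto
      from wirt_smooth_outer[OF U o this, of k h] show ?thesis using Sm hp by (auto simp: wirt_smooth_inf_def)
    qed
    have "Ck_on (Suc (Suc 0)) U (\<lambda>y. ln (\<rho> y))"
    proof (rule Ck_on_cong[OF U _ wirt_smooth_imp_Ck_on[OF U smL]])
      show "Re (- 2 * Ln (h y)) = ln (\<rho> y)" if "y \<in> U" for y using L[OF that] by (metis Re_complex_of_real)
    qed
    from laplacian_wirt[OF U x this] ddL
    have "laplacian (\<lambda>x. ln (\<rho> x)) x = 4 * Re (- 2 * ((h x * dzb (dz h) x - dz h x * dzb h x) / (h x)\<^sup>2))" by simp
    also have "(h x)\<^sup>2 = of_real (1 / \<rho> x)"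
    proof -
      have "(\<rho> x powr (- 1 / 2))\<^sup>2 = \<rho> x powr (- 1)"
        by (simp add: power2_eq_square flip: powr_add)
      also have "\<dots> = 1 / \<rho> x" using pos[OF x] by (simp add: powr_minus_divide)
      finally show ?thesis unfolding h_def by (metis of_real_power)
    qed
    finally have "laplacian (\<lambda>x. ln (\<rho> x)) x = - 8 * (\<rho> x * Re (h x * dzb (dz h) x - dz h x * dzb h x))"
      using pos[OF x] by (simp add: Re_divide_of_real algebra_simps)
    then show ?thesis using pos[OF x] by simp
  qed
qed

section \<open>Conical against regular points, and the Liouville equation in each chart\<close>

lemma conical_not_regular:
  assumes "conical_at g p \<beta>" "regular_at g p" shows "\<beta> = 0"
proof -
  define c where "c = coord p"
  obtain C where C: "C > 0" "coeff_at g p \<sim>[at c] (\<lambda>x. C * norm (x - c) powr (2 * \<beta>))"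
    using assms(1) by (auto simp: conical_at_def c_def)
  obtain r where r: "r > 0" "smooth_on (ball c r) (coeff_at g p)" "\<forall>x\<in>ball c r. coeff_at g p x > 0"
    using assms(2) by (auto simp: regular_at_def c_def)
  have "continuous_on (ball c r) (coeff_at g p)" using r(2) unfolding smooth_on_def by (metis Ck_on.simps(1))
  then have "isCont (coeff_at g p) c" using r(1) by (simp add: continuous_on_eq_continuous_at)
  then have lim: "(coeff_at g p \<longlongrightarrow> coeff_at g p c) (at c)" by (rule isContD)
  have pos: "coeff_at g p c > 0" using r by simp
  have "((\<lambda>x. C * norm (x - c) powr (2 * \<beta>)) \<longlongrightarrow> coeff_at g p c) (at c)"
    by (rule asymp_equiv_tendsto_transfer[OF C(2) lim])
  then have "((\<lambda>x. 1 / C * (C * norm (x - c) powr (2 * \<beta>))) \<longlongrightarrow> 1 / C * coeff_at g p c) (at c)"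
    by (intro tendsto_intros)
  then have "((\<lambda>x. norm (x - c) powr (2 * \<beta>)) \<longlongrightarrow> coeff_at g p c / C) (at c)" using C(1) by simp
  then have l0: "((\<lambda>x::complex. norm x powr (2 * \<beta>)) \<longlongrightarrow> coeff_at g p c / C) (at 0)"
    by (subst (asm) at_to_0) (simp add: filterlim_filtermap)
  \<comment> \<open>The substitution of \<open>x / 2\<close> divides the function by
    \<open>2 powr (2 * \<beta>)\<close> without changing its limit, which is positive; so this
    factor is 1.\<close>
  have "filterlim (\<lambda>x::complex. x / 2) (at 0) (at 0)"
    unfolding filterlim_at by (auto intro!: tendsto_eq_intros simp: eventually_at_filter)
  from filterlim_compose[OF l0 this]
  have "((\<lambda>x::complex. norm (x / 2) powr (2 * \<beta>)) \<longlongrightarrow> coeff_at g p c / C) (at 0)" .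
  moreover have "norm (x / 2) powr (2 * \<beta>) = norm x powr (2 * \<beta>) / 2 powr (2 * \<beta>)" for x :: complex
    by (simp add: norm_divide powr_divide)
  ultimately have "((\<lambda>x::complex. norm x powr (2 * \<beta>) / 2 powr (2 * \<beta>)) \<longlongrightarrow> coeff_at g p c / C) (at 0)" by simp
  moreover have "((\<lambda>x::complex. norm x powr (2 * \<beta>) / 2 powr (2 * \<beta>)) \<longlongrightarrow> coeff_at g p c / C / 2 powr (2 * \<beta>)) (at 0)"
    by (intro tendsto_intros l0) simp
  ultimately have "coeff_at g p c / C = coeff_at g p c / C / 2 powr (2 * \<beta>)"
    using tendsto_unique[OF at_neq_bot] by blast
  then have "2 powr (2 * \<beta>) = 1" using pos C(1) by simp
  then show ?thesis by simp
qed

text \<open>Membership in \<open>Met\<close> gives the curvature off a divisor of its own, a priori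
  different from \<open>D\<close>. A point of that divisor outside the support of \<open>D\<close>
  would be both regular and conical of nonzero order.\<close>

lemma Met_curvature:
  assumes "g \<in> Met" "has_divisor g D" "p \<notin> Poly_Mapping.keys D"
  shows "gauss_curvature g p = 1"
proof -
  obtain D' where D': "has_divisor g D'" "\<forall>p. p \<notin> Poly_Mapping.keys D' \<longrightarrow> gauss_curvature g p = 1"
    using assms(1) by (auto simp: Met_def)
  have "p \<notin> Poly_Mapping.keys D'"
  proof
    assume p: "p \<in> Poly_Mapping.keys D'"
    then have "conical_at g p (Poly_Mapping.lookup D' p)" using D'(1) by (auto simp: has_divisor_def)
    moreover have "regular_at g p" using assms(2,3) by (auto simp: has_divisor_def)
    ultimately have "Poly_Mapping.lookup D' p = 0" by (rule conical_not_regular)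
    then show False using p by (simp add: in_keys_iff)
  qed
  then show ?thesis using D'(2) by blast
qed

lemma inv_sqrt_coeff_Infty:
  assumes "conformal_pseudometric g" "w \<noteq> 0"
  shows "inv_sqrt_coeff g Infty w = inv_sqrt_coeff g (Pt a) (1 / w) * w * cnj w"
proof -
  have c: "coeff_w g w = coeff_z g (1 / w) / norm w ^ 4" "coeff_z g (1 / w) \<ge> 0"
    using assms by (auto simp: conformal_pseudometric_def)
  have n4: "norm w ^ 4 = norm w powr 4" using powr_realpow[of "norm w" 4] assms(2) by simp
  have "(norm w ^ 4) powr (- 1 / 2) = norm w powr (- 2)" unfolding n4 by (simp only: powr_powr) simp
  also have "\<dots> = 1 / (norm w)\<^sup>2" using assms(2) by (simp add: powr_minus_divide powr_numeral)
  finally have "coeff_w g w powr (- 1 / 2) = coeff_z g (1 / w) powr (- 1 / 2) * (norm w)\<^sup>2"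
    unfolding c(1) by (subst powr_divide) (use c(2) in auto)
  then have "complex_of_real (coeff_w g w powr (- 1 / 2)) = of_real (coeff_z g (1 / w) powr (- 1 / 2)) * (w * cnj w)"
    by (simp only: of_real_mult complex_norm_square)
  then show ?thesis by (simp add: inv_sqrt_coeff_def mult.assoc)
qed

lemma liouville_point:
  assumes U: "open U" and sm: "smooth_on U (coeff_at g p)" and pos: "\<forall>x\<in>U. coeff_at g p x > 0"
    and x: "x \<in> U" and curv: "- laplacian (\<lambda>x. ln (coeff_at g p x)) x / (2 * coeff_at g p x) = 1"
  shows "inv_sqrt_coeff g p x * dzb (dz (inv_sqrt_coeff g p)) x - dz (inv_sqrt_coeff g p) x * dzb (inv_sqrt_coeff g p) x = 1 / 4"
proof -
  let ?X = "inv_sqrt_coeff g p x * dzb (dz (inv_sqrt_coeff g p)) x - dz (inv_sqrt_coeff g p) x * dzb (inv_sqrt_coeff g p) x"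
  have e: "(\<lambda>x. complex_of_real (coeff_at g p x powr (- 1 / 2))) = inv_sqrt_coeff g p"
    "\<And>x. complex_of_real (coeff_at g p x powr (- 1 / 2)) = inv_sqrt_coeff g p x" by (auto simp: inv_sqrt_coeff_def)
  note S = smooth_inv_sqrt_coeff[OF U sm pos, unfolded e]
  have "laplacian (\<lambda>x. ln (coeff_at g p x)) x / coeff_at g p x = - 2"
    using curv bspec[OF pos x] by (simp add: field_simps)
  then have "- 8 * Re ?X = - 2" by (rule trans[OF S(3)[OF x, symmetric]])
  then have R: "Re ?X = 1 / 4" by linarith
  have "?X = of_real (Re ?X)" by (rule of_real_Re[OF S(4)[OF x], symmetric])
  then show ?thesis unfolding R by simp
qed

text \<open>The curvature at each finite point is computed in the z-chart, so the equation holds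
  there at once. In the chart at infinity it is obtained off the centre by inversion, and only the
  centre itself uses the curvature at \<open>Infty\<close>.\<close>

lemma chart_liouville:
  assumes g: "g \<in> Met" and D: "has_divisor g D"
  shows "\<exists>r>0. liouville (ball (coord p) r - (if p \<in> Poly_Mapping.keys D then {coord p} else {})) (inv_sqrt_coeff g p)"
proof -
  let ?K = "Poly_Mapping.keys D"
  have cp: "conformal_pseudometric g" using g by (simp add: Met_def)
  define Z where "Z = {z. Pt z \<notin> ?K}"
  have fin: "finite {z. Pt z \<in> ?K}"
    using finite_vimageI[OF finite_keys[of D], of Pt] by (simp add: vimage_def inj_on_def)
  have oZ: "open Z"
  proof -
    have "Z = - {z. Pt z \<in> ?K}" by (auto simp: Z_def)
    then show ?thesis using fin by (simp add: finite_imp_closed open_Compl)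
  qed
  have e: "(\<lambda>x. complex_of_real (coeff_at g p x powr (- 1 / 2))) = inv_sqrt_coeff g p"
    "complex_of_real (coeff_at g p x powr (- 1 / 2)) = inv_sqrt_coeff g p x" for p x by (auto simp: inv_sqrt_coeff_def)
  have zl: "liouville Z (inv_sqrt_coeff g (Pt a))" for a
  proof (rule liouville_local[OF oZ])
    fix x assume x: "x \<in> Z"
    have "regular_at g (Pt x)" using D x by (auto simp: has_divisor_def Z_def)
    then obtain r where r: "r > 0" "smooth_on (ball x r) (coeff_at g (Pt x))" "\<forall>y\<in>ball x r. coeff_at g (Pt x) y > 0"
      by (auto simp: regular_at_def)
    define U where "U = ball x r \<inter> Z"
    have U: "open U" "x \<in> U" using oZ x r(1) by (auto simp: U_def)
    have sub: "smooth_on U (coeff_at g (Pt a))"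
    proof -
      have "Ck_on k U f" if "Ck_on k (ball x r) f" for k and f :: "complex \<Rightarrow> real"
        using that by (induction k arbitrary: f) (auto simp: U_def intro: continuous_on_subset)
      then show ?thesis using r(2) by (simp add: smooth_on_def)
    qed
    have pos: "\<forall>y\<in>U. coeff_at g (Pt a) y > 0" using r(3) by (auto simp: U_def)
    have "gauss_curvature g (Pt y) = 1" if "y \<in> U" for y
      by (rule Met_curvature[OF g D]) (use that in \<open>auto simp: U_def Z_def\<close>)
    then have "- laplacian (\<lambda>x. ln (coeff_at g (Pt a) x)) y / (2 * coeff_at g (Pt a) y) = 1" if "y \<in> U" for y
      using that by (simp add: gauss_curvature_def)
    from liouville_point[OF U(1) sub pos _ this]
    have "inv_sqrt_coeff g (Pt a) y * dzb (dz (inv_sqrt_coeff g (Pt a))) y - dz (inv_sqrt_coeff g (Pt a)) y * dzb (inv_sqrt_coeff g (Pt a)) y = 1 / 4" if "y \<in> U" for y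
      using that by blast
    then have "liouville U (inv_sqrt_coeff g (Pt a))" using smooth_inv_sqrt_coeff(1,2)[OF U(1) sub pos, unfolded e] U(1) unfolding liouville_def by blast
    then show "\<exists>U. open U \<and> x \<in> U \<and> liouville U (inv_sqrt_coeff g (Pt a))" using U by blast
  qed
  show ?thesis
  proof (cases p)
    case (Pt a)
    have "finite ({z. Pt z \<in> ?K} - {a})" using fin by simp
    then have "open (- ({z. Pt z \<in> ?K} - {a}))" by (intro open_Compl finite_imp_closed)
    then obtain r where r: "r > 0" "ball a r \<subseteq> - ({z. Pt z \<in> ?K} - {a})"
      using openE[of _ a] by blast
    have "liouville (ball a r - (if p \<in> ?K then {a} else {})) (inv_sqrt_coeff g (Pt a))"
      by (rule liouville_subset[OF zl]) (use r(2) in \<open>auto simp: Z_def Pt split: if_splits\<close>)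
    then show ?thesis using r(1) unfolding Pt coord.simps by blast
  next
    case Infty
    have "finite ((\<lambda>z. 1 / z) ` {z. Pt z \<in> ?K} - {0})" using fin by simp
    then have "open (- ((\<lambda>z. 1 / z) ` {z. Pt z \<in> ?K} - {0}))" by (intro open_Compl finite_imp_closed)
    then obtain r where r: "r > 0" "ball 0 r \<subseteq> - ((\<lambda>z. 1 / z) ` {z. Pt z \<in> ?K} - {0})"
      using openE[of _ 0] by blast
    have inZ: "1 / w \<in> Z" if "w \<in> ball 0 r" "w \<noteq> 0" for w
    proof (rule ccontr)
      assume "1 / w \<notin> Z"
      then have "1 / (1 / w) \<in> (\<lambda>z. 1 / z) ` {z. Pt z \<in> ?K}" unfolding Z_def by blast
      then show False using r(2) that by auto
    qed
    let ?B = "ball (0::complex) r - {0}"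
    have oB: "open ?B" by (intro open_Diff) auto
    have "liouville ?B (\<lambda>w. inv_sqrt_coeff g (Pt 0) (1 / w) * (\<i> * w) * cnj (\<i> * w))"
    proof (rule liouville_pullback(1)[OF zl oB])
      show "(\<lambda>w. 1 / w) holomorphic_on ?B" "(\<lambda>w. \<i> * w) holomorphic_on ?B" by (auto intro!: holomorphic_intros)
      show "(\<lambda>w. 1 / w) ` ?B \<subseteq> Z" by (rule image_subsetI, rule inZ) auto
      show "(\<i> * w)\<^sup>2 * deriv (\<lambda>w. 1 / w) w = 1" if "w \<in> ?B" for w
      proof -
        have "deriv (\<lambda>w. 1 / w) w = - 1 / w\<^sup>2"
          by (rule DERIV_imp_deriv) (use that in \<open>auto intro!: derivative_eq_intros simp: power2_eq_square\<close>)
        then show ?thesis using that by (simp add: power_mult_distrib)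
      qed
    qed
    then have lB: "liouville ?B (inv_sqrt_coeff g Infty)"
    proof (rule liouville_cong)
      show "inv_sqrt_coeff g (Pt 0) (1 / w) * (\<i> * w) * cnj (\<i> * w) = inv_sqrt_coeff g Infty w" if "w \<in> ?B" for w
        using inv_sqrt_coeff_Infty[OF cp, of w 0] that by (simp add: mult_ac)
    qed
    show ?thesis
    proof (cases "Infty \<in> ?K")
      case True
      then show ?thesis using lB r(1) Infty by (intro exI[of _ r]) simp
    next
      case False
      then have "regular_at g Infty" using D by (auto simp: has_divisor_def)
      then obtain s where s: "s > 0" "smooth_on (ball 0 s) (coeff_at g Infty)" "\<forall>y\<in>ball 0 s. coeff_at g Infty y > 0"
        by (auto simp: regular_at_def)
      have "gauss_curvature g Infty = 1" by (rule Met_curvature[OF g D False])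
      then have "- laplacian (\<lambda>x. ln (coeff_at g Infty x)) 0 / (2 * coeff_at g Infty 0) = 1"
        by (simp add: gauss_curvature_def)
      from liouville_point[OF open_ball s(2,3) _ this]
      have c0: "inv_sqrt_coeff g Infty 0 * dzb (dz (inv_sqrt_coeff g Infty)) 0 - dz (inv_sqrt_coeff g Infty) 0 * dzb (inv_sqrt_coeff g Infty) 0 = 1 / 4"
        using s(1) by simp
      note Sm = smooth_inv_sqrt_coeff(1,2)[OF open_ball s(2,3), unfolded e]
      define t where "t = min r s"
      have "liouville (ball 0 t) (inv_sqrt_coeff g Infty)"
        unfolding liouville_def
      proof (intro conjI ballI)
        have "ball 0 t \<subseteq> ball (0::complex) s" by (auto simp: t_def)
        with Sm(1) show "wirt_smooth_inf (ball 0 t) (inv_sqrt_coeff g Infty)" unfolding wirt_smooth_inf_def using wirt_smooth_subset by blast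
        show "inv_sqrt_coeff g Infty z * dzb (dz (inv_sqrt_coeff g Infty)) z - dz (inv_sqrt_coeff g Infty) z * dzb (inv_sqrt_coeff g Infty) z = 1 / 4"
          if "z \<in> ball 0 t" for z
        proof (cases "z = 0")
          case False
          then have "z \<in> ?B" using that by (simp add: t_def)
          then show ?thesis using lB unfolding liouville_def by blast
        qed (simp add: c0)
      qed (use Sm(2) in \<open>auto simp: t_def\<close>)
      then show ?thesis using r(1) s(1) Infty False by (intro exI[of _ t]) (simp add: t_def)
    qed
  qed
qed

lemma conical_inv_sqrt_coeff:
  assumes cp: "conformal_pseudometric g" and "conical_at g p \<beta>"
  shows "\<exists>c>0. ((\<lambda>x. norm (x - coord p) powr \<beta> * Re (inv_sqrt_coeff g p x)) \<longlongrightarrow> c) (at (coord p))"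
proof -
  define a where "a = coord p"
  obtain C where C: "C > 0" "coeff_at g p \<sim>[at a] (\<lambda>x. C * norm (x - a) powr (2 * \<beta>))"
    using assms(2) by (auto simp: conical_at_def a_def)
  have nn: "coeff_at g p x \<ge> 0" for x using cp by (cases p) (auto simp: conformal_pseudometric_def)
  have ev: "\<forall>\<^sub>F x in at a. x \<noteq> a" by (simp add: eventually_at_filter)
  have "((\<lambda>x. coeff_at g p x / (C * norm (x - a) powr (2 * \<beta>))) \<longlongrightarrow> 1) (at a)"
    by (rule asymp_equivD_strong[OF C(2)]) (use ev C(1) in \<open>auto elim!: eventually_mono\<close>)
  then have "((\<lambda>x. (coeff_at g p x / (C * norm (x - a) powr (2 * \<beta>))) powr (- 1 / 2)) \<longlongrightarrow> 1 powr (- 1 / 2)) (at a)"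
    by (intro tendsto_intros) auto
  then have "((\<lambda>x. C powr (- 1 / 2) * (coeff_at g p x / (C * norm (x - a) powr (2 * \<beta>))) powr (- 1 / 2)) \<longlongrightarrow> C powr (- 1 / 2) * 1 powr (- 1 / 2)) (at a)"
    by (rule tendsto_mult[OF tendsto_const])
  then have lim: "((\<lambda>x. C powr (- 1 / 2) * (coeff_at g p x / (C * norm (x - a) powr (2 * \<beta>))) powr (- 1 / 2)) \<longlongrightarrow> C powr (- 1 / 2)) (at a)"
    by simp
  have "\<forall>\<^sub>F x in at a. C powr (- 1 / 2) * (coeff_at g p x / (C * norm (x - a) powr (2 * \<beta>))) powr (- 1 / 2)
    = norm (x - a) powr \<beta> * Re (inv_sqrt_coeff g p x)"
    using ev
  proof eventually_elim
    case (elim x)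
    define n where "n = norm (x - a)"
    have n: "n > 0" using elim by (simp add: n_def)
    have p0: "C * n powr (2 * \<beta>) > 0" using C(1) n by simp
    have "(coeff_at g p x / (C * n powr (2 * \<beta>))) powr (- 1 / 2)
      = coeff_at g p x powr (- 1 / 2) / (C powr (- 1 / 2) * (n powr (2 * \<beta>)) powr (- 1 / 2))"
      using nn[of x] C(1) n p0 by (simp add: powr_divide powr_mult)
    also have "(n powr (2 * \<beta>)) powr (- 1 / 2) = 1 / n powr \<beta>"
      by (simp add: powr_powr powr_minus_divide)
    finally show ?case using C(1) n by (simp add: inv_sqrt_coeff_def n_def)
  qed
  from Lim_transform_eventually[OF lim this] C(1) show ?thesis
    by (intro exI[of _ "C powr (- 1 / 2)"]) (simp add: a_def)
qed

section \<open>Homogeneous coordinates and Moebius maps\<close>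

fun hom :: "riemann_sphere \<Rightarrow> complex \<times> complex" where
  "hom (Pt a) = (a, 1)"
| "hom Infty = (1, 0)"

text \<open>The determinant of \<open>(u, v)\<close> and the homogeneous coordinates of
  \<open>p\<close>: the linear form that vanishes exactly at \<open>p\<close>.\<close>

definition lin_form :: "riemann_sphere \<Rightarrow> complex \<Rightarrow> complex \<Rightarrow> complex" where
  "lin_form p u v = u * snd (hom p) - v * fst (hom p)"

definition point_of :: "complex \<Rightarrow> complex \<Rightarrow> riemann_sphere" where
  "point_of u v = (if v = 0 then Infty else Pt (u / v))"

text \<open>\<open>num p u v / den p u v\<close> is the coordinate of \<open>(u : v)\<close> in the
  chart of \<open>p\<close>. As mere selections, both can be applied to the coefficients of linear
  expressions as well as to their values.\<close>

fun num :: "riemann_sphere \<Rightarrow> 'a \<Rightarrow> 'a \<Rightarrow> 'a" where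
  "num (Pt a) u v = u"
| "num Infty u v = v"

fun den :: "riemann_sphere \<Rightarrow> 'a \<Rightarrow> 'a \<Rightarrow> 'a" where
  "den (Pt a) u v = v"
| "den Infty u v = u"

lemma lin_eq_0_iff: "u \<noteq> 0 \<or> v \<noteq> 0 \<Longrightarrow> lin_form p u v = 0 \<longleftrightarrow> p = point_of u v"
  by (cases p) (auto simp: lin_form_def point_of_def field_simps)

lemma lin_hom_eq_0_iff: "lin_form p (fst (hom q)) (snd (hom q)) = 0 \<longleftrightarrow> p = q"
  by (cases p; cases q) (auto simp: lin_form_def)

lemma den_pt_nz: "u \<noteq> 0 \<or> v \<noteq> 0 \<Longrightarrow> den (point_of u v) u v \<noteq> 0"
  by (auto simp: point_of_def)

lemma num_den_pt: "num (point_of u v) u v / den (point_of u v) u v = coord (point_of u v)"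
  by (auto simp: point_of_def)

text \<open>A function on homogeneous coordinates which represents \<open>inv_sqrt_coeff\<close> in both charts at once.\<close>

definition hom_inv_sqrt :: "conformal_form \<Rightarrow> complex \<Rightarrow> complex \<Rightarrow> complex" where
  "hom_inv_sqrt g u v = (if v \<noteq> 0 then inv_sqrt_coeff g (Pt 0) (u / v) * v * cnj v else inv_sqrt_coeff g Infty 0 * u * cnj u)"

lemma hom_inv_sqrt_chart:
  assumes "conformal_pseudometric g" "den p u v \<noteq> 0"
  shows "hom_inv_sqrt g u v = inv_sqrt_coeff g p (num p u v / den p u v) * den p u v * cnj (den p u v)"
proof (cases p)
  case (Pt a)
  then show ?thesis using assms(2) by (simp add: hom_inv_sqrt_def inv_sqrt_coeff_def)
next
  case Infty
  show ?thesis
  proof (cases "v = 0")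
    case False
    then have "v / u \<noteq> 0" using assms(2) Infty by simp
    from inv_sqrt_coeff_Infty[OF assms(1) this, of 0] show ?thesis using Infty False assms(2)
      by (simp add: hom_inv_sqrt_def mult_ac)
  qed (use Infty in \<open>simp add: hom_inv_sqrt_def\<close>)
qed

lemma hom_inv_sqrt_scale:
  assumes "c \<noteq> 0" shows "hom_inv_sqrt g (c * u) (c * v) = hom_inv_sqrt g u v * c * cnj c"
  using assms by (simp add: hom_inv_sqrt_def mult_ac)

lemma mobius_difference:
  fixes n1 n0 d1 d0 z w :: complex
  assumes "d1 * z + d0 \<noteq> 0" "d1 * w + d0 \<noteq> 0"
  shows "(n1 * z + n0) / (d1 * z + d0) - (n1 * w + n0) / (d1 * w + d0)
    = (n1 * d0 - n0 * d1) * (z - w) / ((d1 * z + d0) * (d1 * w + d0))"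
  using assms by (simp add: divide_simps) (simp add: algebra_simps)

text \<open>The Moebius map n / d has derivative \<open>\<delta>\<close> over the square of
  \<open>d\<close>, so the factor \<open>d z * cnj (d z) / norm \<delta>\<close> is the reciprocal
  modulus of the derivative and \<open>h\<close> represents the pulled back metric.\<close>

context
  fixes n1 n0 d1 d0 z0 \<delta> :: complex and h f n d :: "complex \<Rightarrow> complex"
  assumes \<delta>: "n1 * d0 - n0 * d1 = \<delta>" "\<delta> \<noteq> 0"
    and n: "\<And>z. n z = n1 * z + n0" and d: "\<And>z. d z = d1 * z + d0"
    and dz0: "d z0 \<noteq> 0"
    and h: "\<And>z. d z \<noteq> 0 \<Longrightarrow> h z = f (n z / d z) * d z * cnj (d z) / of_real (norm \<delta>)"
begin

lemma mobius_den_nz: "\<exists>r>0. \<forall>z\<in>ball z0 r. d z \<noteq> 0"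
proof -
  have "continuous_on UNIV d" unfolding d by (intro continuous_intros)
  then have "open (d -` (- {0}))" by (intro open_vimage) (auto simp: open_Compl)
  then obtain r where "r > 0" "ball z0 r \<subseteq> d -` (- {0})" using openE[of "d -` (- {0})" z0] dz0 by auto
  then show ?thesis by (intro exI[of _ r]) auto
qed

lemma mobius_pullback_liouville:
  assumes f: "liouville (ball (n z0 / d z0) r - X) f" "r > 0" and X: "X = {} \<or> X = {n z0 / d z0}"
  shows "\<exists>s>0. liouville (ball z0 s - (if X = {} then {} else {z0})) h"
proof -
  obtain s0 where s0: "s0 > 0" "\<forall>z\<in>ball z0 s0. d z \<noteq> 0" using mobius_den_nz by blast
  have hol: "(\<lambda>z. n z / d z) holomorphic_on ball z0 s0"
    using s0(2) unfolding n d by (intro holomorphic_intros) auto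
  have "isCont (\<lambda>z. n z / d z) z0"
    using holomorphic_on_imp_continuous_on[OF hol] s0(1) by (simp add: continuous_on_eq_continuous_at)
  then obtain s1 where s1: "s1 > 0" "\<And>z. dist z z0 < s1 \<Longrightarrow> dist (n z / d z) (n z0 / d z0) < r"
    using f(2) unfolding continuous_at_eps_delta by blast
  define s where "s = min s0 s1"
  define B where "B = ball z0 s - (if X = {} then {} else {z0})"
  have oB: "open B" unfolding B_def by (auto intro: open_delete)
  have sub: "B \<subseteq> ball z0 s0" by (auto simp: B_def s_def)
  have dB: "d z \<noteq> 0" if "z \<in> B" for z using s0(2) sub that by auto
  \<comment> \<open>\<open>d z / c\<close> is a square root of the reciprocal derivative, as
    \<open>liouville_pullback\<close> requires.\<close>
  define c where "c = csqrt \<delta>"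
  have c: "c\<^sup>2 = \<delta>" "c \<noteq> 0" using \<delta>(2) by (auto simp: c_def)
  have "liouville B (\<lambda>z. f (n z / d z) * (d z / c) * cnj (d z / c))"
  proof (rule liouville_pullback(1)[OF f(1) oB])
    show "(\<lambda>z. n z / d z) holomorphic_on B" by (rule holomorphic_on_subset[OF hol sub])
    show "(\<lambda>z. d z / c) holomorphic_on B" unfolding d by (intro holomorphic_intros) (use c in auto)
    show "(\<lambda>z. n z / d z) ` B \<subseteq> ball (n z0 / d z0) r - X"
    proof
      fix y assume "y \<in> (\<lambda>z. n z / d z) ` B"
      then obtain z where z: "z \<in> B" "y = n z / d z" by blast
      have "dist (n z / d z) (n z0 / d z0) < r" using s1(2)[of z] z(1) by (auto simp: B_def s_def dist_commute)
      moreover have "y \<notin> X"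
      proof (cases "X = {}")
        case False
        then have "z \<noteq> z0" using z(1) by (auto simp: B_def)
        then have "n z / d z - n z0 / d z0 \<noteq> 0"
          using mobius_difference[of d1 z d0 z0 n1 n0] dB[OF z(1)] dz0 \<delta> unfolding n d by simp
        then show ?thesis using X False z(2) by auto
      qed simp
      ultimately show "y \<in> ball (n z0 / d z0) r - X" using z(2) by (simp add: dist_commute)
    qed
    show "(d z / c)\<^sup>2 * deriv (\<lambda>z. n z / d z) z = 1" if z: "z \<in> B" for z
    proof -
      have "((\<lambda>z. n z / d z) has_field_derivative \<delta> / (d z)\<^sup>2) (at z)"
        unfolding n d \<delta>(1)[symmetric] using dB[OF z] unfolding d
        by (auto intro!: derivative_eq_intros simp: power2_eq_square field_simps)
      then have "deriv (\<lambda>z. n z / d z) z = \<delta> / (d z)\<^sup>2" by (rule DERIV_imp_deriv)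
      then show ?thesis using dB[OF z] c \<delta>(2) by (simp add: power_divide)
    qed
  qed
  then have "liouville B h"
  proof (rule liouville_cong)
    fix z assume z: "z \<in> B"
    have "c * cnj c = of_real ((norm c)\<^sup>2)" by (simp only: complex_norm_square)
    also have "(norm c)\<^sup>2 = norm \<delta>" by (simp flip: norm_power add: c(1))
    finally have e: "(d z / c) * cnj (d z / c) = d z * cnj (d z) / of_real (norm \<delta>)" by simp
    show "f (n z / d z) * (d z / c) * cnj (d z / c) = h z"
      unfolding h[OF dB[OF z]] mult.assoc e by simp
  qed
  then show ?thesis using s0(1) s1(1) by (intro exI[of _ s]) (simp add: s_def B_def)
qed

lemma mobius_pullback_conical:
  assumes lim: "((\<lambda>x. norm (x - n z0 / d z0) powr \<beta> * Re (f x)) \<longlongrightarrow> c) (at (n z0 / d z0))" "c > 0"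
  shows "\<exists>c>0. ((\<lambda>z. norm (z - z0) powr \<beta> * Re (h z)) \<longlongrightarrow> c) (at z0)"
proof -
  obtain s0 where s0: "s0 > 0" "\<forall>z\<in>ball z0 s0. d z \<noteq> 0" using mobius_den_nz by blast
  have ct: "isCont (\<lambda>z. n z / d z) z0" "isCont d z0" using dz0 unfolding n d by (auto intro!: continuous_intros)
  have ev: "\<forall>\<^sub>F z in at z0. z \<in> ball z0 s0 - {z0}" using s0(1) by (intro eventually_at_in_open) auto
  have diff: "n z / d z - n z0 / d z0 = \<delta> * (z - z0) / (d z * d z0)" if "d z \<noteq> 0" for z
    using mobius_difference[of d1 z d0 z0 n1 n0] that dz0 unfolding n d \<delta>(1) by simp
  have "\<forall>\<^sub>F z in at z0. n z / d z \<noteq> n z0 / d z0"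
    using ev
  proof eventually_elim
    case (elim z)
    then have "d z \<noteq> 0" "z \<noteq> z0" using s0 by auto
    then show ?case using diff[of z] \<delta>(2) dz0 by auto
  qed
  then have "filterlim (\<lambda>z. n z / d z) (at (n z0 / d z0)) (at z0)"
    using isContD[OF ct(1)] by (simp add: filterlim_at)
  from filterlim_compose[OF lim(1) this]
  have l1: "((\<lambda>z. norm (n z / d z - n z0 / d z0) powr \<beta> * Re (f (n z / d z))) \<longlongrightarrow> c) (at z0)" .
  \<comment> \<open>The first factor converts the distance of the images into the distance to
    \<open>z0\<close>, the second is the conformal factor of the pullback.\<close>
  define e where "e z = (norm (d z) * norm (d z0) / norm \<delta>) powr \<beta> * ((norm (d z))\<^sup>2 / norm \<delta>)" for z
  have "isCont e z0" unfolding e_def using ct(2) dz0 \<delta>(2) by (intro continuous_intros) auto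
  then have "(e \<longlongrightarrow> e z0) (at z0)" by (rule isContD)
  from tendsto_mult[OF this l1]
  have l2: "((\<lambda>z. e z * (norm (n z / d z - n z0 / d z0) powr \<beta> * Re (f (n z / d z)))) \<longlongrightarrow> e z0 * c) (at z0)" .
  have "\<forall>\<^sub>F z in at z0. e z * (norm (n z / d z - n z0 / d z0) powr \<beta> * Re (f (n z / d z))) = norm (z - z0) powr \<beta> * Re (h z)"
    using ev
  proof eventually_elim
    case (elim z)
    then have z: "d z \<noteq> 0" "z \<noteq> z0" using s0 by auto
    have "d z * cnj (d z) = of_real ((norm (d z))\<^sup>2)" by (simp only: complex_norm_square)
    then have "h z = f (n z / d z) * of_real ((norm (d z))\<^sup>2 / norm \<delta>)"
      unfolding h[OF z(1)] by (simp add: mult.assoc)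
    then have Rh: "Re (h z) = Re (f (n z / d z)) * ((norm (d z))\<^sup>2 / norm \<delta>)" by simp
    have "(norm (d z) * norm (d z0) / norm \<delta>) powr \<beta> * norm (n z / d z - n z0 / d z0) powr \<beta>
       = ((norm (d z) * norm (d z0) / norm \<delta>) * norm (n z / d z - n z0 / d z0)) powr \<beta>"
      by (rule powr_mult[symmetric])
    also have "(norm (d z) * norm (d z0) / norm \<delta>) * norm (n z / d z - n z0 / d z0) = norm (z - z0)"
      unfolding diff[OF z(1)] using z(1) dz0 \<delta>(2) by (simp add: norm_mult norm_divide)
    finally show ?case unfolding e_def Rh by (simp add: mult_ac)
  qed
  from Lim_transform_eventually[OF l2 this] show ?thesis
    using lim(2) dz0 \<delta>(2) by (intro exI[of _ "e z0 * c"]) (simp add: e_def)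
qed

end

text \<open>The map z to (u1 z + u0 : v1 z + v0) has no poles as a map to the sphere. Near
  \<open>z0\<close> it is read in the chart of the image point, where it is a Moebius fraction with
  finite value, whether or not the image is infinity.\<close>

lemma metric_pullback:
  fixes g :: conformal_form
  assumes g: "g \<in> Met" and D: "has_divisor g D"
    and \<Delta>: "\<Delta> = u1 * v0 - u0 * v1" "\<Delta> \<noteq> 0"
    and hdef: "\<And>z. h z = hom_inv_sqrt g (u1 * z + u0) (v1 * z + v0) / of_real (norm \<Delta>)"
    and p: "p = point_of (u1 * z0 + u0) (v1 * z0 + v0)"
  shows "\<exists>s>0. liouville (ball z0 s - (if p \<in> Poly_Mapping.keys D then {z0} else {})) h"
    and "p \<in> Poly_Mapping.keys D \<Longrightarrow>
      \<exists>c>0. ((\<lambda>z. norm (z - z0) powr Poly_Mapping.lookup D p * Re (h z)) \<longlongrightarrow> c) (at z0)"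
proof -
  have cp: "conformal_pseudometric g" using g by (simp add: Met_def)
  have nz: "u1 * z0 + u0 \<noteq> 0 \<or> v1 * z0 + v0 \<noteq> 0"
  proof (rule ccontr)
    assume "\<not> (u1 * z0 + u0 \<noteq> 0 \<or> v1 * z0 + v0 \<noteq> 0)"
    then have 0: "u0 = - u1 * z0" "v0 = - v1 * z0" by (auto simp: add_eq_0_iff)
    show False using \<Delta> unfolding 0 by (simp add: mult_ac)
  qed
  define n1 n0 where "n1 = num p u1 v1" and "n0 = num p u0 v0"
  define d1 d0 where "d1 = den p u1 v1" and "d0 = den p u0 v0"
  have nu: "num p (u1 * z + u0) (v1 * z + v0) = n1 * z + n0" for z by (cases p) (auto simp: n1_def n0_def)
  have de: "den p (u1 * z + u0) (v1 * z + v0) = d1 * z + d0" for z by (cases p) (auto simp: d1_def d0_def)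
  define \<delta> where "\<delta> = n1 * d0 - n0 * d1"
  \<comment> \<open>The chart at infinity interchanges numerator and denominator and so reverses the
    determinant; only its modulus enters the metric.\<close>
  have \<delta>: "\<delta> = \<Delta> \<or> \<delta> = - \<Delta>" by (cases p) (auto simp: \<delta>_def n1_def n0_def d1_def d0_def \<Delta>(1) mult_ac)
  have \<delta>2: "\<delta> \<noteq> 0" "norm \<delta> = norm \<Delta>" using \<delta> \<Delta>(2) by auto
  have dnz: "d1 * z0 + d0 \<noteq> 0" using den_pt_nz[OF nz] unfolding p[symmetric] de .
  have co: "(n1 * z0 + n0) / (d1 * z0 + d0) = coord p"
    using num_den_pt[of "u1 * z0 + u0" "v1 * z0 + v0"] unfolding p[symmetric] de nu .
  have h: "h z = inv_sqrt_coeff g p ((n1 * z + n0) / (d1 * z + d0)) * (d1 * z + d0) * cnj (d1 * z + d0) / of_real (norm \<delta>)"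
    if "d1 * z + d0 \<noteq> 0" for z
    using hom_inv_sqrt_chart[OF cp, of p "u1 * z + u0" "v1 * z + v0"] that unfolding hdef de nu \<delta>2(2) by simp
  obtain r where r: "r > 0" "liouville (ball (coord p) r - (if p \<in> Poly_Mapping.keys D then {coord p} else {})) (inv_sqrt_coeff g p)"
    using chart_liouville[OF g D] by blast
  define X where "X = (if p \<in> Poly_Mapping.keys D then {coord p} else {})"
  have "\<exists>s>0. liouville (ball z0 s - (if X = {} then {} else {z0})) h"
    by (rule mobius_pullback_liouville[OF \<delta>_def[symmetric] \<delta>2(1) refl refl dnz h, of r X])
       (use r co in \<open>auto simp: X_def\<close>)
  then show "\<exists>s>0. liouville (ball z0 s - (if p \<in> Poly_Mapping.keys D then {z0} else {})) h"
    by (auto simp: X_def split: if_splits)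
  assume pK: "p \<in> Poly_Mapping.keys D"
  then have "conical_at g p (Poly_Mapping.lookup D p)" using D by (auto simp: has_divisor_def)
  from conical_inv_sqrt_coeff[OF cp this] obtain c where c: "c > 0"
    "((\<lambda>x. norm (x - coord p) powr Poly_Mapping.lookup D p * Re (inv_sqrt_coeff g p x)) \<longlongrightarrow> c) (at (coord p))" by blast
  show "\<exists>c>0. ((\<lambda>z. norm (z - z0) powr Poly_Mapping.lookup D p * Re (h z)) \<longlongrightarrow> c) (at z0)"
    by (rule mobius_pullback_conical[OF \<delta>_def[symmetric] \<delta>2(1) refl refl dnz h, of "Poly_Mapping.lookup D p" c])
       (use c co in auto)
qed

text \<open>All conditions are invariant under Moebius maps, so the three points may be moved to 0,
  1 and infinity, where \<open>three_conical_parity\<close> applies.\<close>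

theorem metric_parity:
  fixes p1 p2 p3 :: riemann_sphere and \<beta>1 \<beta>2 \<beta>3 :: nat
  assumes ne: "p1 \<noteq> p2" "p1 \<noteq> p3" "p2 \<noteq> p3" and pos: "\<beta>1 > 0" "\<beta>2 > 0" "\<beta>3 > 0"
    and le: "\<beta>1 \<le> \<beta>2" "\<beta>2 \<le> \<beta>3" and g: "g \<in> Met"
    and D: "has_divisor g (Poly_Mapping.single p1 (real \<beta>1) + Poly_Mapping.single p2 (real \<beta>2)
              + Poly_Mapping.single p3 (real \<beta>3))" (is "has_divisor g ?D")
  shows "\<exists>N. \<beta>1 + \<beta>2 = \<beta>3 + 2 * N"
proof -
  have lk: "Poly_Mapping.lookup ?D p1 = \<beta>1" "Poly_Mapping.lookup ?D p2 = \<beta>2" "Poly_Mapping.lookup ?D p3 = \<beta>3"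
    using ne by (auto simp: lookup_add lookup_single)
  have keys: "p \<in> Poly_Mapping.keys ?D \<longleftrightarrow> p \<in> {p1, p2, p3}" for p
    using ne pos by (auto simp: in_keys_iff lookup_add lookup_single when_def)
  \<comment> \<open>The pairwise determinants of the three points, nonzero because the points are
    distinct.\<close>
  define k1 where "k1 = lin_form p3 (fst (hom p2)) (snd (hom p2))"
  define k3 where "k3 = lin_form p2 (fst (hom p1)) (snd (hom p1))"
  define k2 where "k2 = lin_form p3 (fst (hom p1)) (snd (hom p1))"
  have k: "k1 \<noteq> 0" "k2 \<noteq> 0" "k3 \<noteq> 0"
    using ne by (auto simp: k1_def k2_def k3_def lin_hom_eq_0_iff)
  define a b where "a = k1 * fst (hom p1)" and "b = k1 * snd (hom p1)"
  define c d where "c = k3 * fst (hom p3)" and "d = k3 * snd (hom p3)"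
  define \<Delta> where "\<Delta> = c * b - a * d"
  have \<Delta>: "\<Delta> = - (k1 * k2 * k3)" by (simp add: \<Delta>_def a_def b_def c_def d_def k2_def lin_form_def algebra_simps)
  have \<Delta>0: "\<Delta> \<noteq> 0" using k \<Delta> by simp
  \<comment> \<open>By the Pluecker relation, \<open>z \<mapsto> (c z + a : d z + b)\<close> maps \<open>0, 1, \<infinity>\<close> to \<open>p1, p2, p3\<close>.\<close>
  define H where "H z = hom_inv_sqrt g (c * z + a) (d * z + b) / of_real (norm \<Delta>)" for z
  \<comment> \<open>The same metric in the coordinate 1 / z: exchanging the coefficients moves
    \<open>p3\<close> to parameter 0.\<close>
  define H' where "H' z = hom_inv_sqrt g (a * z + c) (b * z + d) / of_real (norm (- \<Delta>))" for z
  have \<Delta>': "- \<Delta> = a * d - c * b" "- \<Delta> \<noteq> 0" using \<Delta>0 by (simp_all add: \<Delta>_def)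
  have nz: "c * z + a \<noteq> 0 \<or> d * z + b \<noteq> 0" for z
  proof (rule ccontr)
    assume "\<not> (c * z + a \<noteq> 0 \<or> d * z + b \<noteq> 0)"
    then have 0: "a = - c * z" "b = - d * z" by (auto simp: add_eq_0_iff)
    show False using \<Delta>0 unfolding \<Delta>_def 0 by (simp add: mult_ac)
  qed
  have nzc: "c \<noteq> 0 \<or> d \<noteq> 0" using \<Delta>0 by (auto simp: \<Delta>_def)
  have l1: "lin_form p1 (c * z + a) (d * z + b) = - (k3 * k2) * z" for z
    by (simp add: lin_form_def a_def b_def c_def d_def k2_def algebra_simps)
  have l3: "lin_form p3 (c * z + a) (d * z + b) = k1 * k2" for z
    by (simp add: lin_form_def a_def b_def c_def d_def k2_def algebra_simps)
  have l2: "lin_form p2 (c * z + a) (d * z + b) = k1 * k3 * (1 - z)" for z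
    by (simp add: lin_form_def a_def b_def c_def d_def k1_def k3_def algebra_simps)
  have q1: "p1 = point_of (c * z + a) (d * z + b) \<longleftrightarrow> z = 0" for z
    using lin_eq_0_iff[OF nz, of p1 z] l1[of z] k by auto
  have q2: "p2 = point_of (c * z + a) (d * z + b) \<longleftrightarrow> z = 1" for z
    using lin_eq_0_iff[OF nz, of p2 z] l2[of z] k by auto
  have q3: "p3 \<noteq> point_of (c * z + a) (d * z + b)" for z
    using lin_eq_0_iff[OF nz, of p3 z] l3[of z] k by auto
  have q3': "p3 = point_of (a * 0 + c) (b * 0 + d)"
    using lin_eq_0_iff[OF nzc, of p3] by (simp add: lin_form_def c_def d_def mult_ac)
  note pull = metric_pullback[OF g D \<Delta>_def \<Delta>0 H_def]
  note pull' = metric_pullback[OF g D \<Delta>' H'_def]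
  have liou: "liouville (UNIV - {0, 1}) H"
  proof (rule liouville_local)
    show "open (UNIV - {0, 1 :: complex})" by (intro open_Diff) auto
    fix z :: complex assume z: "z \<in> UNIV - {0, 1}"
    define p where "p = point_of (c * z + a) (d * z + b)"
    have "p \<notin> Poly_Mapping.keys ?D" unfolding keys using q1[of z] q2[of z] q3[of z] z by (auto simp: p_def)
    with pull(1)[OF p_def] show "\<exists>U. open U \<and> z \<in> U \<and> liouville U H" by (metis Diff_empty centre_in_ball open_ball)
  qed
  obtain c0 where c0: "c0 > 0" "((\<lambda>z. norm (z - 0) powr \<beta>1 * Re (H z)) \<longlongrightarrow> c0) (at 0)"
    using pull(2)[of p1 0] q1[of 0] keys[of p1] lk(1) by auto
  obtain c1 where c1: "c1 > 0" "((\<lambda>z. norm (z - 1) powr \<beta>2 * Re (H z)) \<longlongrightarrow> c1) (at 1)"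
    using pull(2)[of p2 1] q2[of 1] keys[of p2] lk(2) by auto
  obtain c2 where c2: "c2 > 0" "((\<lambda>z. norm (z - 0) powr \<beta>3 * Re (H' z)) \<longlongrightarrow> c2) (at 0)"
    using pull'(2)[of p3 0] q3' keys[of p3] lk(3) by auto
  have HH': "H' z = H (1 / z) * z * cnj z" if "z \<noteq> 0" for z
  proof -
    have "a * z + c = z * (c * (1 / z) + a)" "b * z + d = z * (d * (1 / z) + b)" using that by (simp_all add: field_simps)
    then have "hom_inv_sqrt g (a * z + c) (b * z + d) = hom_inv_sqrt g (c * (1 / z) + a) (d * (1 / z) + b) * z * cnj z"
      using hom_inv_sqrt_scale[OF that] by metis
    then show ?thesis by (simp add: H_def H'_def)
  qed
  show ?thesis
  proof (rule three_conical_parity[OF liou _ c0(1) _ c1(1) _ c2(1) le pos(1)])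
    show "((\<lambda>z. norm z powr \<beta>1 * Re (H z)) \<longlongrightarrow> c0) (at 0)" using c0(2) by simp
    show "((\<lambda>z. norm z powr \<beta>2 * Re (H (z + 1))) \<longlongrightarrow> c1) (at 0)"
      using LIM_offset_zero[OF c1(2)] by (simp add: add.commute)
    have "\<forall>\<^sub>F z in at (0::complex). z \<noteq> 0" by (simp add: eventually_at_filter)
    then have "\<forall>\<^sub>F z in at 0. norm (z - 0) powr \<beta>3 * Re (H' z) = norm z powr \<beta>3 * Re (H (1 / z) * z * cnj z)"
      by eventually_elim (simp add: HH')
    then show "((\<lambda>z. norm z powr \<beta>3 * Re (H (1 / z) * z * cnj z)) \<longlongrightarrow> c2) (at 0)"
      by (rule Lim_transform_eventually[OF c2(2)])
  qed
qed

section \<open>Pullbacks of the Fubini--Study metric\<close>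

text \<open>For f = p / q the density is 4 |f'|^2 / (1 + |f|^2)^2, the pullback of the round metric
  of curvature 1. Writing it with the Wronskian of \<open>p\<close> and \<open>q\<close> removes the
  division by \<open>q\<close>, so poles of f are ordinary points.\<close>

context
  fixes p q W :: "complex \<Rightarrow> complex" and \<rho> :: "complex \<Rightarrow> real"
  assumes p: "p holomorphic_on UNIV" and q: "q holomorphic_on UNIV"
    and nz: "\<And>z. p z \<noteq> 0 \<or> q z \<noteq> 0"
    and W: "\<And>z. W z = deriv p z * q z - p z * deriv q z"
    and \<rho>: "\<And>z. \<rho> z = 4 * (norm (W z))\<^sup>2 / ((norm (p z))\<^sup>2 + (norm (q z))\<^sup>2)\<^sup>2"
begin

lemma fubini_study_denom_pos: "(norm (p z))\<^sup>2 + (norm (q z))\<^sup>2 > 0"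
  using nz[of z] by (auto simp: add_pos_nonneg add_nonneg_pos)

lemma fubini_study_wronskian_holomorphic: "W holomorphic_on UNIV"
  unfolding W[abs_def] by (intro holomorphic_intros p q) auto

lemma fubini_study_complex:
  "of_real (\<rho> z) = 4 * (W z * cnj (W z)) / ((p z * cnj (p z) + q z * cnj (q z)) * (p z * cnj (p z) + q z * cnj (q z)))"
  unfolding \<rho> by (simp only: of_real_divide of_real_mult of_real_add of_real_power complex_norm_square
      power2_eq_square[of "_ + _"] of_real_numeral flip: complex_norm_square)

lemma fubini_study_wirt_smooth: "wirt_smooth k UNIV (\<lambda>z. of_real (\<rho> z))"
proof -
  have h: "wirt_smooth k UNIV p" "wirt_smooth k UNIV q" "wirt_smooth k UNIV W"
    using wirt_smooth_holomorphic[OF open_UNIV] p q fubini_study_wronskian_holomorphic by auto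
  have s: "wirt_smooth k UNIV (\<lambda>z. (p z * cnj (p z) + q z * cnj (q z)) * (p z * cnj (p z) + q z * cnj (q z)))"
    by (intro wirt_smooth_mult wirt_smooth_add wirt_smooth_cnj open_UNIV h)
  have ne: "(p z * cnj (p z) + q z * cnj (q z)) * (p z * cnj (p z) + q z * cnj (q z)) \<noteq> 0" for z
  proof -
    have "p z * cnj (p z) + q z * cnj (q z) = of_real ((norm (p z))\<^sup>2 + (norm (q z))\<^sup>2)"
      by (simp only: complex_norm_square of_real_add)
    then show ?thesis using fubini_study_denom_pos[of z] by (metis mult_eq_0_iff of_real_eq_0_iff less_irrefl)
  qed
  have "wirt_smooth k UNIV (\<lambda>z. inverse ((p z * cnj (p z) + q z * cnj (q z)) * (p z * cnj (p z) + q z * cnj (q z))))"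
    by (rule wirt_smooth_outer[OF open_UNIV _ _ s, of "- {0}" inverse]) (use ne in \<open>auto intro!: holomorphic_intros simp: open_Compl\<close>)
  then show ?thesis unfolding fubini_study_complex divide_inverse
    by (intro wirt_smooth_mult wirt_smooth_const wirt_smooth_cnj open_UNIV h)
qed

lemma fubini_study_smooth: "smooth_on UNIV \<rho>"
  unfolding smooth_on_def using wirt_smooth_imp_Ck_on[OF open_UNIV fubini_study_wirt_smooth] by simp

lemma fubini_study_pos: "W z \<noteq> 0 \<Longrightarrow> \<rho> z > 0"
  unfolding \<rho> using fubini_study_denom_pos[of z]
  by (intro divide_pos_pos mult_pos_pos zero_less_power) auto

text \<open>Off its zeros the contribution of \<open>W\<close> to \<open>ln \<rho>\<close> is
  harmonic. The rest is - 2 ln s with s = |p|^2 + |q|^2, and the mixed derivative of ln s is |W|^2 /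
  s^2.\<close>

lemma fubini_study_laplacian:
  assumes z: "W z \<noteq> 0"
  shows "laplacian (\<lambda>x. ln (\<rho> x)) z = - 2 * \<rho> z"
proof -
  define U where "U = {x. W x \<noteq> 0}"
  have cW: "continuous_on UNIV W" by (rule holomorphic_on_imp_continuous_on[OF fubini_study_wronskian_holomorphic])
  have U: "open U" "z \<in> U"
    using open_vimage[OF _ cW, of "- {0}"] z by (auto simp: U_def vimage_def open_Compl)
  have pos: "\<rho> x > 0" if "x \<in> U" for x using that fubini_study_pos by (simp add: U_def)
  define r where "r x = complex_of_real (\<rho> x)" for x
  define s where "s x = p x * cnj (p x) + q x * cnj (q x)" for x
  have sr: "s x = of_real ((norm (p x))\<^sup>2 + (norm (q x))\<^sup>2)" for x
    unfolding s_def by (simp only: complex_norm_square of_real_add)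
  have snz: "s x \<noteq> 0" for x using fubini_study_denom_pos[of x] unfolding sr by (metis of_real_eq_0_iff less_irrefl)
  have rW: "r x = 4 * (W x * cnj (W x)) / (s x * s x)" for x unfolding r_def s_def by (rule fubini_study_complex)
  have rp: "r x \<notin> \<real>\<^sub>\<le>\<^sub>0" if "x \<in> U" for x using pos[OF that] by (auto simp: r_def nonpos_Reals_def)
  have L: "complex_of_real (ln (\<rho> x)) = Ln (r x)" if "x \<in> U" for x using pos[OF that] by (simp add: r_def Ln_of_real)
  have o: "open (- \<real>\<^sub>\<le>\<^sub>0 :: complex set)" by (simp add: open_Compl)
  have smL: "wirt_smooth k U (\<lambda>x. Ln (r x))" for k
    by (rule wirt_smooth_outer[OF U(1) o _ wirt_smooth_subset[OF fubini_study_wirt_smooth[of k, folded r_def]]])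
       (use rp in \<open>auto intro!: holomorphic_intros\<close>)
  have "Ck_on (Suc (Suc 0)) U (\<lambda>x. ln (\<rho> x))"
  proof (rule Ck_on_cong[OF U(1) _ wirt_smooth_imp_Ck_on[OF U(1) smL]])
    show "Re (Ln (r x)) = ln (\<rho> x)" if "x \<in> U" for x using L[OF that] by (metis Re_complex_of_real)
  qed
  from laplacian_wirt[OF U this]
  have lap: "laplacian (\<lambda>x. ln (\<rho> x)) z = 4 * Re (dzb (dz (\<lambda>x. complex_of_real (ln (\<rho> x)))) z)" .
  define A where "A x = p x * cnj (deriv p x) + q x * cnj (deriv q x)" for x
  define B where "B x = deriv p x * cnj (p x) + deriv q x * cnj (q x)" for x
  note dp = has_wirt_field[OF holomorphic_derivD[OF p open_UNIV UNIV_I]]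
    and dq = has_wirt_field[OF holomorphic_derivD[OF q open_UNIV UNIV_I]]
    and dW = has_wirt_field[OF holomorphic_derivD[OF fubini_study_wronskian_holomorphic open_UNIV UNIV_I]]
    and ddp = has_wirt_field[OF holomorphic_derivD[OF holomorphic_deriv[OF p open_UNIV] open_UNIV UNIV_I]]
    and ddq = has_wirt_field[OF holomorphic_derivD[OF holomorphic_deriv[OF q open_UNIV] open_UNIV UNIV_I]]
    and ddW = has_wirt_field[OF holomorphic_derivD[OF holomorphic_deriv[OF fubini_study_wronskian_holomorphic open_UNIV] open_UNIV UNIV_I]]
  have eq: "has_wirt F x a b \<Longrightarrow> a = c \<Longrightarrow> b = d \<Longrightarrow> has_wirt F x c d" for F x a b c d by simp
  have ds: "has_wirt s x (B x) (A x)" for x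
    unfolding s_def[abs_def] A_def B_def
    by (rule eq, (rule has_wirt_add has_wirt_mult has_wirt_cnj dp dq)+) simp_all
  have dr: "has_wirt r x ((4 * (deriv W x * cnj (W x)) * (s x * s x) - 4 * (W x * cnj (W x)) * (2 * s x * B x)) / (s x * s x)\<^sup>2)
     ((4 * (W x * cnj (deriv W x)) * (s x * s x) - 4 * (W x * cnj (W x)) * (2 * s x * A x)) / (s x * s x)\<^sup>2)" for x
    unfolding rW[abs_def]
    by (rule eq, (rule has_wirt_divide has_wirt_mult has_wirt_const has_wirt_cnj dW ds)+)
       (simp_all add: snz algebra_simps)
  have dL: "dz (\<lambda>x. complex_of_real (ln (\<rho> x))) x = deriv W x / W x - 2 * (B x / s x)" if x: "x \<in> U" for x
  proof -
    have "(Ln has_field_derivative inverse (r x)) (at (r x))"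
      using rp[OF x] by (rule has_field_derivative_Ln)
    from has_wirtD(1)[OF has_wirt_outer[OF dr this]]
    have "dz (\<lambda>x. Ln (r x)) x = inverse (r x) * ((4 * (deriv W x * cnj (W x)) * (s x * s x) - 4 * (W x * cnj (W x)) * (2 * s x * B x)) / (s x * s x)\<^sup>2)" .
    also have "\<dots> = deriv W x / W x - 2 * (B x / s x)"
    proof -
      have nzW: "W x \<noteq> 0" "cnj (W x) \<noteq> 0" using x by (auto simp: U_def)
      show ?thesis unfolding rW using snz[of x] nzW
        by (simp add: divide_simps power2_eq_square) (simp add: algebra_simps)
    qed
    finally show ?thesis using wirt_cong(1)[OF U(1) x L] by simp
  qed
  have dB: "has_wirt B z (deriv (deriv p) z * cnj (p z) + deriv (deriv q) z * cnj (q z))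
      (deriv p z * cnj (deriv p z) + deriv q z * cnj (deriv q z))"
    unfolding B_def[abs_def]
    by (rule eq, (rule has_wirt_add has_wirt_mult has_wirt_cnj dp dq ddp ddq)+) simp_all
  have "dzb (\<lambda>x. deriv W x / W x - 2 * (B x / s x)) z =
     0 - 2 * (((deriv p z * cnj (deriv p z) + deriv q z * cnj (deriv q z)) * s z - B z * A z) / (s z)\<^sup>2)"
    using has_wirtD(2)[OF has_wirt_diff[OF has_wirt_divide[OF ddW dW z]
        has_wirt_mult[OF has_wirt_const[of 2] has_wirt_divide[OF dB ds snz]]]] by simp
  also have "\<dots> = - 2 * (W z * cnj (W z) / (s z)\<^sup>2)"
  proof -
    \<comment> \<open>Lagrange's identity for the vectors (p, q) and (p', q').\<close>
    have "(deriv p z * cnj (deriv p z) + deriv q z * cnj (deriv q z)) * s z - B z * A z = W z * cnj (W z)"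
      unfolding A_def B_def s_def W by (simp add: algebra_simps)
    then show ?thesis by simp
  qed
  also have "\<dots> = - (r z / 2)" unfolding rW by (simp add: power2_eq_square)
  finally have "dzb (dz (\<lambda>x. complex_of_real (ln (\<rho> x)))) z = - (r z / 2)"
    using wirt_cong(2)[OF U dL] by simp
  then show ?thesis unfolding lap by (simp add: r_def)
qed

lemma fubini_study_conical:
  assumes k: "\<And>z. W z = (z - a) ^ b * k z" "isCont k a" "k a \<noteq> 0"
  shows "\<exists>C>0. \<rho> \<sim>[at a] (\<lambda>x. C * norm (x - a) powr (2 * real b))"
proof -
  define e where "e x = 4 * (norm (k x))\<^sup>2 / ((norm (p x))\<^sup>2 + (norm (q x))\<^sup>2)\<^sup>2" for x
  have c: "isCont p a" "isCont q a"
    using holomorphic_on_imp_continuous_on[OF p] holomorphic_on_imp_continuous_on[OF q]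
    by (simp_all add: continuous_on_eq_continuous_at)
  have "isCont e a" unfolding e_def
    using c k(2) fubini_study_denom_pos[of a] by (intro continuous_intros) auto
  moreover have ea: "e a > 0" unfolding e_def using k(3) fubini_study_denom_pos[of a]
    by (intro divide_pos_pos mult_pos_pos zero_less_power) auto
  ultimately have "((\<lambda>x. e x / e a) \<longlongrightarrow> e a / e a) (at a)"
    by (intro tendsto_intros) (auto simp: isCont_def)
  then have lim: "((\<lambda>x. e x / e a) \<longlongrightarrow> 1) (at a)" using ea by simp
  have "\<forall>\<^sub>F x in at a. x \<noteq> a" by (simp add: eventually_at_filter)
  then have "\<forall>\<^sub>F x in at a. e x / e a = \<rho> x / (e a * norm (x - a) powr (2 * real b))"
  proof eventually_elim
    case (elim x)
    define n where "n = norm (x - a)"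
    have n: "n > 0" using elim by (simp add: n_def)
    have pw: "n powr (2 * real b) = (n ^ b)\<^sup>2"
      using powr_realpow[OF n, of "2 * b"] by (simp add: power_mult mult.commute)
    have "\<rho> x = (n ^ b)\<^sup>2 * e x"
      unfolding \<rho> k(1) e_def n_def by (simp add: norm_mult norm_power power_mult_distrib)
    then show ?case using n unfolding n_def[symmetric] pw by simp
  qed
  from Lim_transform_eventually[OF lim this]
  have "\<rho> \<sim>[at a] (\<lambda>x. e a * norm (x - a) powr (2 * real b))" by (rule asymp_equivI')
  then show ?thesis using ea by blast
qed

end

section \<open>Homogenised polynomials and the construction of the metric\<close>

definition homogenize :: "nat \<Rightarrow> complex poly \<Rightarrow> complex \<Rightarrow> complex \<Rightarrow> complex" where
  "homogenize d X u v = (\<Sum>i\<le>d. coeff X i * u ^ i * v ^ (d - i))"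

lemma homogenize_dehomogenize:
  assumes "degree X \<le> d" "v \<noteq> 0" shows "homogenize d X u v = v ^ d * poly X (u / v)"
proof -
  have "poly X (u / v) = (\<Sum>i\<le>d. coeff X i * (u / v) ^ i)"
    unfolding poly_altdef by (rule sum.mono_neutral_left) (use assms(1) in \<open>auto simp: coeff_eq_0\<close>)
  then have "v ^ d * poly X (u / v) = (\<Sum>i\<le>d. v ^ d * (coeff X i * (u / v) ^ i))" by (simp add: sum_distrib_left)
  also have "\<dots> = homogenize d X u v"
    unfolding homogenize_def
  proof (rule sum.cong)
    fix i assume "i \<in> {..d}"
    then have "v ^ d = v ^ (d - i) * v ^ i" by (simp flip: power_add)
    then show "v ^ d * (coeff X i * (u / v) ^ i) = coeff X i * u ^ i * v ^ (d - i)"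
      using assms(2) by (simp add: power_divide)
  qed simp
  finally show ?thesis by simp
qed

lemma homogenize_0: "homogenize d X u 0 = coeff X d * u ^ d"
proof -
  have "homogenize d X u 0 = (\<Sum>i\<in>{d}. coeff X i * u ^ i * 0 ^ (d - i))"
    unfolding homogenize_def by (rule sum.mono_neutral_right) auto
  then show ?thesis by simp
qed

lemma homogenize_scale: "homogenize d X (t * u) (t * v) = t ^ d * homogenize d X u v"
  unfolding homogenize_def sum_distrib_left
proof (rule sum.cong)
  fix i assume "i \<in> {..d}"
  then have "t ^ d = t ^ i * t ^ (d - i)" by (simp flip: power_add)
  then show "coeff X i * (t * u) ^ i * (t * v) ^ (d - i) = t ^ d * (coeff X i * u ^ i * v ^ (d - i))"
    by (simp add: power_mult_distrib)
qed simp

lemma homogenize_affine_holomorphic: "(\<lambda>z. homogenize d X (u1 * z + u0) (v1 * z + v0)) holomorphic_on S"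
  unfolding homogenize_def by (intro holomorphic_intros)

text \<open>The derivative of u / v is \<open>\<Delta>\<close> over v^2, so the Wronskian is v^(2 D
  - 2) times a factor in u / v. Clearing the denominators of order b1 + b2 leaves exactly v^b3: the
  third zero comes from the degree.\<close>

lemma homogenize_wronskian:
  fixes u1 u0 v1 v0 :: complex
  assumes deg: "degree P \<le> D" "degree Q \<le> D"
    and W: "pderiv P * Q - P * pderiv Q = smult C ([:0, 1:] ^ b1 * [:-1, 1:] ^ b2)"
    and D: "2 * D = b1 + b2 + b3 + 2" and \<Delta>: "\<Delta> = u1 * v0 - u0 * v1" "\<Delta> \<noteq> 0"
  defines "u \<equiv> \<lambda>z. u1 * z + u0" and "v \<equiv> \<lambda>z. v1 * z + v0"
  defines "p \<equiv> \<lambda>z. homogenize D P (u z) (v z)" and "q \<equiv> \<lambda>z. homogenize D Q (u z) (v z)"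
  shows "deriv p z * q z - p z * deriv q z = \<Delta> * C * u z ^ b1 * (u z - v z) ^ b2 * v z ^ b3"
proof -
  have hol: "p holomorphic_on UNIV" "q holomorphic_on UNIV"
    unfolding p_def q_def u_def v_def by (rule homogenize_affine_holomorphic)+
  have main: "deriv p z * q z - p z * deriv q z = \<Delta> * C * u z ^ b1 * (u z - v z) ^ b2 * v z ^ b3"
    if vz: "v z \<noteq> 0" for z
  proof -
    define t where "t = u z / v z"
    have cv: "continuous_on UNIV v" unfolding v_def by (intro continuous_intros)
    have U: "open (v -` (- {0}))" "z \<in> v -` (- {0})"
      using open_vimage[OF _ cv, of "- {0}"] vz by (auto simp: open_Compl)
    have dv: "(v has_field_derivative v1) (at z)" unfolding v_def by (auto intro!: derivative_eq_intros)
    have dt: "((\<lambda>x. u x / v x) has_field_derivative \<Delta> / (v z)\<^sup>2) (at z)"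
      using vz unfolding u_def v_def \<Delta>(1) by (auto intro!: derivative_eq_intros simp: power2_eq_square field_simps)
    have der: "deriv (\<lambda>z. homogenize D X (u z) (v z)) z = of_nat D * v z ^ (D - 1) * v1 * poly X t + v z ^ D * (poly (pderiv X) t * (\<Delta> / (v z)\<^sup>2))"
      if X: "degree X \<le> D" for X
    proof (rule DERIV_imp_deriv)
      have "((\<lambda>x. v x ^ D * poly X (u x / v x)) has_field_derivative
          of_nat D * v z ^ (D - 1) * v1 * poly X t + v z ^ D * (poly (pderiv X) t * (\<Delta> / (v z)\<^sup>2))) (at z)"
        unfolding t_def
        by (rule DERIV_cong[OF DERIV_mult[OF DERIV_power[OF dv] DERIV_chain2[OF poly_DERIV dt]]])
           (simp add: algebra_simps)
      then show "((\<lambda>z. homogenize D X (u z) (v z)) has_field_derivative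
          of_nat D * v z ^ (D - 1) * v1 * poly X t + v z ^ D * (poly (pderiv X) t * (\<Delta> / (v z)\<^sup>2))) (at z)"
        by (rule has_field_derivative_transform_within_open[OF _ U]) (simp add: homogenize_dehomogenize[OF X])
    qed
    have pq: "p z = v z ^ D * poly P t" "q z = v z ^ D * poly Q t"
      unfolding p_def q_def t_def using homogenize_dehomogenize[OF deg(1) vz] homogenize_dehomogenize[OF deg(2) vz] by auto
    have "deriv p z * q z - p z * deriv q z = v z ^ D * v z ^ D * (\<Delta> / (v z)\<^sup>2) * (poly (pderiv P) t * poly Q t - poly P t * poly (pderiv Q) t)"
    proof -
      define e where "e = \<Delta> / (v z)\<^sup>2"
      have "deriv p z = of_nat D * v z ^ (D - 1) * v1 * poly P t + v z ^ D * (poly (pderiv P) t * e)"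
        "deriv q z = of_nat D * v z ^ (D - 1) * v1 * poly Q t + v z ^ D * (poly (pderiv Q) t * e)"
        unfolding p_def q_def e_def by (rule der[OF deg(1)] der[OF deg(2)])+
      then show ?thesis unfolding pq e_def[symmetric] by (simp add: algebra_simps)
    qed
    also have "poly (pderiv P) t * poly Q t - poly P t * poly (pderiv Q) t = poly (pderiv P * Q - P * pderiv Q) t" by simp
    also have "\<dots> = C * (t ^ b1 * (t - 1) ^ b2)" unfolding W by (simp add: poly_power)
    also have "v z ^ D * v z ^ D = v z ^ (b1 + b2 + b3 + 2)" unfolding D[symmetric] by (simp add: mult_2 power_add)
    also have "\<dots> = v z ^ b1 * v z ^ b2 * v z ^ b3 * (v z)\<^sup>2" by (simp add: power_add power2_eq_square)
    also have "v z ^ b1 * v z ^ b2 * v z ^ b3 * (v z)\<^sup>2 * (\<Delta> / (v z)\<^sup>2) * (C * (t ^ b1 * (t - 1) ^ b2))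
       = \<Delta> * C * (v z * t) ^ b1 * (v z * (t - 1)) ^ b2 * v z ^ b3"
      using vz by (simp add: power_mult_distrib)
    also have "v z * t = u z" using vz by (simp add: t_def)
    also have "v z * (t - 1) = u z - v z" using vz by (simp add: t_def right_diff_distrib)
    finally show ?thesis .
  qed
  show ?thesis
  proof (cases "v z = 0")
    case True
    \<comment> \<open>The computation divided by \<open>v\<close>; at its single zero the identity
      follows by continuity of both sides.\<close>
    define E where "E x = deriv p x * q x - p x * deriv q x - \<Delta> * C * u x ^ b1 * (u x - v x) ^ b2 * v x ^ b3" for x
    have "E holomorphic_on UNIV" unfolding E_def u_def v_def
      by (intro holomorphic_intros hol) auto
    then have "continuous_on UNIV E" by (rule holomorphic_on_imp_continuous_on)
    then have "isCont E z" by (simp add: continuous_on_eq_continuous_at)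
    then have lim: "(E \<longlongrightarrow> E z) (at z)" by (rule isContD)
    have "v1 \<noteq> 0" using True \<Delta> by (auto simp: v_def)
    have "v x \<noteq> 0" if "x \<noteq> z" for x
    proof -
      have "v x - v z = v1 * (x - z)" by (simp add: v_def algebra_simps)
      then show ?thesis using True that \<open>v1 \<noteq> 0\<close> by auto
    qed
    then have "E x = 0" if "x \<noteq> z" for x using main[of x] that by (simp add: E_def)
    then have "\<forall>\<^sub>F x in at z. E x = 0" by (simp add: eventually_at_filter)
    then have "(E \<longlongrightarrow> 0) (at z)" by (rule tendsto_eventually)
    with lim have "E z = 0" using tendsto_unique[OF at_neq_bot] by blast
    then show ?thesis by (simp add: E_def)
  qed (rule main)
qed

text \<open>\<open>(cx p z, cy p z)\<close> are homogeneous coordinates of the point with coordinate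
  \<open>z\<close> in the chart of \<open>p\<close>.\<close>

fun cx :: "riemann_sphere \<Rightarrow> complex \<Rightarrow> complex" where
  "cx (Pt a) z = z"
| "cx Infty z = 1"

fun cy :: "riemann_sphere \<Rightarrow> complex \<Rightarrow> complex" where
  "cy (Pt a) z = 1"
| "cy Infty z = z"

lemma lin_chart: "lin_form p (cx p z) (cy p z) = (case p of Pt a \<Rightarrow> 1 | Infty \<Rightarrow> - 1) * (z - coord p)"
  by (cases p) (auto simp: lin_form_def)

lemma chart_coord: "cx p (coord p) = fst (hom p)" "cy p (coord p) = snd (hom p)"
  by (cases p; simp)+

text \<open>The density is first written as a function of homogeneous coordinates. Its homogeneity
  of degree - 4 is the transformation law between the two charts, and its restriction to either
  chart is a Fubini-Study pullback whose Wronskian vanishes to the prescribed orders.\<close>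

theorem metric_exists:
  fixes p1 p2 p3 :: riemann_sphere and \<beta>1 \<beta>2 \<beta>3 :: nat
  assumes ne: "p1 \<noteq> p2" "p1 \<noteq> p3" "p2 \<noteq> p3" and pos: "\<beta>1 > 0" "\<beta>2 > 0" "\<beta>3 > 0"
    and le: "\<beta>1 \<le> \<beta>2" "\<beta>2 \<le> \<beta>3" and N: "\<beta>1 + \<beta>2 = \<beta>3 + 2 * N"
  shows "\<exists>g\<in>Met. has_divisor g (Poly_Mapping.single p1 (real \<beta>1) + Poly_Mapping.single p2 (real \<beta>2)
              + Poly_Mapping.single p3 (real \<beta>3))" (is "\<exists>g\<in>Met. has_divisor g ?D")
proof -
  define d where "d = \<beta>1 + \<beta>2 + 1 - N"
  obtain P Q C where PQ: "degree P = d" "degree Q = N" "C \<noteq> 0"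
    "pderiv P * Q - P * pderiv Q = smult C ([:0, 1:] ^ \<beta>1 * [:-1, 1:] ^ \<beta>2)" "poly Q 0 \<noteq> 0" "poly Q 1 \<noteq> 0"
    "jacobi_op \<beta>1 \<beta>2 (of_nat N * of_nat d) Q = 0"
    using jacobi_pair[OF N le pos(1), folded d_def] by (elim exE conjE)
  \<comment> \<open>The Riemann-Hurwitz count for a map of degree \<open>d\<close>: the total
    ramification \<beta>1 + \<beta>2 + \<beta>3 is 2 d - 2.\<close>
  have d2: "2 * d = \<beta>1 + \<beta>2 + \<beta>3 + 2" and Nd: "N \<le> d" "d > 0" using N le by (auto simp: d_def)
  have P0: "P \<noteq> 0" using PQ(1) Nd by auto
  define k1 where "k1 = lin_form p3 (fst (hom p2)) (snd (hom p2))"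
  define k3 where "k3 = lin_form p2 (fst (hom p1)) (snd (hom p1))"
  define k2 where "k2 = lin_form p3 (fst (hom p1)) (snd (hom p1))"
  have k: "k1 \<noteq> 0" "k2 \<noteq> 0" "k3 \<noteq> 0"
    using ne by (auto simp: k1_def k2_def k3_def lin_hom_eq_0_iff)
  \<comment> \<open>By the Pluecker relation, \<open>u / v\<close> maps \<open>p1, p2, p3\<close> to \<open>0, 1, \<infinity>\<close>.\<close>
  define u where "u x y = k1 * lin_form p1 x y" for x y
  define v where "v x y = - k3 * lin_form p3 x y" for x y
  have uv: "u x y - v x y = k2 * lin_form p2 x y" for x y
    by (simp add: u_def v_def k1_def k2_def k3_def lin_form_def algebra_simps)
  define \<alpha> \<beta> where "\<alpha> = k1 * snd (hom p1)" and "\<beta> = - k1 * fst (hom p1)"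
  define \<gamma> \<delta> where "\<gamma> = - k3 * snd (hom p3)" and "\<delta> = k3 * fst (hom p3)"
  have ua: "u x y = \<alpha> * x + \<beta> * y" and va: "v x y = \<gamma> * x + \<delta> * y" for x y
    by (simp_all add: u_def v_def \<alpha>_def \<beta>_def \<gamma>_def \<delta>_def lin_form_def algebra_simps)
  define \<Delta> where "\<Delta> = \<alpha> * \<delta> - \<beta> * \<gamma>"
  have "\<Delta> = - (k1 * k2 * k3)" by (simp add: \<Delta>_def \<alpha>_def \<beta>_def \<gamma>_def \<delta>_def k2_def lin_form_def algebra_simps)
  then have \<Delta>: "\<Delta> \<noteq> 0" using k by simp
  have uvnz: "u x y \<noteq> 0 \<or> v x y \<noteq> 0" if "x \<noteq> 0 \<or> y \<noteq> 0" for x y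
  proof (rule ccontr)
    assume "\<not> (u x y \<noteq> 0 \<or> v x y \<noteq> 0)"
    then have 0: "u x y = 0" "v x y = 0" by auto
    have "\<Delta> * x = \<delta> * u x y - \<beta> * v x y" "\<Delta> * y = \<alpha> * v x y - \<gamma> * u x y"
      by (simp_all add: \<Delta>_def ua va algebra_simps)
    then show False using 0 \<Delta> that by simp
  qed
  \<comment> \<open>At infinity the leading coefficient of \<open>P\<close>, of degree exactly
    \<open>d\<close>, survives. Elsewhere a common zero would be a zero of the Wronskian, hence 0 or
    1, where \<open>Q\<close> does not vanish.\<close>
  have nocommon: "homogenize d P s t \<noteq> 0 \<or> homogenize d Q s t \<noteq> 0" if st: "s \<noteq> 0 \<or> t \<noteq> 0" for s t
  proof (cases "t = 0")
    case True
    then show ?thesis using st PQ(1) P0 by (simp add: homogenize_0 flip: PQ(1))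
  next
    case False
    show ?thesis
    proof (rule ccontr)
      assume "\<not> ?thesis"
      then have z: "poly P (s / t) = 0" "poly Q (s / t) = 0"
        using homogenize_dehomogenize[of P d t s] homogenize_dehomogenize[of Q d t s] PQ(1,2) Nd False by auto
      have "poly (smult C ([:0, 1:] ^ \<beta>1 * [:-1, 1:] ^ \<beta>2)) (s / t) = 0" unfolding PQ(4)[symmetric] using z by simp
      then have "s / t = 0 \<or> s / t = 1" using PQ(3) by (auto simp: poly_power)
      then show False using z PQ(5,6) by auto
    qed
  qed
  define \<rho> where "\<rho> x y = 4 * (norm (\<Delta> * C * u x y ^ \<beta>1 * (u x y - v x y) ^ \<beta>2 * v x y ^ \<beta>3))\<^sup>2
     / ((norm (homogenize d P (u x y) (v x y)))\<^sup>2 + (norm (homogenize d Q (u x y) (v x y)))\<^sup>2)\<^sup>2" for x y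
  define g where "g = \<lparr>coeff_z = (\<lambda>z. \<rho> z 1), coeff_w = (\<lambda>w. \<rho> 1 w)\<rparr>"
  have ga: "coeff_at g p z = \<rho> (cx p z) (cy p z)" for p z by (cases p) (auto simp: g_def)
  \<comment> \<open>Numerator and denominator have degrees 2 (\<beta>1 + \<beta>2 + \<beta>3) and 4
    d, which by \<open>d2\<close> differ by 4.\<close>
  have scale: "\<rho> (t * x) (t * y) = \<rho> x y / norm t ^ 4" if t: "t \<noteq> 0" for t x y
  proof -
    define n where "n = norm t"
    have n: "n > 0" using t by (simp add: n_def)
    have tu: "u (t * x) (t * y) = t * u x y" "v (t * x) (t * y) = t * v x y" by (simp_all add: ua va algebra_simps)
    define X where "X = norm (\<Delta> * C * u x y ^ \<beta>1 * (u x y - v x y) ^ \<beta>2 * v x y ^ \<beta>3)"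
    define S where "S = (norm (homogenize d P (u x y) (v x y)))\<^sup>2 + (norm (homogenize d Q (u x y) (v x y)))\<^sup>2"
    have "\<Delta> * C * (t * u x y) ^ \<beta>1 * (t * u x y - t * v x y) ^ \<beta>2 * (t * v x y) ^ \<beta>3
        = t ^ (\<beta>1 + \<beta>2 + \<beta>3) * (\<Delta> * C * u x y ^ \<beta>1 * (u x y - v x y) ^ \<beta>2 * v x y ^ \<beta>3)"
      unfolding right_diff_distrib[symmetric] by (simp add: power_mult_distrib power_add mult_ac)
    then have N1: "norm (\<Delta> * C * (t * u x y) ^ \<beta>1 * (t * u x y - t * v x y) ^ \<beta>2 * (t * v x y) ^ \<beta>3) = n ^ (\<beta>1 + \<beta>2 + \<beta>3) * X"
      unfolding X_def n_def by (simp only: norm_mult norm_power)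
    have N2: "(norm (homogenize d P (t * u x y) (t * v x y)))\<^sup>2 + (norm (homogenize d Q (t * u x y) (t * v x y)))\<^sup>2 = (n ^ d)\<^sup>2 * S"
      unfolding homogenize_scale S_def n_def by (simp add: norm_mult norm_power power_mult_distrib distrib_left)
    have dd: "n ^ d * n ^ d = n ^ (\<beta>1 + \<beta>2 + \<beta>3) * n\<^sup>2"
      using d2 by (metis mult_2 power_add add.assoc)
    have n4: "(n ^ d)\<^sup>2 * (n ^ d)\<^sup>2 = (n ^ (\<beta>1 + \<beta>2 + \<beta>3))\<^sup>2 * n ^ 4"
    proof -
      have "(n ^ d)\<^sup>2 * (n ^ d)\<^sup>2 = (n ^ d * n ^ d)\<^sup>2" by (simp add: power_mult_distrib)
      also have "\<dots> = (n ^ (\<beta>1 + \<beta>2 + \<beta>3))\<^sup>2 * n ^ 4" unfolding dd by (simp add: power_mult_distrib)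
      finally show ?thesis .
    qed
    have "\<rho> (t * x) (t * y) = 4 * (n ^ (\<beta>1 + \<beta>2 + \<beta>3) * X)\<^sup>2 / ((n ^ d)\<^sup>2 * S)\<^sup>2"
      unfolding \<rho>_def tu N1 N2 ..
    also have "((n ^ d)\<^sup>2 * S)\<^sup>2 = (n ^ (\<beta>1 + \<beta>2 + \<beta>3))\<^sup>2 * n ^ 4 * S\<^sup>2"
      unfolding n4[symmetric] by (simp add: power_mult_distrib power2_eq_square)
    also have "4 * (n ^ (\<beta>1 + \<beta>2 + \<beta>3) * X)\<^sup>2 / ((n ^ (\<beta>1 + \<beta>2 + \<beta>3))\<^sup>2 * n ^ 4 * S\<^sup>2) = 4 * X\<^sup>2 / S\<^sup>2 / n ^ 4"
      using n by (simp add: power_mult_distrib)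
    also have "4 * X\<^sup>2 / S\<^sup>2 = \<rho> x y" by (simp add: \<rho>_def X_def S_def)
    finally show ?thesis by (simp add: n_def)
  qed
  have cp: "conformal_pseudometric g"
    unfolding conformal_pseudometric_def
  proof (intro conjI allI impI)
    show "coeff_z g z \<ge> 0" "coeff_w g z \<ge> 0" for z by (auto simp: g_def \<rho>_def)
    show "coeff_w g w = coeff_z g (1 / w) / norm w ^ 4" if "w \<noteq> 0" for w
      using scale[OF that, of "1 / w" 1] that by (simp add: g_def)
  qed
  define pp where "pp p z = homogenize d P (u (cx p z) (cy p z)) (v (cx p z) (cy p z))" for p z
  define qq where "qq p z = homogenize d Q (u (cx p z) (cy p z)) (v (cx p z) (cy p z))" for p z
  \<comment> \<open>In the chart at infinity the parameter sits in the other homogeneous coordinate,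
    which reverses the sign of the determinant.\<close>
  define \<Delta>' where "\<Delta>' p = (case p of Pt a \<Rightarrow> \<Delta> | Infty \<Rightarrow> - \<Delta>)" for p
  have \<Delta>': "\<Delta>' p \<noteq> 0" "norm (\<Delta>' p * y) = norm (\<Delta> * y)" for p y using \<Delta> by (cases p; simp add: \<Delta>'_def norm_mult)+
  define WW where "WW p z = \<Delta>' p * C * u (cx p z) (cy p z) ^ \<beta>1 * (u (cx p z) (cy p z) - v (cx p z) (cy p z)) ^ \<beta>2 * v (cx p z) (cy p z) ^ \<beta>3" for p z
  have deg: "degree P \<le> d" "degree Q \<le> d" using PQ(1,2) Nd by auto
  have wr: "pp p holomorphic_on UNIV \<and> qq p holomorphic_on UNIV \<and> (\<forall>z. WW p z = deriv (pp p) z * qq p z - pp p z * deriv (qq p) z)" for p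
  proof (cases p)
    case (Pt a)
    have e: "pp p = (\<lambda>z. homogenize d P (\<alpha> * z + \<beta>) (\<gamma> * z + \<delta>))" "qq p = (\<lambda>z. homogenize d Q (\<alpha> * z + \<beta>) (\<gamma> * z + \<delta>))"
      using Pt by (auto simp: pp_def qq_def ua va)
    show ?thesis unfolding e using homogenize_wronskian[OF deg PQ(4) d2 \<Delta>_def \<Delta>] Pt homogenize_affine_holomorphic
      by (simp add: WW_def \<Delta>'_def ua va)
  next
    case Infty
    have e: "pp p = (\<lambda>z. homogenize d P (\<beta> * z + \<alpha>) (\<delta> * z + \<gamma>))" "qq p = (\<lambda>z. homogenize d Q (\<beta> * z + \<alpha>) (\<delta> * z + \<gamma>))"
      using Infty by (auto simp: pp_def qq_def ua va add.commute)
    have D: "- \<Delta> = \<beta> * \<gamma> - \<alpha> * \<delta>" "- \<Delta> \<noteq> 0" using \<Delta> by (simp_all add: \<Delta>_def)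
    show ?thesis unfolding e using homogenize_wronskian[OF deg PQ(4) d2 D] Infty homogenize_affine_holomorphic
      by (simp add: WW_def \<Delta>'_def ua va add.commute)
  qed
  have cnz: "cx p z \<noteq> 0 \<or> cy p z \<noteq> 0" for p z by (cases p) auto
  have nz: "pp p z \<noteq> 0 \<or> qq p z \<noteq> 0" for p z
    unfolding pp_def qq_def by (rule nocommon[OF uvnz[OF cnz]])
  have rho: "coeff_at g p z = 4 * (norm (WW p z))\<^sup>2 / ((norm (pp p z))\<^sup>2 + (norm (qq p z))\<^sup>2)\<^sup>2" for p z
    unfolding ga \<rho>_def WW_def pp_def qq_def mult.assoc \<Delta>'(2) ..
  note FS = wr[THEN conjunct1] wr[THEN conjunct2, THEN conjunct1] nz wr[THEN conjunct2, THEN conjunct2, rule_format] rho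
  note fs_smooth = fubini_study_smooth[OF FS] and fs_pos = fubini_study_pos[OF FS]
    and fs_lap = fubini_study_laplacian[OF FS] and fs_con = fubini_study_conical[OF FS]
  have WW0: "WW p (coord p) \<noteq> 0" if "p \<noteq> p1" "p \<noteq> p2" "p \<noteq> p3" for p
    using that \<Delta>'(1) PQ(3) k unfolding WW_def uv unfolding chart_coord
    by (auto simp: u_def v_def lin_hom_eq_0_iff)
  have keys: "p \<in> Poly_Mapping.keys ?D \<longleftrightarrow> p \<in> {p1, p2, p3}" for p
    using ne pos by (auto simp: in_keys_iff lookup_add lookup_single when_def)
  have reg: "regular_at g p" if p: "p \<noteq> p1" "p \<noteq> p2" "p \<noteq> p3" for p
  proof -
    have "isCont (WW p) (coord p)"
      using holomorphic_on_imp_continuous_on[OF fubini_study_wronskian_holomorphic[OF FS]]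
      by (simp add: continuous_on_eq_continuous_at)
    then obtain r where r: "r > 0" "\<And>y. dist (coord p) y < r \<Longrightarrow> WW p y \<noteq> 0"
      using continuous_at_avoid[of "coord p" "WW p" 0] WW0[OF p] by blast
    have "Ck_on j (ball (coord p) r) f" if "Ck_on j UNIV f" for j and f :: "complex \<Rightarrow> real"
      using that by (induction j arbitrary: f) (auto intro: continuous_on_subset)
    then have "smooth_on (ball (coord p) r) (coeff_at g p)" using fs_smooth by (simp add: smooth_on_def)
    moreover have "\<forall>x\<in>ball (coord p) r. coeff_at g p x > 0" using r(2) fs_pos by auto
    ultimately show ?thesis unfolding regular_at_def using r(1) by blast
  qed
  have curv: "gauss_curvature g p = 1" if p: "p \<noteq> p1" "p \<noteq> p2" "p \<noteq> p3" for p
    unfolding gauss_curvature_def fs_lap[OF WW0[OF p]] using fs_pos[OF WW0[OF p]] by simp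
  have contu: "isCont (\<lambda>z. lin_form p (cx p' z) (cy p' z)) z" for p p' z
    unfolding lin_form_def by (cases p') (auto intro!: continuous_intros)
  define \<epsilon> :: "riemann_sphere \<Rightarrow> complex" where "\<epsilon> p = (case p of Pt a \<Rightarrow> 1 | Infty \<Rightarrow> - 1)" for p
  have \<epsilon>: "\<epsilon> p \<noteq> 0" for p by (cases p) (auto simp: \<epsilon>_def)
  have con: "conical_at g p (real b)" if "WW p = (\<lambda>z. (z - coord p) ^ b * k z)" "isCont k (coord p)" "k (coord p) \<noteq> 0" for p b k
    unfolding conical_at_def using fs_con[of p "coord p" b k] that by auto
  have c1: "conical_at g p1 \<beta>1"
  proof (rule con)
    let ?k = "\<lambda>z. \<Delta>' p1 * C * (k1 * \<epsilon> p1) ^ \<beta>1 * (k2 * lin_form p2 (cx p1 z) (cy p1 z)) ^ \<beta>2 * (- k3 * lin_form p3 (cx p1 z) (cy p1 z)) ^ \<beta>3"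
    show "WW p1 = (\<lambda>z. (z - coord p1) ^ \<beta>1 * ?k z)"
      unfolding WW_def uv unfolding u_def v_def lin_chart \<epsilon>_def[symmetric] by (simp add: power_mult_distrib mult_ac)
    show "isCont ?k (coord p1)" by (intro continuous_intros contu)
    show "?k (coord p1) \<noteq> 0" using \<Delta>'(1) PQ(3) k \<epsilon> ne unfolding chart_coord by (simp add: lin_hom_eq_0_iff)
  qed
  have c2: "conical_at g p2 \<beta>2"
  proof (rule con)
    let ?k = "\<lambda>z. \<Delta>' p2 * C * (k1 * lin_form p1 (cx p2 z) (cy p2 z)) ^ \<beta>1 * (k2 * \<epsilon> p2) ^ \<beta>2 * (- k3 * lin_form p3 (cx p2 z) (cy p2 z)) ^ \<beta>3"
    show "WW p2 = (\<lambda>z. (z - coord p2) ^ \<beta>2 * ?k z)"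
      unfolding WW_def uv unfolding u_def v_def lin_chart \<epsilon>_def[symmetric] by (simp add: power_mult_distrib mult_ac)
    show "isCont ?k (coord p2)" by (intro continuous_intros contu)
    show "?k (coord p2) \<noteq> 0" using \<Delta>'(1) PQ(3) k \<epsilon> ne unfolding chart_coord by (simp add: lin_hom_eq_0_iff)
  qed
  have c3: "conical_at g p3 \<beta>3"
  proof (rule con)
    let ?k = "\<lambda>z. \<Delta>' p3 * C * (k1 * lin_form p1 (cx p3 z) (cy p3 z)) ^ \<beta>1 * (k2 * lin_form p2 (cx p3 z) (cy p3 z)) ^ \<beta>2 * (- k3 * \<epsilon> p3) ^ \<beta>3"
    have e: "(- k3 * (\<epsilon> p3 * y)) ^ \<beta>3 = y ^ \<beta>3 * (- k3 * \<epsilon> p3) ^ \<beta>3" for y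
      unfolding power_mult_distrib[symmetric] by (simp add: mult_ac)
    show "WW p3 = (\<lambda>z. (z - coord p3) ^ \<beta>3 * ?k z)"
      unfolding WW_def uv unfolding u_def v_def lin_chart \<epsilon>_def[symmetric] e by (simp only: mult_ac)
    show "isCont ?k (coord p3)" by (intro continuous_intros contu)
    show "?k (coord p3) \<noteq> 0" using \<Delta>'(1) PQ(3) k \<epsilon> ne unfolding chart_coord by (simp add: lin_hom_eq_0_iff)
  qed
  have lk: "Poly_Mapping.lookup ?D p1 = \<beta>1" "Poly_Mapping.lookup ?D p2 = \<beta>2" "Poly_Mapping.lookup ?D p3 = \<beta>3"
    using ne by (auto simp: lookup_add lookup_single)
  have hd: "has_divisor g ?D"
    unfolding has_divisor_def
  proof (intro conjI ballI allI impI)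
    show "conical_at g p (Poly_Mapping.lookup ?D p)" if "p \<in> Poly_Mapping.keys ?D" for p
    proof -
      have "p = p1 \<or> p = p2 \<or> p = p3" using that unfolding keys by simp
      then show ?thesis by (elim disjE) (simp_all only: lk c1 c2 c3)
    qed
    show "regular_at g p" if "p \<notin> Poly_Mapping.keys ?D" for p
      by (rule reg) (use that in \<open>auto simp: keys\<close>)
  qed
  moreover have "g \<in> Met" unfolding Met_def using cp hd curv keys by blast
  ultimately show ?thesis by blast
qed

theorem proposition3p3:
  fixes p1 p2 p3 :: riemann_sphere and \<beta>1 \<beta>2 \<beta>3 :: nat
  assumes "p1 \<noteq> p2" and "p1 \<noteq> p3" and "p2 \<noteq> p3"
    and "\<beta>1 > 0" and "\<beta>2 > 0" and "\<beta>3 > 0"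
    and "\<beta>1 \<le> \<beta>2" and "\<beta>2 \<le> \<beta>3"
  shows "(\<exists>g\<in>Met. has_divisor g
             (Poly_Mapping.single p1 (real \<beta>1) + Poly_Mapping.single p2 (real \<beta>2)
              + Poly_Mapping.single p3 (real \<beta>3)))
    \<longleftrightarrow>
    (\<exists>(N::nat) (a :: nat \<Rightarrow> complex).
        inj_on a {1..N} \<and>
        (\<forall>j\<in>{1..N}. a j \<noteq> 0 \<and> a j \<noteq> 1) \<and>
        int \<beta>1 + int \<beta>2 - int \<beta>3 = 2 * int N \<and>
        (\<forall>j\<in>{1..N}.
           of_nat \<beta>1 / a j + of_nat \<beta>2 / (a j - 1)
             - (\<Sum>k\<in>{1..N} - {j}. 2 / (a j - a k)) = 0))" (is "?L \<longleftrightarrow> ?R")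
proof
  assume ?L
  then obtain N where N: "\<beta>1 + \<beta>2 = \<beta>3 + 2 * N"
    using metric_parity[OF assms(1-8)] by blast
  obtain a :: "nat \<Rightarrow> complex" where "inj_on a {1..N}" "\<forall>j\<in>{1..N}. a j \<noteq> 0 \<and> a j \<noteq> 1"
    "\<forall>j\<in>{1..N}. of_nat \<beta>1 / a j + of_nat \<beta>2 / (a j - 1) - (\<Sum>k\<in>{1..N} - {j}. 2 / (a j - a k)) = 0"
    using jacobi_roots_system[OF N assms(7,8,4)] by blast
  moreover have "int \<beta>1 + int \<beta>2 - int \<beta>3 = 2 * int N" using N by linarith
  ultimately show ?R by (intro exI[of _ N] exI[of _ a]) simp
next
  assume ?R
  then obtain N :: nat where "int \<beta>1 + int \<beta>2 - int \<beta>3 = 2 * int N" by blast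
  then have "\<beta>1 + \<beta>2 = \<beta>3 + 2 * N" by linarith
  then show ?L by (rule metric_exists[OF assms(1-8)])
qed

end
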